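(* Let $h\colon\mathbb D\to\mathbb D$ be a holomorphic map, and let $\pi\colon\mathbb D\to V$ and $g\colon U\to V$ be holomorphic covering maps, where $V=\widehat{\mathbb C}-P$ with $3\le|P|<\infty$ and $U\subset V$ is a domain of $\widehat{\mathbb C}$. Suppose that $\pi(h(\mathbb D))\subset U$ and $\pi=g\circ\pi\circ h$. If the map $g\colon U\to V$ is non-injective, then exactly one of the following two possibilities is satisfied: (1) for every $z\in\mathbb D$, the $h$-orbit of $z$ converges to the unique fixed point of $h$ (in $\mathbb D$), or (2) the sequence $(\pi(h^{\circ n}(z)))_n$ converges to the same repelling fixed point $x\in P$ of the map $g$, regardless of the choice of $z\in\mathbb D$.
   Context: $\mathbb D$ is the open unit disk. A point $x\in\widehat{\mathbb C}$ is a fixed point of a holomorphic map $g\colon U\to V$ between domains of $\widehat{\mathbb C}$ if either $x\in U$ and $g(x)=x$, or $x$ is an isolated removable singularity of $g$ (i.e. a punctured neighborhood of $x$ lies in $U$ and $g$ extends holomorphically, as a map to $\widehat{\mathbb C}$, to $x$) and the extension satisfies $g(x)=x$. It is repelling if the multiplier of the (extended) map $g$ at $x$ has absolute value greater than $1$. *)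

theory Defs
  imports "HOL-Complex_Analysis.Complex_Analysis"
begin

text \<open>
  The Riemann sphere is \<^typ>\<open>complex option\<close>, the one-point compactification of the plane:
  \<^term>\<open>Some z\<close> is the finite point \<^term>\<open>z\<close>, and \<^term>\<open>None\<close> is the point at infinity.
\<close>

instantiation option :: (topological_space) topological_space
begin

definition open_option :: "'a option set \<Rightarrow> bool" where
  "open_option W \<longleftrightarrow> openin (Alexandroff_compactification euclidean) W"

instance
proof
  have "openin (Alexandroff_compactification euclidean)
          (topspace (Alexandroff_compactification (euclidean :: 'a topology)))"
    by (rule openin_topspace)
  then show "open (UNIV :: 'a option set)"
    by (simp add: open_option_def UNIV_option_conv)
qed (auto simp: open_option_def)

end

instance option :: (heine_borel) t2_space
proof
  fix x y :: "'a option"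
  assume "x \<noteq> y"
  moreover have "Hausdorff_space (Alexandroff_compactification (euclidean :: 'a topology))"
    by (simp add: Hausdorff_space_Alexandroff_compactification locally_compact_space_euclidean)
  moreover have "topspace (Alexandroff_compactification (euclidean :: 'a topology)) = UNIV"
    by (simp add: UNIV_option_conv)
  ultimately show "\<exists>U V. open U \<and> open V \<and> x \<in> U \<and> y \<in> V \<and> U \<inter> V = {}"
    unfolding open_option_def Hausdorff_space_def disjnt_def by blast
qed

type_synonym riemann_sphere = "complex option"

fun sphere_inverse :: "riemann_sphere \<Rightarrow> riemann_sphere" where
  "sphere_inverse None = Some 0"
| "sphere_inverse (Some z) = (if z = 0 then None else Some (1 / z))"

text \<open>
  The two standard charts of the sphere are \<^term>\<open>the\<close>, on the complement of
  \<^term>\<open>None\<close>, and \<^term>\<open>the \<circ> sphere_inverse\<close>, on the complement of \<^term>\<open>Some 0\<close>; their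
  inverses are \<^term>\<open>Some\<close> and \<^term>\<open>sphere_inverse \<circ> Some\<close>. Both predicates below
  are intended for open sets: then continuity makes the sets on which the chart expressions are
  required to be holomorphic open as well.
\<close>

definition holomorphic_to_sphere_on ::
    "(complex \<Rightarrow> riemann_sphere) \<Rightarrow> complex set \<Rightarrow> bool" where
  "holomorphic_to_sphere_on f A \<longleftrightarrow>
     continuous_on A f \<and>
     (the \<circ> f) holomorphic_on {z \<in> A. f z \<noteq> None} \<and>
     (the \<circ> sphere_inverse \<circ> f) holomorphic_on {z \<in> A. f z \<noteq> Some 0}"

definition sphere_holomorphic_on ::
    "(riemann_sphere \<Rightarrow> riemann_sphere) \<Rightarrow> riemann_sphere set \<Rightarrow> bool" where
  "sphere_holomorphic_on g U \<longleftrightarrow>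
     holomorphic_to_sphere_on (g \<circ> Some) {z. Some z \<in> U} \<and>
     holomorphic_to_sphere_on (g \<circ> sphere_inverse \<circ> Some) {z. sphere_inverse (Some z) \<in> U}"

text \<open>
  The derivative of \<^term>\<open>g\<close> at a fixed point \<^term>\<open>x\<close>, in the coordinate \<open>1 / z\<close>
  when \<^term>\<open>x\<close> is the point at infinity.
\<close>

definition multiplier :: "(riemann_sphere \<Rightarrow> riemann_sphere) \<Rightarrow> riemann_sphere \<Rightarrow> complex" where
  "multiplier g x =
     (case x of
        Some z \<Rightarrow> deriv (the \<circ> g \<circ> Some) z
      | None \<Rightarrow> deriv (the \<circ> sphere_inverse \<circ> g \<circ> sphere_inverse \<circ> Some) 0)"

text \<open>
  \<^term>\<open>x\<close> is an isolated removable singularity of the holomorphic map \<^term>\<open>g\<close> on the open set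
  \<^term>\<open>U\<close>, and \<^term>\<open>G\<close> is the extension. The values of \<^term>\<open>G\<close> outside
  \<^term>\<open>insert x U\<close> are irrelevant.
\<close>

definition removable_extension ::
    "riemann_sphere set \<Rightarrow> (riemann_sphere \<Rightarrow> riemann_sphere) \<Rightarrow> riemann_sphere \<Rightarrow>
     (riemann_sphere \<Rightarrow> riemann_sphere) \<Rightarrow> bool" where
  "removable_extension U g x G \<longleftrightarrow>
     x \<notin> U \<and> (\<exists>N. open N \<and> x \<in> N \<and> N - {x} \<subseteq> U) \<and>
     sphere_holomorphic_on G (insert x U) \<and> (\<forall>u\<in>U. G u = g u)"

definition repelling_fixed_point ::
    "riemann_sphere set \<Rightarrow> (riemann_sphere \<Rightarrow> riemann_sphere) \<Rightarrow> riemann_sphere \<Rightarrow> bool" where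
  "repelling_fixed_point U g x \<longleftrightarrow>
     (x \<in> U \<and> g x = x \<and> norm (multiplier g x) > 1) \<or>
     (\<exists>G. removable_extension U g x G \<and> G x = x \<and> norm (multiplier G x) > 1)"

end

theory Submission
  imports Defs "HOL-Combinatorics.Cycles"
    "HOL-Computational_Algebra.Fundamental_Theorem_Algebra"
begin

text \<open>
  After a Moebius change of coordinate a puncture lies at infinity, and \<open>V\<close> is the complement of
  a finite set \<open>Q\<close> in the plane. A surjective self-map of that set permutes the ends, so an iterate
  is a polynomial totally ramified over two points of \<open>Q\<close> and hence affine; thus \<open>U \<noteq> V\<close> when
  \<open>g\<close> is non-injective.

  A map of the disc omitting a point \<open>b\<close> contracts the pseudohyperbolic distance by a definite
  factor within bounded distance of \<open>b\<close>. This makes any fixed point of \<open>h\<close> attract all orbits, and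
  produces a fixed point as soon as an orbit comes infinitely often within bounded distance of
  preimages of points outside \<open>U\<close>. Lifting \<open>\<pi>\<close> through itself moves such preimages near the orbit
  whenever \<open>\<pi> ((h ^^ n) z)\<close> accumulates in \<open>V\<close>. So without a fixed point the projected orbit leaves
  all compact sets, and by Schottky's theorem it converges to a puncture \<open>q\<close> independent of \<open>z\<close>. If
  points outside \<open>U\<close> accumulated at \<open>q\<close>, the projected orbit, moving in bounded steps, would pass them
  along short circles about \<open>q\<close>; hence \<open>q\<close> is isolated in the complement of \<open>U\<close>, and by Picard's
  theorem \<open>g\<close> extends to \<open>q\<close> with multiplier \<open>\<lambda> \<noteq> 0\<close>. On the half-plane covering a punctured disc at
  \<open>q\<close>, \<open>\<pi> \<circ> h ^^ m\<close> coincides near the puncture with the \<open>m\<close>-th iterate of the local inverse of \<open>g\<close>.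
  It therefore descends to a holomorphic map of a disc about \<open>q\<close> with derivative \<open>\<lambda>\<close> to the power
  \<open>-m\<close>. For large \<open>m\<close> it maps a fixed circle close to \<open>q\<close>, which forces \<open>\<bar>\<lambda>\<bar> > 1\<close>.
\<close>

section \<open>The pseudohyperbolic distance\<close>

text \<open>This is tanh of half the hyperbolic distance of curvature -1. The expression
  \<open>(r + s) / (1 + r * s)\<close> that recurs below is accordingly the addition formula of
  tanh.\<close>

definition pdist :: "complex \<Rightarrow> complex \<Rightarrow> real" where
  "pdist w z = cmod (Moebius_function 0 w z)"

lemma pdist_altdef: "pdist w z = cmod (z - w) / cmod (1 - cnj w * z)"
  by (simp add: pdist_def Moebius_function_simple norm_divide)

lemma pdist_nonneg [simp]: "0 \<le> pdist w z"
  by (simp add: pdist_def)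

lemma pdist_refl [simp]: "pdist w w = 0"
  by (simp add: pdist_altdef)

lemma pdist_0_left [simp]: "pdist 0 z = cmod z"
  by (simp add: pdist_altdef)

lemma pdist_commute: "pdist w z = pdist z w"
proof -
  have "cmod (1 - cnj w * z) = cmod (cnj (1 - cnj w * z))"
    by (simp only: complex_mod_cnj)
  also have "\<dots> = cmod (1 - cnj z * w)"
    by (simp add: mult.commute)
  finally show ?thesis
    by (simp add: pdist_altdef norm_minus_commute)
qed

lemma one_minus_cnj_mult_nz: "cmod w < 1 \<Longrightarrow> cmod z < 1 \<Longrightarrow> 1 - cnj w * z \<noteq> 0"
  by (metis complex_mod_cnj norm_mult_less norm_one less_irrefl mult_1 right_minus_eq)

lemma pdist_lt_1: "cmod w < 1 \<Longrightarrow> cmod z < 1 \<Longrightarrow> pdist w z < 1"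
  by (simp add: pdist_def Moebius_function_norm_lt_1)

text \<open>Both \<open>D\<^sup>2 - N\<^sup>2\<close> and
  \<open>(1 + x * y)\<^sup>2 - (x + y)\<^sup>2\<close> equal \<open>K\<close>. Thus the squared
  distance is 1 - K / D^2, which is largest when \<open>D\<close> attains its upper bound
  \<open>1 + x * y\<close>.\<close>

lemma pdist_le_norms:
  assumes "cmod a < 1" "cmod c < 1"
  shows "pdist a c \<le> (cmod a + cmod c) / (1 + cmod a * cmod c)"
proof -
  define x y N D where "x = cmod a" and "y = cmod c" and "N = cmod (c - a)"
    and "D = cmod (1 - cnj a * c)"
  define K where "K = (1 - x\<^sup>2) * (1 - y\<^sup>2)"
  have xy: "0 \<le> x" "x < 1" "0 \<le> y" "y < 1"
    using assms by (auto simp: x_def y_def)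
  have D0: "D > 0"
    using one_minus_cnj_mult_nz[OF assms] by (simp add: D_def)
  have "K \<ge> 0"
    using xy by (simp add: K_def power_le_one)
  have NDK: "N\<^sup>2 = D\<^sup>2 - K"
    unfolding N_def D_def K_def x_def y_def cmod_power2 by (simp add: power2_eq_square algebra_simps)
  have "D \<le> 1 + x * y"
    unfolding D_def x_def y_def by (metis complex_mod_cnj norm_mult norm_one norm_triangle_ineq4)
  then have D2: "D\<^sup>2 \<le> (1 + x * y)\<^sup>2"
    using D0 by (intro power_mono) auto
  have K': "K = (1 + x * y)\<^sup>2 - (x + y)\<^sup>2"
    by (simp add: K_def power2_eq_square algebra_simps)
  have "K * D\<^sup>2 \<le> K * (1 + x * y)\<^sup>2"
    using D2 \<open>K \<ge> 0\<close> by (rule mult_left_mono)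
  then have "(N * (1 + x * y))\<^sup>2 \<le> ((x + y) * D)\<^sup>2"
  proof -
    assume *: "K * D\<^sup>2 \<le> K * (1 + x * y)\<^sup>2"
    have "(N * (1 + x * y))\<^sup>2 = D\<^sup>2 * (1 + x * y)\<^sup>2 - K * (1 + x * y)\<^sup>2"
      by (simp only: power_mult_distrib NDK left_diff_distrib)
    also have "\<dots> \<le> D\<^sup>2 * (1 + x * y)\<^sup>2 - K * D\<^sup>2"
      using * by simp
    also have "\<dots> = ((x + y) * D)\<^sup>2"
      unfolding power_mult_distrib K' by (simp add: algebra_simps)
    finally show ?thesis .
  qed
  then have "N * (1 + x * y) \<le> (x + y) * D"
    by (rule power2_le_imp_le) (use xy D0 in auto)
  moreover have "1 + x * y > 0"
    using xy by (simp add: add_pos_nonneg)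
  ultimately have "N / D \<le> (x + y) / (1 + x * y)"
    using D0 by (simp add: divide_simps mult.commute)
  then show ?thesis
    by (simp add: pdist_altdef N_def D_def x_def y_def)
qed

lemma add_div_mono:
  fixes x :: real
  assumes "0 \<le> x" "x \<le> x'" "x' \<le> 1" "0 \<le> y" "y \<le> y'" "y' \<le> 1"
  shows "(x + y) / (1 + x * y) \<le> (x' + y') / (1 + x' * y')"
proof -
  have aux: "(u + v) / (1 + u * v) \<le> (u' + v) / (1 + u' * v)"
    if "0 \<le> u" "u \<le> u'" "0 \<le> v" "v \<le> 1" for u u' v :: real
  proof -
    have "0 \<le> (u' - u) * (1 - v\<^sup>2)"
      using that by (simp add: power_le_one)
    then have "(u + v) * (1 + u' * v) \<le> (u' + v) * (1 + u * v)"
      by (simp add: algebra_simps power2_eq_square)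
    moreover have "1 + u * v > 0" "1 + u' * v > 0"
      using that by (auto intro!: add_pos_nonneg)
    ultimately show ?thesis
      by (simp add: divide_simps)
  qed
  have "(x + y) / (1 + x * y) \<le> (x' + y) / (1 + x' * y)"
    using aux assms by simp
  also have "\<dots> \<le> (x' + y') / (1 + x' * y')"
    using aux[of y y' x'] assms by (simp add: add.commute mult.commute)
  finally show ?thesis .
qed

text \<open>Moebius maps moving \<open>a\<close> and \<open>h a\<close> to 0 reduce the inequality
  to the Schwarz lemma for the conjugated map \<open>?f\<close>.\<close>

lemma Schwarz_Pick:
  assumes holh: "h holomorphic_on ball 0 1" and h: "h ` ball 0 1 \<subseteq> ball 0 1"
    and a: "cmod a < 1" and b: "cmod b < 1"
  shows "pdist (h a) (h b) \<le> pdist a b"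
proof -
  have ha: "cmod (h a) < 1"
    using h a by (auto simp: image_subset_iff)
  let ?f = "\<lambda>z. Moebius_function 0 (h a) (h (Moebius_function 0 (- a) z))"
  have im: "Moebius_function 0 (- a) ` ball 0 1 \<subseteq> ball 0 1"
    using Moebius_function_norm_lt_1 a by auto
  have "(Moebius_function 0 (h a) \<circ> (h \<circ> Moebius_function 0 (- a))) holomorphic_on ball 0 1"
    by (intro holomorphic_on_compose_gen[where t = "ball 0 1"] Moebius_function_holomorphic holh)
       (use ha a im h in auto)
  then have hol: "?f holomorphic_on ball 0 1"
    by (simp add: o_def)
  have f0: "?f 0 = 0"
    by (simp add: Moebius_function_of_zero Moebius_function_eq_zero)
  have lt: "cmod (?f z) < 1" if "cmod z < 1" for z
    using that a ha h im by (intro Moebius_function_norm_lt_1) (auto simp: image_subset_iff)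
  define z where "z = Moebius_function 0 a b"
  have z: "cmod z < 1"
    using a b by (simp add: z_def Moebius_function_norm_lt_1)
  have "Moebius_function 0 (- a) z = b"
    unfolding z_def using a b by (intro Moebius_function_compose) auto
  then show ?thesis
    using Schwarz_Lemma(1)[OF hol f0 lt z] by (simp add: pdist_def z_def)
qed

text \<open>The Moebius map and its inverse are both holomorphic self-maps of the disc, so
  Schwarz-Pick gives the two inequalities.\<close>

lemma pdist_Moebius:
  assumes "cmod b < 1" "cmod u < 1" "cmod v < 1"
  shows "pdist (Moebius_function 0 b u) (Moebius_function 0 b v) = pdist u v"
proof (rule antisym)
  have M: "Moebius_function 0 c holomorphic_on ball 0 1"
    "Moebius_function 0 c ` ball 0 1 \<subseteq> ball 0 1" if "cmod c < 1" for c
    using that Moebius_function_norm_lt_1 by (auto intro: Moebius_function_holomorphic)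
  show "pdist (Moebius_function 0 b u) (Moebius_function 0 b v) \<le> pdist u v"
    using Schwarz_Pick[OF M] assms by auto
  have "pdist (Moebius_function 0 (- b) (Moebius_function 0 b u))
          (Moebius_function 0 (- b) (Moebius_function 0 b v))
      \<le> pdist (Moebius_function 0 b u) (Moebius_function 0 b v)"
    using assms by (intro Schwarz_Pick M) (auto simp: Moebius_function_norm_lt_1)
  then show "pdist u v \<le> pdist (Moebius_function 0 b u) (Moebius_function 0 b v)"
    using assms by (simp add: Moebius_function_compose)
qed

text \<open>Moving the middle point \<open>b\<close> to 0 turns the two distances into norms. Unlike
  the sum \<open>r + s\<close>, this bound stays below 1 whenever \<open>r\<close> and
  \<open>s\<close> do, which is what keeps contraction factors below 1 later on.\<close>

lemma pdist_strong_triangle: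
  assumes "cmod u < 1" "cmod v < 1" "cmod b < 1" "pdist u b \<le> r" "pdist b v \<le> s" "r \<le> 1" "s \<le> 1"
  shows "pdist u v \<le> (r + s) / (1 + r * s)"
proof -
  have "pdist u v = pdist (Moebius_function 0 b u) (Moebius_function 0 b v)"
    using assms by (simp add: pdist_Moebius)
  also have "\<dots> \<le> (pdist b u + pdist b v) / (1 + pdist b u * pdist b v)"
    unfolding pdist_def[of b] using assms by (intro pdist_le_norms Moebius_function_norm_lt_1)
  also have "\<dots> \<le> (r + s) / (1 + r * s)"
    using assms by (intro add_div_mono) (auto simp: pdist_commute)
  finally show ?thesis .
qed

lemma pdist_triangle:
  assumes "cmod u < 1" "cmod v < 1" "cmod b < 1"
  shows "pdist u v \<le> pdist u b + pdist b v"
proof -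
  have "pdist u v \<le> (pdist u b + pdist b v) / (1 + pdist u b * pdist b v)"
    using assms pdist_lt_1 by (intro pdist_strong_triangle[of _ _ b]) (auto simp: less_imp_le)
  also have "\<dots> \<le> (pdist u b + pdist b v) / 1"
    by (intro divide_left_mono) (auto intro: add_pos_nonneg)
  finally show ?thesis by simp
qed

lemma add_div_lt_1: "0 \<le> r \<Longrightarrow> r < 1 \<Longrightarrow> 0 \<le> s \<Longrightarrow> s < 1 \<Longrightarrow> (r + s) / (1 + r * s) < (1::real)"
proof -
  assume *: "0 \<le> r" "r < 1" "0 \<le> s" "s < 1"
  then have "0 < (1 - r) * (1 - s)" by simp
  then have "r + s < 1 + r * s" by (simp add: algebra_simps)
  then show ?thesis using * by (simp add: divide_simps add_pos_nonneg)
qed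

text \<open>A map omitting \<open>b\<close> factors through the squaring map after \<open>b\<close> is moved to \<open>0\<close>, and
  \<open>pdist (s\<^sup>2) (t\<^sup>2) = pdist s t * pdist s (- t)\<close>.\<close>

lemma pdist_contraction_omitting:
  assumes holh: "h holomorphic_on ball 0 1" and h: "h ` ball 0 1 \<subseteq> ball 0 1"
    and b: "cmod b < 1" "b \<notin> h ` ball 0 1"
    and u: "cmod u < 1" "pdist b (h u) \<le> r" and v: "cmod v < 1" "pdist b (h v) \<le> r" and r: "r \<le> 1"
  shows "pdist (h u) (h v) \<le> (2 * sqrt r / (1 + r)) * pdist u v"
proof -
  let ?F = "\<lambda>z. Moebius_function 0 b (h z)"
  have "(Moebius_function 0 b \<circ> h) holomorphic_on ball 0 1"
    using b h by (intro holomorphic_on_compose_gen[where t = "ball 0 1"] Moebius_function_holomorphic holh) auto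
  then have holF: "?F holomorphic_on ball 0 1"
    by (simp add: o_def)
  have Fnz: "?F z \<noteq> 0" if "z \<in> ball 0 1" for z
    using b h that one_minus_cnj_mult_nz[of b "h z"]
    by (auto simp: Moebius_function_simple image_subset_iff)
  \<comment> \<open>A holomorphic square root exists because \<open>?F\<close> has no zero on the
    convex disc.\<close>
  obtain S where holS: "S holomorphic_on ball 0 1" and S: "\<And>z. z \<in> ball 0 1 \<Longrightarrow> ?F z = S z ^ 2"
    using contractible_imp_holomorphic_sqrt[OF holF convex_imp_contractible Fnz] by auto
  have nS: "cmod (S z) ^ 2 = pdist b (h z)" if "z \<in> ball 0 1" for z
    using S[OF that] by (simp add: pdist_def norm_power)
  have S1: "cmod (S z) < 1" if "z \<in> ball 0 1" for z
  proof -
    have "cmod (S z) ^ 2 < 1"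
      using nS[OF that] pdist_lt_1[of b "h z"] b h that by (auto simp: image_subset_iff)
    then show ?thesis
      by (simp add: power_less_one_iff)
  qed
  have Sr: "cmod (S z) \<le> sqrt r" if "cmod z < 1" "pdist b (h z) \<le> r" for z
    using nS[of z] that by (simp add: real_le_rsqrt)
  define s t where "s = S u" and "t = S v"
  have st: "cmod s < 1" "cmod t < 1" "cmod s \<le> sqrt r" "cmod t \<le> sqrt r"
    using S1 Sr u v by (auto simp: s_def t_def)
  have r0: "0 \<le> r"
    using u(2) pdist_nonneg[of b "h u"] by linarith
  have prod: "pdist (s ^ 2) (t ^ 2) = pdist s t * pdist s (- t)"
  proof -
    have "cmod (t\<^sup>2 - s\<^sup>2) = cmod (t - s) * cmod (- t - s)"
      by (metis (no_types, lifting) add.commute minus_add_distrib norm_minus_cancel norm_mult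
          power2_eq_square square_diff_square_factored uminus_add_conv_diff mult.commute)
    moreover have "cmod (1 - cnj (s\<^sup>2) * t\<^sup>2) = cmod (1 - cnj s * t) * cmod (1 - cnj s * (- t))"
    proof -
      have "1 - cnj (s\<^sup>2) * t\<^sup>2 = (1 - cnj s * t) * (1 - cnj s * (- t))"
        by (simp add: power2_eq_square algebra_simps)
      then show ?thesis by (simp only: norm_mult)
    qed
    ultimately show ?thesis by (simp add: pdist_altdef)
  qed
  \<comment> \<open>The factor \<open>pdist s t\<close> is at most \<open>pdist u v\<close> by
    Schwarz-Pick for \<open>S\<close>. The gain comes from this second factor, since
    \<open>s\<close> and \<open>t\<close> both have modulus at most \<open>sqrt r\<close>.\<close>
  have "pdist s (- t) \<le> (cmod s + cmod t) / (1 + cmod s * cmod t)"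
    using pdist_le_norms[of s "- t"] st by simp
  also have "\<dots> \<le> (sqrt r + sqrt r) / (1 + sqrt r * sqrt r)"
    using st r by (intro add_div_mono) auto
  also have "\<dots> = 2 * sqrt r / (1 + r)"
    using r0 by simp
  finally have fac: "pdist s (- t) \<le> 2 * sqrt r / (1 + r)" .
  have "pdist (h u) (h v) = pdist (?F u) (?F v)"
    using b h u v by (subst pdist_Moebius) (auto simp: image_subset_iff)
  also have "\<dots> = pdist s t * pdist s (- t)"
    using u v S prod by (simp add: s_def t_def)
  also have "\<dots> \<le> pdist u v * (2 * sqrt r / (1 + r))"
  proof (rule mult_mono)
    show "pdist s t \<le> pdist u v"
      unfolding s_def t_def using S1 u v by (intro Schwarz_Pick holS) auto
  qed (use fac in auto)
  finally show ?thesis by (simp add: mult.commute)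
qed

lemma contraction_factor_lt_1:
  fixes r :: real
  assumes "0 \<le> r" "r < 1"
  shows "2 * sqrt r / (1 + r) < 1"
proof -
  have "0 < (1 - sqrt r)\<^sup>2"
    using assms by auto
  also have "\<dots> = 1 - 2 * sqrt r + r"
    using assms by (simp add: power2_eq_square algebra_simps)
  finally show ?thesis using assms by (simp add: divide_simps)
qed

section \<open>Schottky's theorem on pseudohyperbolic discs\<close>

text \<open>The map \<open>?m\<close> carries the closed unit disc onto the pseudohyperbolic disc of
  radius \<open>\<rho>'\<close> about \<open>w\<close>. Schottky's theorem for \<open>F\<close>
  composed with \<open>?m\<close> gives a bound that involves only \<open>R\<close> and
  \<open>t\<close>, hence is the same for all \<open>w\<close> and \<open>w'\<close>.\<close>

lemma Schottky_pdist:
  fixes R \<rho> :: real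
  assumes F: "F holomorphic_on ball 0 1" "\<And>z. z \<in> ball 0 1 \<Longrightarrow> F z \<noteq> 0 \<and> F z \<noteq> 1"
    and "\<rho> < 1"
  obtains B where "\<And>w w'. \<lbrakk>cmod w < 1; cmod w' < 1; pdist w w' \<le> \<rho>; cmod (F w) \<le> R\<rbrakk>
      \<Longrightarrow> cmod (F w') \<le> B"
proof -
  define \<rho>0 where "\<rho>0 = max \<rho> 0"
  define \<rho>' where "\<rho>' = (1 + \<rho>0) / 2"
  \<comment> \<open>Schottky's theorem wants a radius strictly between 0 and 1; the value 1/2
    replaces the ratio when that ratio would be 0.\<close>
  define t where "t = (if \<rho>0 = 0 then 1 / 2 else \<rho>0 / \<rho>')"
  have \<rho>: "0 \<le> \<rho>0" "\<rho>0 < \<rho>'" "\<rho>' < 1" "\<rho> \<le> \<rho>0"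
    using assms by (auto simp: \<rho>0_def \<rho>'_def)
  have t: "0 < t" "t < 1"
    using \<rho> by (auto simp: t_def)
  show thesis
  proof (rule that)
    fix w w'
    assume w: "cmod w < 1" "cmod w' < 1" "pdist w w' \<le> \<rho>" "cmod (F w) \<le> R"
    let ?m = "\<lambda>z. Moebius_function 0 (- w) (of_real \<rho>' * z)"
    have m: "cmod (of_real \<rho>' * z) < 1" if "cmod z \<le> 1" for z
    proof -
      have "cmod (of_real \<rho>' * z) = \<rho>' * cmod z"
        using \<rho> by (simp add: norm_mult)
      also have "\<dots> \<le> \<rho>' * 1"
        using that \<rho> by (intro mult_left_mono) auto
      finally show ?thesis using \<rho> by simp
    qed
    have "(F \<circ> (Moebius_function 0 (- w) \<circ> (\<lambda>z. of_real \<rho>' * z))) holomorphic_on cball 0 1"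
      by (intro holomorphic_on_compose_gen[where t = "ball 0 1"] Moebius_function_holomorphic F
          holomorphic_intros) (use w m in \<open>auto simp: Moebius_function_norm_lt_1\<close>)
    then have hol: "(\<lambda>z. F (?m z)) holomorphic_on cball 0 1"
      by (simp add: o_def)
    have 0: "cmod (F (?m 0)) \<le> R"
      using w by (simp add: Moebius_function_of_zero)
    have no: "\<not> (F (?m z) = 0 \<or> F (?m z) = 1)" if "z \<in> cball 0 1" for z
      using F(2)[of "?m z"] that m[of z] w by (auto simp: Moebius_function_norm_lt_1)
    define z where "z = Moebius_function 0 w w' / of_real \<rho>'"
    have "cmod z = pdist w w' / \<rho>'"
      using \<rho> by (simp add: z_def pdist_def norm_divide)
    also have "\<dots> \<le> \<rho>0 / \<rho>'"
      using w \<rho> by (intro divide_right_mono) auto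
    also have "\<dots> \<le> t"
      using \<rho> by (simp add: t_def)
    finally have zt: "cmod z \<le> t" .
    have "?m z = w'"
    proof -
      have "of_real \<rho>' * z = Moebius_function 0 w w'"
        using \<rho> by (simp add: z_def)
      then show ?thesis
        using w by (simp add: Moebius_function_compose)
    qed
    then show "cmod (F w') \<le> exp(pi * exp(pi * (2 + 2 * R + 12 * t / (1 - t))))"
      using Schottky[OF hol 0 no t zt] by simp
  qed
qed

section \<open>Surjective self-maps of a punctured plane\<close>

text \<open>The great Picard theorem applies to \<open>f - a\<close>, which omits 0 and
  \<open>b - a\<close>, and gives a finite limit of this function or of its reciprocal. A reciprocal
  tending to 0 is the case of a pole.\<close>

lemma puncture_limit:
  assumes "open M" "z \<in> M" "a \<noteq> b" and holf: "f holomorphic_on (M - {z})"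
    and fab: "\<And>w. w \<in> M - {z} \<Longrightarrow> f w \<noteq> a \<and> f w \<noteq> b"
  shows "(\<exists>l. (f \<longlongrightarrow> l) (at z)) \<or> filterlim f at_infinity (at z)"
proof -
  have nz: "\<forall>\<^sub>F w in at z. f w - a \<noteq> 0"
    using fab assms(1,2) unfolding eventually_at_topological by auto
  obtain l where l: "((\<lambda>w. f w - a) \<longlongrightarrow> l) (at z) \<or> ((inverse \<circ> (\<lambda>w. f w - a)) \<longlongrightarrow> l) (at z)"
  proof (rule great_Picard[of M z 0 "b - a" "\<lambda>w. f w - a"])
    show "(\<lambda>w. f w - a) holomorphic_on M - {z}"
      by (intro holomorphic_intros holf)
  qed (use assms in auto)
  show ?thesis
    using l
  proof
    assume "((\<lambda>w. f w - a) \<longlongrightarrow> l) (at z)"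
    then have "((\<lambda>w. (f w - a) + a) \<longlongrightarrow> l + a) (at z)"
      by (intro tendsto_intros)
    then show ?thesis by auto
  next
    assume inv: "((inverse \<circ> (\<lambda>w. f w - a)) \<longlongrightarrow> l) (at z)"
    show ?thesis
    proof (cases "l = 0")
      case False
      have "((\<lambda>w. inverse ((inverse \<circ> (\<lambda>w. f w - a)) w) + a) \<longlongrightarrow> inverse l + a) (at z)"
        using inv False by (intro tendsto_intros) (auto simp: o_def)
      then show ?thesis by auto
    next
      case True
      have "filterlim (\<lambda>w. inverse (f w - a)) (at 0) (at z)"
        using inv True nz by (auto simp: filterlim_at o_def elim: eventually_mono)
      then have "filterlim (\<lambda>w. inverse (inverse (f w - a))) at_infinity (at z)"
        by (rule filterlim_compose[OF filterlim_inverse_at_infinity])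
      then have "filterlim (\<lambda>w. a + (f w - a)) at_infinity (at z)"
        by (intro tendsto_add_filterlim_at_infinity[OF tendsto_const]) simp
      then show ?thesis by simp
    qed
  qed
qed

text \<open>After splitting off the full power of the linear factor at \<open>q\<close>, the
  cofactor has no root, so it is constant by the fundamental theorem of algebra.\<close>

lemma poly_single_root:
  fixes r :: "complex poly"
  assumes "\<And>z. poly r z = 0 \<longleftrightarrow> z = q"
  obtains c n where "c \<noteq> 0" "n > 0" "r = smult c ([:-q, 1:] ^ n)"
proof -
  have r0: "r \<noteq> 0"
    using assms[of "q + 1"] by auto
  obtain s where s: "r = [:-q, 1:] ^ order q r * s" and nd: "\<not> [:-q, 1:] dvd s"
    using order_decomp[OF r0] by blast
  have sq: "poly s q \<noteq> 0"
    using nd by (simp add: poly_eq_0_iff_dvd)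
  have "poly s z \<noteq> 0" for z
  proof
    assume "poly s z = 0"
    then have "poly r z = 0"
      by (subst s) simp
    then show False
      using assms sq \<open>poly s z = 0\<close> by auto
  qed
  then have "constant (poly s)"
    using Fundamental_Theorem_Algebra.fundamental_theorem_of_algebra[of s] by metis
  then obtain c where c: "s = [:c:]"
    unfolding constant_degree by (auto elim: degree_eq_zeroE)
  have "order q r \<noteq> 0"
    using r0 assms[of q] by (simp add: order_root)
  moreover have "r = smult c ([:-q, 1:] ^ order q r)"
    by (subst s) (simp add: c)
  ultimately show thesis
    using that[of c "order q r"] sq c by auto
qed

text \<open>Both \<open>p - q\<close> and \<open>p - q'\<close> are constant multiples of powers of
  linear factors. The derivative computed from the second form does not vanish at \<open>q\<close>,
  so the exponent \<open>n\<close> in the first form is 1 and \<open>p\<close> is affine.\<close>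

lemma poly_two_totally_ramified:
  fixes p :: "complex poly"
  assumes "q \<noteq> q'" and q: "\<And>z. poly p z = q \<longleftrightarrow> z = q" and q': "\<And>z. poly p z = q' \<longleftrightarrow> z = q'"
  shows "inj (poly p)"
proof -
  obtain c n where c: "c \<noteq> 0" "n > 0" "p - [:q:] = smult c ([:-q, 1:] ^ n)"
    using poly_single_root[of "p - [:q:]" q] q by auto
  obtain c' n' where c': "c' \<noteq> 0" "n' > 0" "p - [:q':] = smult c' ([:-q', 1:] ^ n')"
    using poly_single_root[of "p - [:q':]" q'] q' by auto
  have pd: "pderiv p = smult (c * of_nat n) ([:-q, 1:] ^ (n - 1))"
  proof -
    have "pderiv p = pderiv (p - [:q:])" by (simp add: pderiv_diff)
    then show ?thesis using c(2)
      by (cases n) (simp_all add: c(3) pderiv_smult pderiv_power_Suc pderiv_pCons algebra_simps del: power_Suc)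
  qed
  have pd': "pderiv p = smult (c' * of_nat n') ([:-q', 1:] ^ (n' - 1))"
  proof -
    have "pderiv p = pderiv (p - [:q':])" by (simp add: pderiv_diff)
    then show ?thesis using c'(2)
      by (cases n') (simp_all add: c'(3) pderiv_smult pderiv_power_Suc pderiv_pCons algebra_simps del: power_Suc)
  qed
  have "poly (pderiv p) q \<noteq> 0"
    using c' assms(1) by (simp add: pd')
  then have "n = 1"
    using c(2) by (cases "n = 1") (auto simp: pd)
  then have "p = [:q:] + smult c [:-q, 1:]"
    using c(3) by (simp add: algebra_simps)
  then have "poly p z = q + c * (z - q)" for z
    by (simp add: algebra_simps)
  then show ?thesis
    using c(1) by (auto simp: inj_on_def)
qed

section \<open>Ends of a punctured plane, described by filters\<close>

text \<open>Neighbourhoods of a point of the sphere as seen from the plane. This treats infinity and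
  finite points alike while all maps remain between subsets of the plane.\<close>

definition sphere_nhds :: "complex option \<Rightarrow> complex filter" where
  "sphere_nhds p = (case p of None \<Rightarrow> at_infinity | Some l \<Rightarrow> nhds l)"

text \<open>Intersecting with \<open>- Q\<close> gives the filter of an end: it is
  \<open>at q\<close> for a finite puncture and \<open>at_infinity\<close> for infinity, as the two
  evaluation lemmas below record.\<close>

definition puncture_filter :: "complex set \<Rightarrow> complex option \<Rightarrow> complex filter" where
  "puncture_filter Q p = inf (sphere_nhds p) (principal (- Q))"

lemma sphere_nhds_unique:
  assumes "F \<noteq> bot" "filterlim g (sphere_nhds p) F" "filterlim g (sphere_nhds p') F"
  shows "p = p'"
  using assms not_tendsto_and_filterlim_at_infinity[of F g] tendsto_unique[of F g]
  by (cases p; cases p') (auto simp: sphere_nhds_def)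

lemma puncture_filter_None:
  assumes "finite Q"
  shows "puncture_filter Q None = at_infinity"
proof -
  have "\<forall>\<^sub>F z in at_infinity. z \<in> - Q"
  proof -
    obtain B where B: "\<And>q. q \<in> Q \<Longrightarrow> cmod q \<le> B"
      using finite_imp_bounded[OF assms] unfolding bounded_pos by blast
    have "z \<in> - Q" if "B + 1 \<le> cmod z" for z
      using B[of z] that by auto
    then show ?thesis
      unfolding eventually_at_infinity by blast
  qed
  then show ?thesis
    by (simp add: puncture_filter_def sphere_nhds_def inf_absorb1 le_principal)
qed

lemma puncture_filter_Some:
  assumes "finite Q" "q \<in> Q"
  shows "puncture_filter Q (Some q) = at q"
proof -
  have "open (- (Q - {q}))"
    using assms by (intro open_Compl finite_imp_closed finite_Diff)
  then have "at q within - Q = at q within UNIV"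
    using assms by (intro at_within_nhd[of q "- (Q - {q})"]) auto
  moreover have "at q within - Q = puncture_filter Q (Some q)"
    using assms by (simp add: puncture_filter_def sphere_nhds_def at_within_def)
  ultimately show ?thesis by simp
qed

text \<open>Every end \<open>p'\<close> is the limit of \<open>g\<close> along some end
  \<open>\<rho> p'\<close>. Uniqueness of limits makes \<open>\<rho>\<close> injective on the finite
  set of ends, hence a permutation of finite order \<open>k\<close>. The iterate
  \<open>g ^^ k\<close> then fixes every end and extends to a polynomial that takes the values
  \<open>a\<close> and \<open>b\<close> only at \<open>a\<close> and \<open>b\<close>; such a
  polynomial is injective, and so is \<open>g\<close>.\<close>

lemma surjective_self_map_injective:
  assumes Q: "finite Q" "2 \<le> card Q" and holg: "g holomorphic_on - Q" and surj: "g ` (- Q) = - Q"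
  shows "inj_on g (- Q)"
proof -
  obtain a b where ab: "a \<in> Q" "b \<in> Q" "a \<noteq> b"
  proof -
    have "\<not> card Q \<le> Suc 0"
      using Q(2) by simp
    then show ?thesis
      using that card_le_Suc0_iff_eq[OF Q(1)] by blast
  qed
  define P where "P = insert None (Some ` Q)"
  let ?pf = "puncture_filter Q"
  have openV: "open (- Q)"
    using Q by (simp add: finite_imp_closed open_Compl)
  have gV: "g z \<in> - Q" if "z \<in> - Q" for z
    using surj that by blast
  have gab: "g z \<noteq> a" "g z \<noteq> b" if "z \<notin> Q" for z
    using gV[of z] that ab by auto
  have nontriv: "?pf p \<noteq> bot" if "p \<in> P" for p
    using that Q trivial_limit_at_infinity[where 'a = complex]
    by (auto simp: P_def puncture_filter_None puncture_filter_Some)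
  have limit: "\<exists>s. filterlim g (sphere_nhds s) (?pf p)" if "p \<in> P" for p
  proof (cases p)
    case (Some q)
    then have q: "q \<in> Q" using that by (auto simp: P_def)
    have "(\<exists>l. (g \<longlongrightarrow> l) (at q)) \<or> filterlim g at_infinity (at q)"
    proof (rule puncture_limit[of "- (Q - {q})" q a b])
      show "g holomorphic_on - (Q - {q}) - {q}"
        by (rule holomorphic_on_subset[OF holg]) auto
      show "open (- (Q - {q}))"
        using Q by (intro open_Compl finite_imp_closed finite_Diff)
    qed (use Q ab gab in auto)
    then show ?thesis
      unfolding Some puncture_filter_Some[OF Q(1) q]
    proof
      assume "\<exists>l. (g \<longlongrightarrow> l) (at q)"
      then obtain l where "filterlim g (sphere_nhds (Some l)) (at q)"
        by (auto simp: sphere_nhds_def)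
      then show "\<exists>s. filterlim g (sphere_nhds s) (at q)" ..
    next
      assume "filterlim g at_infinity (at q)"
      then have "filterlim g (sphere_nhds None) (at q)"
        by (simp add: sphere_nhds_def)
      then show "\<exists>s. filterlim g (sphere_nhds s) (at q)" ..
    qed
  next
    case None
    obtain B where B: "B > 0" "\<And>q. q \<in> Q \<Longrightarrow> cmod q \<le> B"
      using finite_imp_bounded[OF Q(1)] unfolding bounded_pos by blast
    have inv: "inverse w \<notin> Q" if "w \<in> ball 0 (1 / B) - {0}" for w
    proof
      assume "inverse w \<in> Q"
      from B(2)[OF this] have "inverse (cmod w) \<le> B"
        by (simp add: norm_inverse)
      then show False
        using that B(1) by (simp add: field_simps)
    qed
    have "(\<exists>l. ((g \<circ> inverse) \<longlongrightarrow> l) (at 0)) \<or> filterlim (g \<circ> inverse) at_infinity (at 0)"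
    proof (rule puncture_limit[of "ball 0 (1 / B)" 0 a b])
      show "(g \<circ> inverse) holomorphic_on ball 0 (1 / B) - {0}"
        by (intro holomorphic_on_compose_gen[OF _ holg] holomorphic_intros) (use inv in auto)
    qed (use B inv ab gab in auto)
    then have "(\<exists>l. (g \<longlongrightarrow> l) at_infinity) \<or> filterlim g at_infinity at_infinity"
      by (simp add: at_to_infinity filterlim_filtermap o_def)
    then show ?thesis
      unfolding None puncture_filter_None[OF Q(1)]
    proof
      assume "\<exists>l. (g \<longlongrightarrow> l) (at_infinity)"
      then obtain l where "filterlim g (sphere_nhds (Some l)) (at_infinity)"
        by (auto simp: sphere_nhds_def)
      then show "\<exists>s. filterlim g (sphere_nhds s) (at_infinity)" ..
    next
      assume "filterlim g at_infinity (at_infinity)"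
      then have "filterlim g (sphere_nhds None) (at_infinity)"
        by (simp add: sphere_nhds_def)
      then show "\<exists>s. filterlim g (sphere_nhds s) (at_infinity)" ..
    qed
  qed
  have upgrade: "filterlim g (?pf p') F"
    if "filterlim g (sphere_nhds p') F" "F \<le> principal (- Q)" for F p'
  proof -
    have "\<forall>\<^sub>F x in F. x \<in> - Q"
      using that(2) by (simp only: le_principal)
    then have "\<forall>\<^sub>F x in F. g x \<in> - Q"
      by (rule eventually_mono) (rule gV)
    then show ?thesis
      using that(1) by (simp only: puncture_filter_def filterlim_inf filterlim_principal)
  qed
  \<comment> \<open>\<open>F\<close> is the pullback of the end \<open>p'\<close> under
    \<open>g\<close>; surjectivity makes it nontrivial. It has a cluster point \<open>p\<close> on
    the compact sphere. At a point of \<open>- Q\<close> continuity would force \<open>g\<close> to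
    tend to a value in \<open>- Q\<close> instead of \<open>p'\<close>, so \<open>p\<close> is a
    puncture.\<close>
  have "\<exists>p\<in>P. filterlim g (?pf p') (?pf p)" if p': "p' \<in> P" for p'
  proof -
    define F where "F = inf (filtercomap g (?pf p')) (principal (- Q))"
    have F: "F \<noteq> bot"
    proof
      assume "F = bot"
      then have "eventually (\<lambda>_. False) F"
        by simp
      then have "\<forall>\<^sub>F x in filtercomap g (?pf p'). x \<in> - Q \<longrightarrow> False"
        unfolding F_def eventually_inf_principal .
      then obtain A where A: "eventually A (?pf p')" "\<And>x. A (g x) \<Longrightarrow> x \<in> Q"
        unfolding eventually_filtercomap by auto
      have "\<forall>\<^sub>F y in ?pf p'. y \<in> - Q"
        by (simp add: puncture_filter_def eventually_inf_principal)
      with A(1) have "\<forall>\<^sub>F y in ?pf p'. A y \<and> y \<in> - Q"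
        by (rule eventually_conj)
      then obtain y where "A y" "y \<in> - Q"
        using eventually_happens'[OF nontriv[OF p']] by blast
      then obtain x where "x \<in> - Q" "g x = y"
        using surj by (metis imageE)
      then show False using A(2)[of x] \<open>A y\<close> by auto
    qed
    have limF: "filterlim g (sphere_nhds p') F"
    proof -
      have "filterlim g (?pf p') F"
        unfolding F_def by (rule filterlim_mono[OF filterlim_filtercomap]) auto
      then show ?thesis
        by (rule filterlim_mono) (auto simp: puncture_filter_def)
    qed
    \<comment> \<open>Compactness of the sphere in filter form: if \<open>F\<close> does not cluster
      at infinity, it eventually lies in a closed disc.\<close>
    obtain p where p: "inf F (sphere_nhds p) \<noteq> bot"
    proof (cases "inf F at_infinity = bot")
      case False
      then show ?thesis using that[of None] by (simp add: sphere_nhds_def)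
    next
      case True
      then have "eventually (\<lambda>_. False) (inf F at_infinity)"
        by simp
      then obtain A B where AB: "eventually A F" "eventually B at_infinity" "\<And>x. A x \<Longrightarrow> B x \<Longrightarrow> False"
        unfolding eventually_inf by auto
      obtain R where R: "\<And>x. R \<le> cmod x \<Longrightarrow> B x"
        using AB(2) by (auto simp: eventually_at_infinity)
      have "\<forall>\<^sub>F x in F. x \<in> cball 0 R"
        using AB(1)
      proof (rule eventually_mono)
        fix x assume "A x"
        then show "x \<in> cball 0 R" using AB(3) R[of x] by (cases "R \<le> cmod x") auto
      qed
      then obtain x where "inf (nhds x) F \<noteq> bot"
        using F compact_cball[of "0 :: complex" R] unfolding compact_filter le_principal by blast
      then show ?thesis using that[of "Some x"] by (simp add: sphere_nhds_def inf_commute)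
    qed
    define G where "G = inf F (sphere_nhds p)"
    have G: "G \<noteq> bot" "G \<le> F" "G \<le> ?pf p"
      using p by (auto simp: G_def F_def puncture_filter_def intro: le_infI1)
    have limG: "filterlim g (sphere_nhds p') G"
      using limF G(2) by (rule filterlim_mono[OF _ order_refl])
    have pP: "p \<in> P"
    proof (rule ccontr)
      assume "p \<notin> P"
      then obtain x where x: "p = Some x" "x \<in> - Q"
        by (cases p) (auto simp: P_def)
      have "isCont g x"
        using holomorphic_on_imp_continuous_on[OF holg] openV x by (simp add: continuous_on_eq_continuous_at)
      then have "(g \<longlongrightarrow> g x) (nhds x)"
        by (simp add: continuous_at tendsto_nhds_iff)
      then have "filterlim g (sphere_nhds (Some (g x))) G"
        by (simp add: sphere_nhds_def G_def x(1) filterlim_mono[OF _ order_refl])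
      then have "p' = Some (g x)"
        using sphere_nhds_unique[OF G(1) limG] by blast
      then show False using gV[OF x(2)] p' by (auto simp: P_def)
    qed
    obtain s where s: "filterlim g (sphere_nhds s) (?pf p)"
      using limit[OF pP] by blast
    then have "filterlim g (sphere_nhds s) G"
      using G(3) by (rule filterlim_mono[OF _ order_refl])
    then have "s = p'"
      using sphere_nhds_unique[OF G(1) _ limG] by blast
    then show ?thesis
      using upgrade[of p' "?pf p"] s pP by (auto simp: puncture_filter_def)
  qed
  then obtain \<rho> where \<rho>: "\<And>p. p \<in> P \<Longrightarrow> \<rho> p \<in> P \<and> filterlim g (?pf p) (?pf (\<rho> p))"
    by metis
  have inj\<rho>: "inj_on \<rho> P"
  proof (rule inj_onI)
    fix p1 p2 assume p: "p1 \<in> P" "p2 \<in> P" "\<rho> p1 = \<rho> p2"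
    have "filterlim g (sphere_nhds p) (?pf (\<rho> p))" if "p \<in> P" for p
      using \<rho>[OF that] by (auto simp: puncture_filter_def filterlim_inf)
    from this[of p1] this[of p2] show "p1 = p2"
      using p(1,2) \<rho>[OF p(1)] nontriv unfolding p(3) by (intro sphere_nhds_unique) auto
  qed
  \<comment> \<open>Extension by the identity turns \<open>\<rho>\<close> into a permutation of the
    whole type, for which a power equal to \<open>id\<close> is available.\<close>
  define \<sigma> where "\<sigma> p = (if p \<in> P then \<rho> p else p)" for p
  have finP: "finite P"
    using Q by (simp add: P_def)
  have "\<sigma> permutes P"
  proof (rule bij_imp_permutes)
    have "inj_on \<sigma> P"
      using inj\<rho> by (simp add: \<sigma>_def inj_on_def)
    moreover have "\<sigma> ` P \<subseteq> P"
      using \<rho> by (auto simp: \<sigma>_def)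
    ultimately show "bij_betw \<sigma> P P"
      by (simp add: bij_betw_def endo_inj_surj[OF finP])
  qed (simp add: \<sigma>_def)
  then have "permutation \<sigma>"
    using finP permutation_permutes by blast
  then obtain k where k: "\<sigma> ^^ k = id" "k > 0"
    by (rule permutation_is_nilpotent)
  have iter: "(\<sigma> ^^ j) p \<in> P \<and> filterlim (g ^^ j) (?pf p) (?pf ((\<sigma> ^^ j) p))" if "p \<in> P" for j p
  proof (induction j)
    case 0
    then show ?case using that by (simp add: filterlim_ident id_def)
  next
    case (Suc j)
    then have "filterlim g (?pf ((\<sigma> ^^ j) p)) (?pf (\<sigma> ((\<sigma> ^^ j) p)))" "\<sigma> ((\<sigma> ^^ j) p) \<in> P"
      using \<rho>[of "(\<sigma> ^^ j) p"] by (simp_all add: \<sigma>_def[of "(\<sigma> ^^ j) p"])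
    moreover from this Suc have "LIM x ?pf (\<sigma> ((\<sigma> ^^ j) p)). (g ^^ j) (g x) :> ?pf p"
      by (blast intro: filterlim_compose)
    moreover have "g ^^ Suc j = (\<lambda>x. (g ^^ j) (g x))"
      by (simp add: fun_eq_iff funpow_swap1)
    ultimately show ?case
      by (simp only: funpow.simps(2) o_apply)
  qed
  have fixed_lim: "filterlim (g ^^ k) (?pf p) (?pf p)" if "p \<in> P" for p
    using iter[OF that, of k] k by simp
  have holgk: "(g ^^ j) holomorphic_on - Q \<and> (\<forall>z\<in>-Q. (g ^^ j) z \<in> - Q)" for j
  proof (induction j)
    case 0
    then show ?case by (auto simp: id_def intro: holomorphic_intros)
  next
    case (Suc j)
    then have "(g \<circ> (g ^^ j)) holomorphic_on - Q"
      by (intro holomorphic_on_compose_gen[OF _ holg]) auto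
    then show ?case
      using Suc gV by (simp add: o_def)
  qed
  \<comment> \<open>Since \<open>g ^^ k\<close> tends to \<open>q\<close> at each \<open>q\<close>
    in \<open>Q\<close>, these values fill in removable singularities. They also make
    \<open>q\<close> the only point at which \<open>G\<close> takes the value
    \<open>q\<close>.\<close>
  define G where "G z = (if z \<in> Q then z else (g ^^ k) z)" for z
  have ev: "\<forall>\<^sub>F z in ?pf p. G z = (g ^^ k) z" for p
    by (simp add: puncture_filter_def eventually_inf_principal G_def)
  have Gq: "G z = q \<longleftrightarrow> z = q" if "q \<in> Q" for q z
    using holgk[of k] that by (auto simp: G_def)
  have holG: "G holomorphic_on UNIV"
  proof (rule no_isolated_singularity'[where K = Q])
    fix q assume q: "q \<in> Q"
    then have "filterlim (g ^^ k) (nhds q) (?pf (Some q))"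
      using fixed_lim[of "Some q"] by (auto simp: P_def puncture_filter_def filterlim_inf sphere_nhds_def)
    then have "filterlim G (nhds q) (?pf (Some q))"
      using ev by (subst filterlim_cong[OF refl refl]) auto
    then show "(G \<longlongrightarrow> G q) (at q)"
      using q Q by (simp add: puncture_filter_Some G_def)
  next
    show "G holomorphic_on UNIV - Q"
      by (rule holomorphic_transform[of "g ^^ k"]) (use holgk[of k] in \<open>auto simp: G_def Compl_eq_Diff_UNIV\<close>)
  qed (use Q in auto)
  have "filterlim (g ^^ k) at_infinity (?pf None)"
    using fixed_lim[of None] by (auto simp: P_def puncture_filter_def filterlim_inf sphere_nhds_def)
  then have "filterlim G at_infinity (?pf None)"
    using ev by (subst filterlim_cong[OF refl refl]) auto
  then have "filterlim G at_infinity at_infinity"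
    using Q by (simp add: puncture_filter_None)
  then have "((inverse \<circ> G) \<longlongrightarrow> 0) at_infinity"
    unfolding o_def by (rule filterlim_compose[OF tendsto_inverse_0])
  then obtain c n where G: "\<And>z. G z = (\<Sum>i\<le>n. c i * z ^ i)"
    using pole_at_infinity[OF holG] by blast
  define p where "p = (\<Sum>i\<le>n. monom (c i) i)"
  have p: "poly p z = G z" for z
    by (simp add: p_def G poly_sum poly_monom)
  have "inj (poly p)"
    using ab Gq by (intro poly_two_totally_ramified[of a b]) (auto simp: p)
  then have injG: "inj G"
    by (simp add: inj_def p)
  show ?thesis
  proof (rule inj_onI)
    fix x y assume xy: "x \<in> - Q" "y \<in> - Q" "g x = g y"
    obtain j where "k = Suc j"
      using k(2) gr0_implies_Suc by blast
    then have "(g ^^ k) x = (g ^^ k) y"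
      by (simp only: funpow_Suc_right o_apply xy(3))
    then have "G x = G y"
      using xy(1,2) by (simp add: G_def)
    then show "x = y"
      using injG by (rule injD[rotated])
  qed
qed

section \<open>Orbits of a lifted inverse branch\<close>

lemma compact_subset_unit_ball:
  fixes C :: "complex set"
  assumes "compact C" "C \<subseteq> ball 0 1"
  obtains t where "0 \<le> t" "t < 1" "C \<subseteq> cball 0 t"
proof (cases "C = {}")
  case False
  then obtain m where m: "m \<in> C" "\<And>c. c \<in> C \<Longrightarrow> cmod c \<le> cmod m"
    using continuous_attains_sup[of C cmod] assms(1) by (auto intro: continuous_intros)
  moreover from m assms(2) have "cmod m < 1"
    by auto
  moreover from m(2) have "C \<subseteq> cball 0 (cmod m)"
    by (simp add: subset_iff)
  ultimately show ?thesis
    using that[of "cmod m"] by simp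
qed (use that[of 0] in auto)

section \<open>The setting in the plane, lifts and deck maps\<close>

text \<open>The situation after one puncture has been moved to infinity: \<open>- Q\<close> plays
  the part of V, and two points of \<open>Q\<close> together with infinity make three punctures.
  Non-injectivity of the covering enters as \<open>U \<noteq> - Q\<close>. By
  \<open>semiconj\<close>, \<open>h\<close> lifts an inverse branch of \<open>g\<close>.\<close>

locale lifted_inverse =
  fixes h \<pi> g :: "complex \<Rightarrow> complex" and U Q :: "complex set"
  assumes holh: "h holomorphic_on ball 0 1" and h_ball: "h ` ball 0 1 \<subseteq> ball 0 1"
    and Q: "finite Q" "2 \<le> card Q"
    and U: "open U" "U \<subseteq> - Q" "U \<noteq> - Q"
    and hol\<pi>: "\<pi> holomorphic_on ball 0 1" and cov: "covering_space (ball 0 1) \<pi> (- Q)"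
    and holg: "g holomorphic_on U" and g_im: "g ` U \<subseteq> - Q"
    and \<pi>h_U: "cmod z < 1 \<Longrightarrow> \<pi> (h z) \<in> U"
    and semiconj: "cmod z < 1 \<Longrightarrow> g (\<pi> (h z)) = \<pi> z"
begin

lemma h_norm: "cmod z < 1 \<Longrightarrow> cmod (h z) < 1"
  using h_ball by (auto simp: image_subset_iff)

lemma iterate_norm: "cmod z < 1 \<Longrightarrow> cmod ((h ^^ n) z) < 1"
  by (induction n) (auto intro: h_norm)

lemma holomorphic_iterate: "(h ^^ n) holomorphic_on ball 0 1"
proof (induction n)
  case (Suc n)
  then have "(h \<circ> (h ^^ n)) holomorphic_on ball 0 1"
    by (intro holomorphic_on_compose_gen[OF _ holh]) (auto intro: iterate_norm)
  then show ?case by (simp add: o_def)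
qed (simp add: id_def holomorphic_on_ident)

lemma pdist_iterate:
  assumes "cmod u < 1" "cmod v < 1"
  shows "pdist ((h ^^ n) u) ((h ^^ n) v) \<le> pdist u v"
  using assms by (intro Schwarz_Pick holomorphic_iterate) (auto intro: iterate_norm)

lemma \<pi>_notin: "cmod z < 1 \<Longrightarrow> \<pi> z \<notin> Q"
  using covering_space_imp_surjective[OF cov] by auto

lemma \<pi>_surj:
  assumes "y \<notin> Q"
  obtains w where "cmod w < 1" "\<pi> w = y"
  using covering_space_imp_surjective[OF cov] assms that by (metis ComplI imageE mem_ball_0)

lemma \<pi>_iterate_notin: "cmod z < 1 \<Longrightarrow> \<pi> ((h ^^ n) z) \<notin> Q"
  by (intro \<pi>_notin iterate_norm)

lemma g_iterate: "cmod z < 1 \<Longrightarrow> g (\<pi> ((h ^^ Suc n) z)) = \<pi> ((h ^^ n) z)"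
  using semiconj[OF iterate_norm] by simp

lemma open_compl_Q: "open (- Q)"
  using Q(1) by (simp add: finite_imp_closed open_Compl)

lemma other_puncture:
  obtains q' where "q' \<in> Q" "q' \<noteq> q"
proof -
  have "\<not> card Q \<le> Suc 0"
    using Q(2) by simp
  then show ?thesis
    using that card_le_Suc0_iff_eq[OF Q(1)] by blast
qed

text \<open>A convex set is simply connected and locally path connected, so \<open>F\<close> lifts
  through the covering; the lift is holomorphic because \<open>\<pi>\<close> is.\<close>

lemma lift:
  fixes F :: "complex \<Rightarrow> complex"
  assumes S: "convex S" and F: "F holomorphic_on S" "F ` S \<subseteq> - Q"
    and base: "z0 \<in> S" "cmod w0 < 1" "\<pi> w0 = F z0"
  obtains F' where "F' holomorphic_on S" "F' ` S \<subseteq> ball 0 1" "F' z0 = w0"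
    "\<And>z. z \<in> S \<Longrightarrow> \<pi> (F' z) = F z"
proof -
  obtain F' where F': "continuous_on S F'" "F' \<in> S \<rightarrow> ball 0 1" "F' z0 = w0"
    "\<And>z. z \<in> S \<Longrightarrow> \<pi> (F' z) = F z"
  proof (rule covering_space_lift_strong[OF cov, of w0 z0 S F])
    show "continuous_on S F"
      using F(1) by (rule holomorphic_on_imp_continuous_on)
  qed (use assms in \<open>auto simp: convex_imp_simply_connected convex_imp_locally_path_connected\<close>)
  moreover have "F' holomorphic_on S"
    using F F' by (intro covering_space_lift_is_holomorphic[OF cov _ hol\<pi> F(1)]) auto
  ultimately show thesis
    using that by blast
qed

text \<open>Lifting \<open>\<pi>\<close> through itself with \<open>w\<close> sent to
  \<open>w'\<close> gives a holomorphic self-map of the disc over the identity of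
  \<open>- Q\<close>. It carries \<open>b\<close> to \<open>b'\<close>, and Schwarz-Pick bounds the
  distance.\<close>

lemma deck_map:
  assumes "cmod w < 1" "cmod w' < 1" "\<pi> w = \<pi> w'" and b: "cmod b < 1"
  obtains b' where "cmod b' < 1" "\<pi> b' = \<pi> b" "pdist b' w' \<le> pdist b w"
proof -
  obtain \<gamma> where \<gamma>: "\<gamma> holomorphic_on ball 0 1" "\<gamma> ` ball 0 1 \<subseteq> ball 0 1" "\<gamma> w = w'"
    "\<And>z. z \<in> ball 0 1 \<Longrightarrow> \<pi> (\<gamma> z) = \<pi> z"
    using lift[of "ball 0 1" \<pi> w w'] assms hol\<pi> \<pi>_notin by (auto simp: image_subset_iff)
  have "pdist (\<gamma> b) (\<gamma> w) \<le> pdist b w"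
    using \<gamma> assms by (intro Schwarz_Pick) auto
  then show thesis
    using that[of "\<gamma> b"] \<gamma> b by (auto simp: image_subset_iff)
qed

lemma omitted_point:
  obtains b where "b \<notin> Q" "b \<notin> U"
  using U by auto

lemma notin_range_h: "\<pi> b \<notin> U \<Longrightarrow> b \<notin> h ` ball 0 1"
  using \<pi>h_U by auto

section \<open>Fixed points of \<open>h\<close>\<close>

text \<open>A preimage \<open>b\<close> of a point outside \<open>U\<close> is omitted by
  \<open>h\<close>. The orbit of \<open>z\<close> stays within distance \<open>s\<close> of
  \<open>p\<close>, hence within \<open>r\<close> of \<open>b\<close>, so every step contracts the
  distance to \<open>p\<close> by the same factor \<open>c < 1\<close>.\<close>

lemma fixed_point_attracts:
  assumes p: "cmod p < 1" "h p = p" and z: "cmod z < 1"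
  shows "(\<lambda>n. (h ^^ n) z) \<longlonglongrightarrow> p"
proof -
  obtain b0 where "b0 \<notin> Q" "b0 \<notin> U"
    by (rule omitted_point)
  moreover from this obtain b where "cmod b < 1" "\<pi> b = b0"
    using \<pi>_surj by blast
  ultimately have b: "b0 \<notin> U" "cmod b < 1" "\<pi> b = b0"
    by auto
  then have bh: "b \<notin> h ` ball 0 1"
    using notin_range_h by simp
  define s t where "s = pdist p z" and "t = pdist b p"
  have st: "0 \<le> s" "s < 1" "0 \<le> t" "t < 1"
    using p z b by (auto simp: s_def t_def intro: pdist_lt_1)
  define r where "r = (t + s) / (1 + t * s)"
  have r: "0 \<le> r" "r < 1"
    using st add_div_lt_1[of t s] by (auto simp: r_def)
  define c where "c = 2 * sqrt r / (1 + r)"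
  have c: "0 \<le> c" "c < 1"
    using r contraction_factor_lt_1 by (auto simp: c_def)
  have fixp: "(h ^^ n) p = p" for n
    by (induction n) (use p in auto)
  have near: "pdist b ((h ^^ n) z) \<le> r" for n
    unfolding r_def
  proof (rule pdist_strong_triangle[of _ _ p])
    show "pdist p ((h ^^ n) z) \<le> s"
      using pdist_iterate[OF p(1) z, of n] by (simp add: fixp s_def)
  qed (use b p z st in \<open>auto simp: t_def intro: iterate_norm\<close>)
  have nearp: "pdist b (h p) \<le> r"
  proof -
    have "(t + 0) / (1 + t * 0) \<le> r"
      unfolding r_def using st by (intro add_div_mono) auto
    then show ?thesis using p by (simp add: t_def)
  qed
  have bound: "pdist p ((h ^^ n) z) \<le> c ^ n" for n
  proof (induction n)
    case 0
    then show ?case using st by (simp add: s_def)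
  next
    case (Suc n)
    have "pdist (h p) (h ((h ^^ n) z)) \<le> c * pdist p ((h ^^ n) z)"
      unfolding c_def using b bh p z r nearp near[of "Suc n"]
      by (intro pdist_contraction_omitting[OF holh h_ball, of b]) (auto intro: iterate_norm)
    also have "\<dots> \<le> c * c ^ n"
      using Suc c by (intro mult_left_mono) auto
    finally show ?case using p by simp
  qed
  \<comment> \<open>The denominator of \<open>pdist\<close> has modulus at most 2, which converts
    the pseudohyperbolic bound into a Euclidean one.\<close>
  have bound': "cmod ((h ^^ n) z - p) \<le> 2 * c ^ n" for n
  proof -
    define w where "w = (h ^^ n) z"
    have w: "cmod w < 1"
      using z by (simp add: w_def iterate_norm)
    have "cmod (1 - cnj p * w) \<le> 1 + cmod p * cmod w"
      by (metis complex_mod_cnj norm_mult norm_one norm_triangle_ineq4)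
    also have "\<dots> \<le> 1 + 1 * 1"
      using p w by (intro add_left_mono mult_mono) auto
    finally have "pdist p w * cmod (1 - cnj p * w) \<le> c ^ n * 2"
      using bound[of n] c by (intro mult_mono) (auto simp: w_def)
    moreover have "pdist p w * cmod (1 - cnj p * w) = cmod (w - p)"
      using one_minus_cnj_mult_nz[OF p(1) w] by (simp add: pdist_altdef)
    ultimately show ?thesis by (simp add: w_def mult.commute)
  qed
  have "(\<lambda>n. 2 * c ^ n) \<longlonglongrightarrow> 2 * 0"
    using c by (intro tendsto_intros LIMSEQ_power_zero) auto
  then have "(\<lambda>n. 2 * c ^ n) \<longlonglongrightarrow> 0"
    by simp
  then have "(\<lambda>n. (h ^^ n) z - p) \<longlonglongrightarrow> 0"
    by (rule Lim_null_comparison[OF always_eventually[OF allI[OF bound']]])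
  then show ?thesis
    by (simp add: LIM_zero_iff)
qed

text \<open>Each time the orbit comes within bounded distance of a point omitted by \<open>h\<close>, its step
  length shrinks by a definite factor; once a step is short enough, a disc around the orbit point is
  mapped into itself, and Brouwer's theorem applies.\<close>

lemma fixed_point_if_near_omitted:
  assumes z: "cmod z < 1" and r: "r < 1"
    and near: "\<exists>\<^sub>F n in sequentially. \<exists>b. cmod b < 1 \<and> \<pi> b \<notin> U \<and> pdist b ((h ^^ n) z) \<le> r"
  shows "\<exists>p. cmod p < 1 \<and> h p = p"
proof -
  let ?near = "\<lambda>n. \<exists>b. cmod b < 1 \<and> \<pi> b \<notin> U \<and> pdist b ((h ^^ n) z) \<le> r"
  define d where "d n = pdist ((h ^^ n) z) ((h ^^ Suc n) z)" for n
  have zn: "cmod ((h ^^ n) z) < 1" for n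
    using z by (rule iterate_norm)
  have d0: "0 \<le> d n" "d n < 1" for n
    using zn[of n] zn[of "Suc n"] by (auto simp: d_def intro: pdist_lt_1)
  have "d (Suc n) \<le> d n" for n
    using Schwarz_Pick[OF holh h_ball zn[of n] zn[of "Suc n"]] by (simp add: d_def)
  then have dec: "decseq d"
    by (simp add: decseq_SucI)
  have r0: "0 \<le> r"
  proof -
    obtain n where "?near n"
      using near frequently_ex by blast
    then show ?thesis
      using pdist_nonneg order_trans by blast
  qed
  \<comment> \<open>The contraction lemma needs both ends of the image step near \<open>b\<close>.
    If one orbit point is within \<open>r\<close> of \<open>b\<close>, its successor is within
    \<open>r1\<close>, because no step is longer than \<open>d 0\<close>.\<close>
  define r1 where "r1 = (r + d 0) / (1 + r * d 0)"
  have r1: "r \<le> r1" "r1 < 1" "0 \<le> r1"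
  proof -
    have "(r + 0) / (1 + r * 0) \<le> r1"
      unfolding r1_def using r r0 d0[of 0] by (intro add_div_mono) auto
    then show "r \<le> r1" "0 \<le> r1" using r0 by auto
    show "r1 < 1"
      unfolding r1_def using r r0 d0[of 0] by (intro add_div_lt_1)
  qed
  have next_near: "pdist b ((h ^^ Suc n) z) \<le> r1" if "cmod b < 1" "pdist b ((h ^^ n) z) \<le> r" for b n
    unfolding r1_def
  proof (rule pdist_strong_triangle[of _ _ "(h ^^ n) z"])
    show "pdist ((h ^^ n) z) ((h ^^ Suc n) z) \<le> d 0"
      using decseqD[OF dec, of 0 n] by (simp add: d_def)
  qed (use that zn[of "Suc n"] zn r d0[of 0] in \<open>auto simp: less_imp_le\<close>)
  define c where "c = 2 * sqrt r1 / (1 + r1)"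
  have c: "0 \<le> c" "c < 1"
    using r1 contraction_factor_lt_1 by (auto simp: c_def)
  have shrink: "d (Suc n) \<le> c * d n" if "?near (Suc n)" for n
  proof -
    from that obtain b where b: "cmod b < 1" "\<pi> b \<notin> U" "pdist b ((h ^^ Suc n) z) \<le> r"
      by blast
    have "pdist (h ((h ^^ n) z)) (h ((h ^^ Suc n) z)) \<le> c * pdist ((h ^^ n) z) ((h ^^ Suc n) z)"
      unfolding c_def using b r1 next_near[OF b(1) b(3)] zn[of n] zn[of "Suc n"] notin_range_h[OF b(2)]
      by (intro pdist_contraction_omitting[OF holh h_ball, of b]) simp_all
    then show ?thesis by (simp add: d_def)
  qed
  obtain L where L: "d \<longlonglongrightarrow> L"
    using decseq_convergent[OF dec, of 0] d0 by metis
  have "L \<ge> 0"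
    using L d0 by (intro LIMSEQ_le_const) auto
  \<comment> \<open>If the decreasing step lengths had a positive limit \<open>L\<close>, then
    eventually \<open>c * d n < L\<close>, and at one of the infinitely many shrinking times the
    next step would be shorter than \<open>L\<close>.\<close>
  have "L = 0"
  proof (rule ccontr)
    assume "L \<noteq> 0"
    then have "L > 0" using \<open>L \<ge> 0\<close> by simp
    have "(\<lambda>n. c * d n) \<longlonglongrightarrow> c * L"
      using L by (intro tendsto_intros)
    moreover have "c * L < L"
      using c \<open>L > 0\<close> by simp
    ultimately have "\<forall>\<^sub>F n in sequentially. c * d n < L"
      by (rule order_tendstoD)
    then obtain N where N: "\<And>n. n \<ge> N \<Longrightarrow> c * d n < L"
      by (auto simp: eventually_sequentially)
    obtain n where "n \<ge> Suc N" "?near n"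
      using near unfolding frequently_sequentially by blast
    then obtain m where m: "m \<ge> N" "?near (Suc m)"
      by (metis Suc_le_D Suc_le_mono)
    then have "d (Suc m) < L"
      using shrink[OF m(2)] N[OF m(1)] by simp
    moreover have "L \<le> d (Suc m)"
      using decseq_ge[OF dec L] by simp
    ultimately show False by simp
  qed
  \<comment> \<open>Bounds the distance from \<open>b\<close> to the image of any point within 1/2
    of \<open>w\<close>, the centre of the disc to be mapped into itself.\<close>
  define r2 where "r2 = (r1 + 1 / 2) / (1 + r1 * (1 / 2))"
  have r2: "r1 \<le> r2" "r2 < 1"
  proof -
    have "(r1 + 0) / (1 + r1 * 0) \<le> r2"
      unfolding r2_def using r1 by (intro add_div_mono) auto
    then show "r1 \<le> r2" by simp
    show "r2 < 1"
      unfolding r2_def using r1 by (intro add_div_lt_1) auto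
  qed
  define c2 where "c2 = 2 * sqrt r2 / (1 + r2)"
  have c2: "0 \<le> c2" "c2 < 1"
    using r1 r2 contraction_factor_lt_1[of r2] by (auto simp: c2_def)
  have "\<forall>\<^sub>F n in sequentially. d n < (1 - c2) / 2"
    using L c2 unfolding \<open>L = 0\<close> by (intro order_tendstoD) auto
  from frequently_ex[OF frequently_eventually_frequently[OF near this]]
  obtain n b where b: "cmod b < 1" "\<pi> b \<notin> U" "pdist b ((h ^^ n) z) \<le> r" and dn: "d n < (1 - c2) / 2"
    by blast
  define w where "w = (h ^^ n) z"
  have w: "cmod w < 1"
    using zn by (simp add: w_def)
  \<comment> \<open>The threshold for \<open>d n\<close> was chosen so that a step shorter than
    \<open>(1 - c2) / 2\<close> plus the contracted radius \<open>c2 / 2\<close> stays below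
    1/2.\<close>
  have stay: "pdist w (h w') \<le> 1 / 2" if w': "cmod w' < 1" "pdist w w' \<le> 1 / 2" for w'
  proof -
    have hw: "pdist b (h w) \<le> r1"
      using next_near[OF b(1,3)] by (simp add: w_def)
    have "pdist (h w) (h w') \<le> 1 / 2"
      using Schwarz_Pick[OF holh h_ball w w'(1)] w'(2) by simp
    then have "pdist b (h w') \<le> r2"
      unfolding r2_def using hw b(1) w w'(1) r1
      by (intro pdist_strong_triangle[of _ _ "h w"]) (simp_all add: h_norm)
    then have "pdist (h w) (h w') \<le> c2 * pdist w w'"
      unfolding c2_def using b(1) hw r2 w w'(1) notin_range_h[OF b(2)]
      by (intro pdist_contraction_omitting[OF holh h_ball, of b]) simp_all
    also have "\<dots> \<le> c2 * (1 / 2)"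
      using c2 w' by (intro mult_left_mono) auto
    finally have "pdist (h w) (h w') \<le> c2 / 2" by simp
    moreover have "pdist w (h w) < (1 - c2) / 2"
      using dn by (simp add: d_def w_def)
    moreover have "pdist w (h w') \<le> pdist w (h w) + pdist (h w) (h w')"
      using w w' by (intro pdist_triangle h_norm)
    ultimately show ?thesis by (simp add: field_simps)
  qed
  let ?M = "Moebius_function 0"
  have Mw: "cmod (?M w u) < 1" "cmod (?M (- w) u) < 1" if "cmod u < 1" for u
    using that w by (auto intro: Moebius_function_norm_lt_1)
  have "((?M w \<circ> h) \<circ> ?M (- w)) holomorphic_on ball 0 1"
    using w h_norm Mw by (intro holomorphic_on_compose_gen[where t = "ball 0 1"] Moebius_function_holomorphic holh) auto
  then have cont: "continuous_on (cball 0 (1 / 2)) ((?M w \<circ> h) \<circ> ?M (- w))"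
    by (intro holomorphic_on_imp_continuous_on) (erule holomorphic_on_subset, auto)
  \<comment> \<open>In the coordinate that moves \<open>w\<close> to 0, the pseudohyperbolic disc
    becomes the Euclidean disc \<open>cball 0 (1 / 2)\<close>, as Brouwer's theorem
    requires.\<close>
  have self: "cmod (?M w (h (?M (- w) u))) \<le> 1 / 2" if "cmod u \<le> 1 / 2" for u
  proof -
    have "pdist w (?M (- w) u) = cmod u"
      using w that unfolding pdist_def by (subst Moebius_function_compose) auto
    then show ?thesis
      using stay[of "?M (- w) u"] Mw(2)[of u] that by (simp add: pdist_def)
  qed
  obtain u where u: "u \<in> cball 0 (1 / 2)" "((?M w \<circ> h) \<circ> ?M (- w)) u = u"
    using brouwer_ball[of "1 / 2" 0 "(?M w \<circ> h) \<circ> ?M (- w)"] cont self by auto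
  define p where "p = ?M (- w) u"
  have p: "cmod p < 1"
    using u(1) Mw by (simp add: p_def)
  have "?M (- w) (?M w (h p)) = h p"
    using w p h_norm by (intro Moebius_function_compose) auto
  then have "h p = p"
    using u(2) by (simp add: p_def)
  then show ?thesis using p by blast
qed


text \<open>As \<open>\<pi>\<close> is open, the projected orbit returns infinitely often to the
  image of \<open>ball 0 \<rho>\<close>. Whenever it does, a deck map carries the fixed point
  \<open>b\<close> over the complement of \<open>U\<close> to a point \<open>b'\<close> over the
  same value, within distance \<open>r\<close> of the orbit point.\<close>

lemma fixed_point_if_accumulates:
  assumes z: "cmod z < 1" and y: "y \<notin> Q"
    and acc: "\<And>N. open N \<Longrightarrow> y \<in> N \<Longrightarrow> \<exists>\<^sub>F n in sequentially. \<pi> ((h ^^ n) z) \<in> N"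
  shows "\<exists>p. cmod p < 1 \<and> h p = p"
proof -
  obtain y' where y': "cmod y' < 1" "\<pi> y' = y"
    using \<pi>_surj[OF y] by blast
  obtain b0 where "b0 \<notin> Q" "b0 \<notin> U"
    by (rule omitted_point)
  moreover from this obtain b where "cmod b < 1" "\<pi> b = b0"
    using \<pi>_surj by blast
  ultimately have b: "cmod b < 1" "\<pi> b \<notin> U"
    by auto
  define \<rho> where "\<rho> = (1 + cmod y') / 2"
  have \<rho>: "cmod y' < \<rho>" "\<rho> < 1" "0 \<le> \<rho>"
    using y' by (auto simp: \<rho>_def)
  have "openin (top_of_set (- Q)) (\<pi> ` ball 0 \<rho>)"
    using \<rho> by (intro covering_space_open_map[OF cov]) (auto simp: openin_open_eq)
  then have "open (\<pi> ` ball 0 \<rho>)"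
    using open_compl_Q by (simp add: openin_open_eq)
  moreover have "y \<in> \<pi> ` ball 0 \<rho>"
    using \<rho> y' by auto
  ultimately have freq: "\<exists>\<^sub>F n in sequentially. \<pi> ((h ^^ n) z) \<in> \<pi> ` ball 0 \<rho>"
    by (rule acc)
  define r where "r = (cmod b + \<rho>) / (1 + cmod b * \<rho>)"
  have r: "r < 1"
    unfolding r_def using b \<rho> by (intro add_div_lt_1) auto
  show ?thesis
  proof (rule fixed_point_if_near_omitted[OF z r frequently_elim1[OF freq]])
    fix n assume "\<pi> ((h ^^ n) z) \<in> \<pi> ` ball 0 \<rho>"
    then obtain w where w: "cmod w < \<rho>" "\<pi> w = \<pi> ((h ^^ n) z)"
      by auto
    have w1: "cmod w < 1"
      using w(1) \<rho>(2) by simp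
    obtain b' where b': "cmod b' < 1" "\<pi> b' = \<pi> b" "pdist b' ((h ^^ n) z) \<le> pdist b w"
      using deck_map[OF w1 iterate_norm[OF z] w(2) b(1)] by blast
    have "pdist b w \<le> r"
      unfolding r_def
      by (rule pdist_strong_triangle[of _ _ 0]) (use b w w1 \<rho> in \<open>auto simp: pdist_commute[of _ 0]\<close>)
    then show "\<exists>b. cmod b < 1 \<and> \<pi> b \<notin> U \<and> pdist b ((h ^^ n) z) \<le> r"
      using b b' by (intro exI[of _ b']) auto
  qed
qed

lemma leaves_compact:
  assumes nofix: "\<nexists>p. cmod p < 1 \<and> h p = p" and z: "cmod z < 1"
    and K: "compact K" "K \<subseteq> - Q"
  shows "\<forall>\<^sub>F n in sequentially. \<pi> ((h ^^ n) z) \<notin> K"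
proof -
  have "\<exists>N. open N \<and> y \<in> N \<and> (\<forall>\<^sub>F n in sequentially. \<pi> ((h ^^ n) z) \<notin> N)" if "y \<in> K" for y
    using fixed_point_if_accumulates[OF z, of y] nofix K that unfolding frequently_def by blast
  then obtain N where N: "\<And>y. y \<in> K \<Longrightarrow> open (N y)" "\<And>y. y \<in> K \<Longrightarrow> y \<in> N y"
    "\<And>y. y \<in> K \<Longrightarrow> \<forall>\<^sub>F n in sequentially. \<pi> ((h ^^ n) z) \<notin> N y"
    by metis
  obtain C where C: "C \<subseteq> K" "finite C" "K \<subseteq> (\<Union>y\<in>C. N y)"
    using compactE_image[OF K(1), of K N] N by blast
  have "\<forall>\<^sub>F n in sequentially. \<forall>y\<in>C. \<pi> ((h ^^ n) z) \<notin> N y"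
    using C N(3) by (intro eventually_ball_finite) auto
  then show ?thesis
    by (rule eventually_mono) (use C(3) in blast)
qed

section \<open>Convergence of the projected orbit to a puncture\<close>

abbreviation punctures :: "complex option set" where
  "punctures \<equiv> insert None (Some ` Q)"

text \<open>Normalise \<open>\<pi>\<close> to a function \<open>F\<close> that omits 0 and 1 and is
  large near the puncture. If \<open>\<pi> w'\<close> violated \<open>A\<close>, then
  \<open>F\<close> would be bounded at \<open>w'\<close>, so by Schottky with the roles exchanged
  also at \<open>w\<close>, which is false when \<open>\<pi> w\<close> is close enough to
  \<open>p\<close>.\<close>

lemma near_puncture:
  assumes p: "p \<in> punctures" and \<rho>: "\<rho> < 1" and A: "eventually A (sphere_nhds p)"
  obtains A' where "eventually A' (sphere_nhds p)"
    "\<And>w w'. \<lbrakk>cmod w < 1; cmod w' < 1; pdist w w' \<le> \<rho>; A' (\<pi> w)\<rbrakk> \<Longrightarrow> A (\<pi> w')"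
proof (cases p)
  case None
  obtain R where R: "\<And>x. R \<le> cmod x \<Longrightarrow> A x"
    using A by (auto simp: None sphere_nhds_def eventually_at_infinity)
  obtain q where q: "q \<in> Q"
    using other_puncture by blast
  obtain q' where q': "q' \<in> Q" "q' \<noteq> q"
    using other_puncture by blast
  define F where "F w = (\<pi> w - q) / (q' - q)" for w
  have F: "F holomorphic_on ball 0 1" "\<And>w. w \<in> ball 0 1 \<Longrightarrow> F w \<noteq> 0 \<and> F w \<noteq> 1"
    using q q' \<pi>_notin unfolding F_def by (auto intro!: holomorphic_intros hol\<pi> simp: field_simps)
  obtain B where B: "\<And>w w'. \<lbrakk>cmod w < 1; cmod w' < 1; pdist w w' \<le> \<rho>;
      cmod (F w) \<le> (R + cmod q) / cmod (q' - q)\<rbrakk> \<Longrightarrow> cmod (F w') \<le> B"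
    using Schottky_pdist[OF F \<rho>] by blast
  define R' where "R' = B * cmod (q' - q) + cmod q + 1"
  show thesis
  proof (rule that)
    show "eventually (\<lambda>x. R' \<le> cmod x) (sphere_nhds p)"
      by (auto simp: None sphere_nhds_def eventually_at_infinity)
    fix w w' assume w: "cmod w < 1" "cmod w' < 1" "pdist w w' \<le> \<rho>" "R' \<le> cmod (\<pi> w)"
    show "A (\<pi> w')"
    proof (rule ccontr)
      assume "\<not> A (\<pi> w')"
      then have "cmod (\<pi> w' - q) \<le> R + cmod q"
        using R[of "\<pi> w'"] norm_triangle_ineq4[of "\<pi> w'" q] by (cases "R \<le> cmod (\<pi> w')") auto
      then have "cmod (F w') \<le> (R + cmod q) / cmod (q' - q)"
        unfolding F_def norm_divide by (rule divide_right_mono) simp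
      then have "cmod (F w) \<le> B"
        using B[of w' w] w by (simp add: pdist_commute)
      then have "cmod (\<pi> w - q) \<le> B * cmod (q' - q)"
        using q' by (simp add: F_def norm_divide divide_le_eq)
      then show False
        using w(4) norm_triangle_ineq2[of "\<pi> w" q] by (simp add: R'_def)
    qed
  qed
next
  case (Some q)
  then have q: "q \<in> Q" using p by auto
  obtain e where e: "e > 0" "\<And>x. cmod (x - q) < e \<Longrightarrow> A x"
    using A by (auto simp: Some sphere_nhds_def eventually_nhds_metric dist_norm)
  obtain q' where q': "q' \<in> Q" "q' \<noteq> q"
    using other_puncture by blast
  \<comment> \<open>The reciprocal sends the puncture \<open>q\<close> to infinity; the values 0 and
    1 would correspond to infinity and \<open>q'\<close>.\<close>
  define F where "F w = (q' - q) / (\<pi> w - q)" for w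
  have F: "F holomorphic_on ball 0 1" "\<And>w. w \<in> ball 0 1 \<Longrightarrow> F w \<noteq> 0 \<and> F w \<noteq> 1"
    using q q' \<pi>_notin unfolding F_def by (auto intro!: holomorphic_intros hol\<pi> simp: field_simps)
  obtain B where B: "\<And>w w'. \<lbrakk>cmod w < 1; cmod w' < 1; pdist w w' \<le> \<rho>;
      cmod (F w) \<le> cmod (q' - q) / e\<rbrakk> \<Longrightarrow> cmod (F w') \<le> B"
    using Schottky_pdist[OF F \<rho>] by blast
  show thesis
  proof (rule that)
    have "((\<lambda>x. B * cmod (x - q)) \<longlongrightarrow> B * cmod (q - q)) (nhds q)"
      by (intro tendsto_intros) (auto simp: filterlim_ident)
    then show "eventually (\<lambda>x. B * cmod (x - q) < cmod (q' - q)) (sphere_nhds p)"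
      using q' unfolding Some sphere_nhds_def by (auto intro: order_tendstoD)
    fix w w' assume w: "cmod w < 1" "cmod w' < 1" "pdist w w' \<le> \<rho>" "B * cmod (\<pi> w - q) < cmod (q' - q)"
    show "A (\<pi> w')"
    proof (rule ccontr)
      assume "\<not> A (\<pi> w')"
      then have "e \<le> cmod (\<pi> w' - q)"
        using e(2) by force
      then have "cmod (F w') \<le> cmod (q' - q) / e"
        unfolding F_def norm_divide using e(1) by (intro divide_left_mono mult_pos_pos) auto
      then have "cmod (F w) \<le> B"
        using B[of w' w] w by (simp add: pdist_commute)
      then have "cmod (q' - q) \<le> B * cmod (\<pi> w - q)"
        using q \<pi>_notin[OF w(1)] by (auto simp: F_def norm_divide divide_le_eq split: if_splits)
      then show False
        using w(4) by simp
    qed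
  qed
qed

text \<open>Iterates of \<open>h\<close> do not increase \<open>pdist\<close>, so the orbits of all
  points of \<open>C\<close> stay within \<open>\<rho>\<close> of the orbit of \<open>z\<close>, and
  \<open>near_puncture\<close> transfers closeness to the puncture.\<close>

lemma uniform_convergence:
  assumes z: "cmod z < 1" and p: "p \<in> punctures"
    and lim: "filterlim (\<lambda>n. \<pi> ((h ^^ n) z)) (sphere_nhds p) sequentially"
    and \<rho>: "\<rho> < 1" "\<And>c. c \<in> C \<Longrightarrow> cmod c < 1 \<and> pdist z c \<le> \<rho>" and A: "eventually A (sphere_nhds p)"
  shows "\<forall>\<^sub>F n in sequentially. \<forall>c\<in>C. A (\<pi> ((h ^^ n) c))"
proof -
  obtain A' where A': "eventually A' (sphere_nhds p)"
    "\<And>w w'. \<lbrakk>cmod w < 1; cmod w' < 1; pdist w w' \<le> \<rho>; A' (\<pi> w)\<rbrakk> \<Longrightarrow> A (\<pi> w')"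
    using near_puncture[OF p \<rho>(1) A] by blast
  have "\<forall>\<^sub>F n in sequentially. A' (\<pi> ((h ^^ n) z))"
    using lim A'(1) by (auto simp: filterlim_iff)
  then show ?thesis
  proof (rule eventually_mono)
    fix n assume *: "A' (\<pi> ((h ^^ n) z))"
    show "\<forall>c\<in>C. A (\<pi> ((h ^^ n) c))"
    proof
      fix c assume "c \<in> C"
      then have c: "cmod c < 1" "pdist z c \<le> \<rho>"
        using \<rho>(2) by auto
      have "pdist ((h ^^ n) z) ((h ^^ n) c) \<le> \<rho>"
        using pdist_iterate[OF z c(1), of n] c(2) by simp
      then show "A (\<pi> ((h ^^ n) c))"
        using A'(2) * z c(1) iterate_norm by blast
    qed
  qed
qed

lemma pdist_bounded_on_compact:
  assumes "cmod z < 1" "compact C" "C \<subseteq> ball 0 1"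
  obtains \<rho> where "\<rho> < 1" "\<And>c. c \<in> C \<Longrightarrow> cmod c < 1 \<and> pdist z c \<le> \<rho>"
proof -
  obtain t where t: "0 \<le> t" "t < 1" "C \<subseteq> cball 0 t"
    using compact_subset_unit_ball assms by blast
  show thesis
  proof (rule that)
    show "(cmod z + t) / (1 + cmod z * t) < 1"
      using assms t by (intro add_div_lt_1) auto
    fix c assume "c \<in> C"
    then have c: "cmod c \<le> t"
      using t by auto
    then have "pdist z c \<le> (cmod z + t) / (1 + cmod z * t)"
      using assms t by (intro pdist_strong_triangle[of _ _ 0]) (auto simp: pdist_commute[of _ 0])
    with c t show "cmod c < 1 \<and> pdist z c \<le> (cmod z + t) / (1 + cmod z * t)"
      by auto
  qed
qed

lemma limit_independent:
  assumes "cmod z < 1" "p \<in> punctures" "filterlim (\<lambda>n. \<pi> ((h ^^ n) z)) (sphere_nhds p) sequentially"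
    and "cmod z' < 1"
  shows "filterlim (\<lambda>n. \<pi> ((h ^^ n) z')) (sphere_nhds p) sequentially"
proof -
  have "\<forall>\<^sub>F n in sequentially. \<forall>c\<in>{z'}. A (\<pi> ((h ^^ n) c))" if "eventually A (sphere_nhds p)" for A
    using assms that by (intro uniform_convergence[of z p "pdist z z'"]) (auto intro: pdist_lt_1)
  then show ?thesis
    by (simp add: filterlim_iff)
qed

text \<open>The radius at infinity is \<open>1 / e\<close>, so that one parameter tending to 0
  shrinks the neighbourhoods of all punctures together.\<close>

definition puncture_nhd :: "real \<Rightarrow> complex option \<Rightarrow> complex set" where
  "puncture_nhd e p = (case p of None \<Rightarrow> {x. 1 / e < cmod x} | Some q \<Rightarrow> ball q e)"

lemma puncture_nhd_mono: "0 < d \<Longrightarrow> d \<le> e \<Longrightarrow> puncture_nhd d p \<subseteq> puncture_nhd e p"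
proof (cases p)
  case None
  assume *: "0 < d" "d \<le> e"
  then have "1 / e \<le> 1 / d"
    by (simp add: frac_le)
  then show ?thesis
    by (auto simp: puncture_nhd_def None)
qed (auto simp: puncture_nhd_def)

lemma open_puncture_nhd: "open (puncture_nhd e p)"
proof (cases p)
  case None
  have "open {x :: complex. 1 / e < cmod x}"
    by (intro open_Collect_less continuous_intros)
  then show ?thesis by (simp add: puncture_nhd_def None)
qed (simp add: puncture_nhd_def)

lemma eventually_puncture_nhd:
  assumes "e > 0"
  shows "\<forall>\<^sub>F x in sphere_nhds p. x \<in> puncture_nhd e p"
proof (cases p)
  case None
  then show ?thesis
    by (auto simp: puncture_nhd_def sphere_nhds_def eventually_at_infinity intro!: exI[of _ "1 / e + 1"])
next
  case (Some q)
  then show ?thesis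
    using assms eventually_nhds_in_open[of "ball q e" q] by (simp add: puncture_nhd_def sphere_nhds_def)
qed

lemma puncture_nhd_basis:
  assumes "eventually A (sphere_nhds p)"
  obtains e where "e > 0" "\<And>x. x \<in> puncture_nhd e p \<Longrightarrow> A x"
proof (cases p)
  case None
  then obtain R where R: "\<And>x. R \<le> cmod x \<Longrightarrow> A x"
    using assms by (auto simp: sphere_nhds_def eventually_at_infinity)
  have "R \<le> cmod x" if "1 / (1 / (\<bar>R\<bar> + 1)) < cmod x" for x :: complex
    using that by simp
  then show ?thesis
    using R by (intro that[of "1 / (\<bar>R\<bar> + 1)"]) (auto simp: puncture_nhd_def None)
next
  case (Some q)
  then show ?thesis
    using assms that by (auto simp: puncture_nhd_def sphere_nhds_def eventually_nhds_metric dist_commute)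
qed

lemma disjoint_puncture_nhds:
  obtains e where "e > 0" "\<And>p p'. \<lbrakk>p \<in> punctures; p' \<in> punctures; p \<noteq> p'\<rbrakk> \<Longrightarrow> puncture_nhd e p \<inter> puncture_nhd e p' = {}"
proof -
  have None_Some: "\<exists>e>0. puncture_nhd e None \<inter> puncture_nhd e (Some q) = {}" for q
  proof -
    \<comment> \<open>With this choice \<open>e \<le> 1\<close>, so points of
      \<open>ball q e\<close> have modulus below \<open>cmod q + 1 = 1 / e\<close>.\<close>
    define e where "e = 1 / (cmod q + 1)"
    have "0 < cmod q + 1"
      by (simp add: add_nonneg_pos)
    then have e: "0 < e" "e \<le> 1" "1 / e = cmod q + 1"
      by (auto simp: e_def divide_simps)
    have "cmod x < cmod q + 1" if "x \<in> ball q e" for x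
      using that e norm_triangle_sub[of x q] by (auto simp: dist_norm norm_minus_commute)
    then show ?thesis
      using e by (intro exI[of _ e]) (force simp: puncture_nhd_def)
  qed
  have Some_Some: "\<exists>e>0. puncture_nhd e (Some q) \<inter> puncture_nhd e (Some q') = {}" if "q \<noteq> q'" for q q'
    using that by (intro exI[of _ "dist q q' / 2"]) (auto simp: puncture_nhd_def intro!: disjoint_ballI)
  have pair: "\<exists>e>0. puncture_nhd e p \<inter> puncture_nhd e p' = {}" if "p \<noteq> p'" for p p'
    using that None_Some Some_Some by (cases p; cases p') (auto simp: Int_commute)
  have "\<forall>\<^sub>F e in at_right 0. p \<noteq> p' \<longrightarrow> puncture_nhd e p \<inter> puncture_nhd e p' = {}" for p p'
  proof (cases "p = p'")
    case False
    then obtain e where e: "e > 0" "puncture_nhd e p \<inter> puncture_nhd e p' = {}"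
      using pair by blast
    have "\<forall>\<^sub>F d in at_right 0. d \<in> {0<..<e}"
      using e(1) by (rule eventually_at_right_real)
    then show ?thesis
      by (rule eventually_mono) (use e puncture_nhd_mono[of _ e] in fastforce)
  qed simp
  then have "\<forall>\<^sub>F e in at_right 0. \<forall>x\<in>punctures \<times> punctures. fst x \<noteq> snd x \<longrightarrow>
      puncture_nhd e (fst x) \<inter> puncture_nhd e (snd x) = {}"
    using Q(1) by (intro eventually_ball_finite) auto
  moreover have "\<forall>\<^sub>F e :: real in at_right 0. e > 0"
    by (rule eventually_at_right_less)
  ultimately have "\<forall>\<^sub>F e in at_right 0. e > 0 \<and> (\<forall>x\<in>punctures \<times> punctures. fst x \<noteq> snd x \<longrightarrow>
      puncture_nhd e (fst x) \<inter> puncture_nhd e (snd x) = {})"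
    by eventually_elim auto
  then obtain e where e: "e > 0" "\<forall>x\<in>punctures \<times> punctures. fst x \<noteq> snd x \<longrightarrow>
      puncture_nhd e (fst x) \<inter> puncture_nhd e (snd x) = {}"
    using eventually_happens' trivial_limit_at_right_real by blast
  show thesis
  proof (rule that[OF e(1)])
    fix p p' assume "p \<in> punctures" "p' \<in> punctures" "p \<noteq> p'"
    then show "puncture_nhd e p \<inter> puncture_nhd e p' = {}"
      using bspec[OF e(2), of "(p, p')"] by auto
  qed
qed

text \<open>The projected orbit leaves every compact set, so it ends up in a union of small disjoint
  neighbourhoods of punctures. Consecutive orbit points are within the fixed distance
  \<open>\<rho>\<close>, which rules out a jump between two of these neighbourhoods.\<close>

lemma converges_to_puncture:
  assumes nofix: "\<nexists>p. cmod p < 1 \<and> h p = p" and z: "cmod z < 1"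
  obtains p where "p \<in> punctures" "filterlim (\<lambda>n. \<pi> ((h ^^ n) z)) (sphere_nhds p) sequentially"
proof -
  define X where "X n = \<pi> ((h ^^ n) z)" for n
  obtain e0 where e0: "e0 > 0"
    "\<And>p p'. \<lbrakk>p \<in> punctures; p' \<in> punctures; p \<noteq> p'\<rbrakk> \<Longrightarrow> puncture_nhd e0 p \<inter> puncture_nhd e0 p' = {}"
    using disjoint_puncture_nhds by blast
  define \<rho> where "\<rho> = pdist z (h z)"
  have \<rho>: "\<rho> < 1"
    using z by (auto simp: \<rho>_def intro: pdist_lt_1 h_norm)
  \<comment> \<open>The scale \<open>d < e\<close> is taken so small that a point projecting into
    the \<open>d\<close>-neighbourhood of a puncture has its successor in the
    \<open>e\<close>-neighbourhood of the same one. Disjointness then identifies the puncture whose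
    \<open>d\<close>-neighbourhood holds the successor.\<close>
  have trapped: "\<exists>p\<in>punctures. \<forall>\<^sub>F n in sequentially. X n \<in> puncture_nhd e p" if e: "0 < e" "e \<le> e0" for e
  proof -
    have "\<forall>\<^sub>F d in at_right 0. \<forall>w w'. cmod w < 1 \<longrightarrow> cmod w' < 1 \<longrightarrow> pdist w w' \<le> \<rho> \<longrightarrow>
        \<pi> w \<in> puncture_nhd d p \<longrightarrow> \<pi> w' \<in> puncture_nhd e p" if p: "p \<in> punctures" for p
    proof -
      obtain A where A: "eventually A (sphere_nhds p)"
        "\<And>w w'. \<lbrakk>cmod w < 1; cmod w' < 1; pdist w w' \<le> \<rho>; A (\<pi> w)\<rbrakk> \<Longrightarrow> \<pi> w' \<in> puncture_nhd e p"
        using near_puncture[OF p \<rho> eventually_puncture_nhd[OF e(1)]] by blast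
      obtain d0 where d0: "d0 > 0" "\<And>x. x \<in> puncture_nhd d0 p \<Longrightarrow> A x"
        using puncture_nhd_basis[OF A(1)] by blast
      have "\<forall>\<^sub>F d in at_right 0. d \<in> {0<..<d0}"
        using d0(1) by (rule eventually_at_right_real)
      then show ?thesis
      proof (rule eventually_mono)
        fix d assume "d \<in> {0<..<d0}"
        then have "puncture_nhd d p \<subseteq> puncture_nhd d0 p"
          by (intro puncture_nhd_mono) auto
        then show "\<forall>w w'. cmod w < 1 \<longrightarrow> cmod w' < 1 \<longrightarrow> pdist w w' \<le> \<rho> \<longrightarrow>
            \<pi> w \<in> puncture_nhd d p \<longrightarrow> \<pi> w' \<in> puncture_nhd e p"
          using d0(2) A(2) by blast
      qed
    qed
    then have "\<forall>\<^sub>F d in at_right 0. \<forall>p\<in>punctures. \<forall>w w'. cmod w < 1 \<longrightarrow> cmod w' < 1 \<longrightarrow> pdist w w' \<le> \<rho> \<longrightarrow>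
        \<pi> w \<in> puncture_nhd d p \<longrightarrow> \<pi> w' \<in> puncture_nhd e p"
      using Q(1) by (intro eventually_ball_finite) auto
    moreover have "\<forall>\<^sub>F d in at_right 0. d \<in> {0<..<e}"
      using e(1) by (rule eventually_at_right_real)
    ultimately have "\<forall>\<^sub>F d in at_right 0. d \<in> {0<..<e} \<and> (\<forall>p\<in>punctures. \<forall>w w'. cmod w < 1 \<longrightarrow>
        cmod w' < 1 \<longrightarrow> pdist w w' \<le> \<rho> \<longrightarrow> \<pi> w \<in> puncture_nhd d p \<longrightarrow> \<pi> w' \<in> puncture_nhd e p)"
      by eventually_elim auto
    from eventually_happens'[OF trivial_limit_at_right_real this]
    obtain d where d: "0 < d" "d < e" and
      dd: "\<forall>p\<in>punctures. \<forall>w w'. cmod w < 1 \<longrightarrow> cmod w' < 1 \<longrightarrow> pdist w w' \<le> \<rho> \<longrightarrow>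
          \<pi> w \<in> puncture_nhd d p \<longrightarrow> \<pi> w' \<in> puncture_nhd e p"
      by auto
    define K where "K = - (\<Union>p\<in>punctures. puncture_nhd d p)"
    have "closed K"
      unfolding K_def by (intro closed_Compl open_UN ballI open_puncture_nhd)
    moreover have "K \<subseteq> cball 0 (1 / d)"
      by (auto simp: K_def puncture_nhd_def)
    ultimately have "compact K"
      by (meson bounded_cball bounded_subset compact_eq_bounded_closed)
    moreover have "K \<subseteq> - Q"
      using d(1) by (force simp: K_def puncture_nhd_def)
    ultimately have "\<forall>\<^sub>F n in sequentially. X n \<notin> K"
      unfolding X_def by (rule leaves_compact[OF nofix z])
    then obtain n0 where n0: "\<And>n. n \<ge> n0 \<Longrightarrow> \<exists>p\<in>punctures. X n \<in> puncture_nhd d p"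
      unfolding eventually_sequentially K_def by auto
    then obtain p where p: "p \<in> punctures" "X n0 \<in> puncture_nhd d p"
      by blast
    have "X n \<in> puncture_nhd d p" if "n \<ge> n0" for n
      using that
    proof (induction n rule: dec_induct)
      case (step n)
      have "pdist ((h ^^ n) z) ((h ^^ n) (h z)) \<le> \<rho>"
        unfolding \<rho>_def using z h_norm by (intro pdist_iterate) auto
      then have "X (Suc n) \<in> puncture_nhd e p"
        using dd[rule_format, OF p(1) iterate_norm[OF z] iterate_norm[OF z], of n "Suc n"] step
        by (simp add: X_def funpow_swap1)
      moreover obtain p' where p': "p' \<in> punctures" "X (Suc n) \<in> puncture_nhd d p'"
        using n0[of "Suc n"] step by auto
      ultimately have "p' = p"
        using e0(2)[OF p'(1) p(1)] puncture_nhd_mono[of e e0 p] puncture_nhd_mono[of d e0 p'] e d by fastforce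
      then show ?case using p' by simp
    qed (use p in simp)
    then have "X n \<in> puncture_nhd e p" if "n \<ge> n0" for n
      using puncture_nhd_mono[of d e p] d that by auto
    then show ?thesis
      using p(1) unfolding eventually_sequentially by blast
  qed
  obtain p where p: "p \<in> punctures" "\<forall>\<^sub>F n in sequentially. X n \<in> puncture_nhd e0 p"
    using trapped[of e0] e0(1) by auto
  \<comment> \<open>The puncture supplied by \<open>trapped\<close> might depend on
    \<open>e\<close>. A common late index lies in the \<open>e0\<close>-neighbourhoods of both
    candidates, so they coincide.\<close>
  have small: "\<forall>\<^sub>F n in sequentially. X n \<in> puncture_nhd e p" if e: "0 < e" "e \<le> e0" for e
  proof -
    obtain p' where p': "p' \<in> punctures" "\<forall>\<^sub>F n in sequentially. X n \<in> puncture_nhd e p'"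
      using trapped[OF e] by blast
    have "\<forall>\<^sub>F n in sequentially. X n \<in> puncture_nhd e0 p \<and> X n \<in> puncture_nhd e0 p'"
      using p(2) p'(2)
      by eventually_elim (use puncture_nhd_mono[OF e, of p'] in auto)
    then obtain n where "X n \<in> puncture_nhd e0 p" "X n \<in> puncture_nhd e0 p'"
      using eventually_happens'[OF sequentially_bot] by blast
    then have "p' = p"
      using e0(2)[OF p'(1) p(1)] by auto
    then show ?thesis using p'(2) by simp
  qed
  have "filterlim X (sphere_nhds p) sequentially"
    unfolding filterlim_iff
  proof (intro allI impI)
    fix A assume A: "eventually A (sphere_nhds p)"
    obtain e where e: "e > 0" "\<And>x. x \<in> puncture_nhd e p \<Longrightarrow> A x"
      using puncture_nhd_basis[OF A] by blast
    have "\<forall>\<^sub>F n in sequentially. X n \<in> puncture_nhd (min e e0) p"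
      using e(1) e0(1) by (intro small) auto
    then show "\<forall>\<^sub>F n in sequentially. A (X n)"
      by (rule eventually_mono) (use e e0(1) puncture_nhd_mono[of "min e e0" e p] in auto)
  qed
  then show thesis
    using that p(1) unfolding X_def by blast
qed

end

section \<open>The limit puncture\<close>

text \<open>Periodicity makes \<open>\<phi>\<close> constant on the fibres of \<open>exp\<close>, so
  composing with \<open>Ln\<close> is legitimate in spite of its jump. Holomorphy is checked with a
  local branch of the logarithm in place of \<open>Ln\<close>.\<close>

lemma half_plane_periodic_descends:
  fixes \<phi> :: "complex \<Rightarrow> complex"
  assumes hol: "\<phi> holomorphic_on {\<zeta>. Re \<zeta> < 0}"
    and per: "\<And>\<zeta>. Re \<zeta> < 0 \<Longrightarrow> \<phi> (\<zeta> + 2 * of_real pi * \<i>) = \<phi> \<zeta>"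
  obtains \<Phi> where "\<Phi> holomorphic_on ball 0 1 - {0}" "\<And>\<zeta>. Re \<zeta> < 0 \<Longrightarrow> \<Phi> (exp \<zeta>) = \<phi> \<zeta>"
proof -
  have per_nat: "\<phi> (\<zeta> + of_nat n * (2 * of_real pi * \<i>)) = \<phi> \<zeta>" if "Re \<zeta> < 0" for \<zeta> n
  proof (induction n)
    case (Suc n)
    have "Re (\<zeta> + of_nat n * (2 * of_real pi * \<i>)) < 0"
      using that by simp
    note step = per[OF this]
    have "\<zeta> + of_nat (Suc n) * (2 * of_real pi * \<i>) =
        \<zeta> + of_nat n * (2 * of_real pi * \<i>) + 2 * of_real pi * \<i>"
      by (simp add: algebra_simps)
    then show ?case
      by (simp only: step Suc.IH)
  qed simp
  have per_exp: "\<phi> a = \<phi> b" if ab: "Re a < 0" "Re b < 0" "exp a = exp b" for a b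
  proof -
    obtain n :: int where n: "a = b + (of_int (2 * n) * pi) * \<i>"
      using ab(3) unfolding exp_eq by blast
    show ?thesis
    proof (cases "n \<ge> 0")
      case True
      then have "a = b + of_nat (nat n) * (2 * of_real pi * \<i>)"
        using n by simp
      then show ?thesis
        using per_nat[OF ab(2), of "nat n"] by simp
    next
      case False
      then have "b = a + of_nat (nat (- n)) * (2 * of_real pi * \<i>)"
        using n by simp
      then show ?thesis
        using per_nat[OF ab(1), of "nat (- n)"] by simp
    qed
  qed
  define \<Phi> where "\<Phi> x = \<phi> (Ln x)" for x
  have Ln_neg: "Re (Ln x) < 0" if "x \<in> ball 0 1 - {0}" for x
    using that by simp
  have \<Phi>_exp: "\<Phi> (exp \<zeta>) = \<phi> \<zeta>" if "Re \<zeta> < 0" for \<zeta>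
    unfolding \<Phi>_def using that by (intro per_exp) auto
  have "\<Phi> holomorphic_on ball 0 1 - {0}"
    unfolding holomorphic_on_def
  proof
    fix x0 :: complex assume x0: "x0 \<in> ball 0 1 - {0}"
    define S where "S = (ball 0 1 - {0}) \<inter> ball x0 (cmod x0)"
    \<comment> \<open>This branch is holomorphic near \<open>x0\<close> even if \<open>x0\<close>
      lies on the negative axis: on the disc of radius \<open>cmod x0\<close> about
      \<open>x0\<close> the quotient \<open>x / x0\<close> has positive real part.\<close>
    define l where "l x = Ln (x / x0) + Ln x0" for x
    have S: "open S" "x0 \<in> S"
      using x0 by (auto simp: S_def)
    have slit: "x / x0 \<notin> \<real>\<^sub>\<le>\<^sub>0" if "x \<in> S" for x
    proof
      assume neg: "x / x0 \<in> \<real>\<^sub>\<le>\<^sub>0"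
      have "cmod (1 - x / x0) * cmod x0 = cmod (x0 - x)"
        using x0 by (simp flip: norm_mult add: algebra_simps)
      also have "\<dots> < 1 * cmod x0"
        using that by (simp add: S_def dist_norm)
      finally have "cmod (1 - x / x0) < 1"
        using x0 by simp
      then have "1 - Re (x / x0) < 1"
        using complex_Re_le_cmod[of "1 - x / x0"] by simp
      then show False
        using neg by (simp add: complex_nonpos_Reals_iff)
    qed
    have exp_l: "exp (l x) = x" if "x \<in> S" for x
      using that x0 slit[OF that] by (auto simp: l_def exp_add S_def)
    have l_neg: "Re (l x) < 0" if "x \<in> S" for x
    proof -
      have "exp (Re (l x)) = cmod x"
        using exp_l[OF that] by (metis norm_exp_eq_Re)
      moreover have "cmod x < 1"
        using that by (simp add: S_def)
      ultimately show ?thesis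
        by (metis exp_less_one_iff)
    qed
    have "l holomorphic_on S"
      unfolding l_def using slit x0 by (auto intro!: holomorphic_intros)
    then have "(\<phi> \<circ> l) holomorphic_on S"
      using l_neg by (intro holomorphic_on_compose_gen[OF _ hol]) auto
    then have "\<Phi> holomorphic_on S"
      by (rule holomorphic_transform) (use \<Phi>_exp l_neg exp_l in force)
    then show "\<Phi> field_differentiable at x0 within ball 0 1 - {0}"
      using S by (meson field_differentiable_at_within holomorphic_on_imp_differentiable_at)
  qed
  then show thesis
    using that \<Phi>_exp by blast
qed

text \<open>\<open>k\<close> is controlled only on \<open>ball q r\<close>, so the iterate is
  restricted to a disc whose radius \<open>s\<close> depends on \<open>m\<close>; the derivative
  follows from the chain rule.\<close>

lemma iterate_near_fixed_point:
  fixes k :: "complex \<Rightarrow> complex"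
  assumes hol: "k holomorphic_on ball q r" and r: "r > 0" and fixed: "k q = q"
    and der: "(k has_field_derivative c) (at q)"
  obtains s where "0 < s" "s \<le> r" "(k ^^ m) holomorphic_on ball q s"
    "(k ^^ m) ` ball q s \<subseteq> ball q r" "((k ^^ m) has_field_derivative c ^ m) (at q)" "(k ^^ m) q = q"
proof -
  have "\<exists>s. 0 < s \<and> s \<le> r \<and> (k ^^ m) holomorphic_on ball q s \<and> (k ^^ m) ` ball q s \<subseteq> ball q r \<and>
      ((k ^^ m) has_field_derivative c ^ m) (at q) \<and> (k ^^ m) q = q"
  proof (induction m)
    case 0
    then show ?case
      using r by (intro exI[of _ r]) (auto simp: id_def intro!: holomorphic_intros derivative_eq_intros)
  next
    case (Suc m)
    then obtain s where s: "0 < s" "s \<le> r" "(k ^^ m) holomorphic_on ball q s"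
      "(k ^^ m) ` ball q s \<subseteq> ball q r" "((k ^^ m) has_field_derivative c ^ m) (at q)" "(k ^^ m) q = q"
      by blast
    have holS: "(k \<circ> (k ^^ m)) holomorphic_on ball q s"
      using s(4) by (intro holomorphic_on_compose_gen[OF s(3) hol])
    have "open (ball q s \<inter> (k \<circ> (k ^^ m)) -` ball q r)"
      using holomorphic_on_imp_continuous_on[OF holS] by (rule continuous_open_preimage) auto
    moreover have "q \<in> ball q s \<inter> (k \<circ> (k ^^ m)) -` ball q r"
      using s r fixed by simp
    ultimately obtain t where t: "t > 0" "ball q t \<subseteq> ball q s \<inter> (k \<circ> (k ^^ m)) -` ball q r"
      unfolding open_contains_ball by blast
    have der': "((k \<circ> (k ^^ m)) has_field_derivative c * c ^ m) (at q)"
      using s(5,6) der by (intro DERIV_chain) simp_all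
    show ?case
    proof (intro exI[of _ "min t s"] conjI)
      show "(k ^^ Suc m) holomorphic_on ball q (min t s)"
        using holS by (auto intro: holomorphic_on_subset)
      show "(k ^^ Suc m) ` ball q (min t s) \<subseteq> ball q r"
        using t(2) by auto
      show "((k ^^ Suc m) has_field_derivative c ^ Suc m) (at q)"
        using der' by simp
    qed (use s t fixed in auto)
  qed
  then show thesis
    using that by blast
qed

section \<open>The limit puncture is an isolated point of the complement of \<open>U\<close>\<close>

context lifted_inverse
begin

text \<open>The circle of radius \<open>\<bar>b - q\<bar>\<close> about the puncture is parametrised by the imaginary segment of
  length \<open>1\<close> in the unit disc, which bounds the distance between suitable preimages.\<close>

lemma preimage_on_circle:
  assumes e: "ball q e - {q} \<subseteq> - Q" and q: "q \<in> Q" and w: "cmod w < 1"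
    and small: "cmod (\<pi> w - q) * exp (2 * pi) < e" and b: "cmod (b - q) = cmod (\<pi> w - q)"
  obtains b' where "cmod b' < 1" "\<pi> b' = b" "pdist b' w \<le> 1 / 2"
proof -
  define a where "a = \<pi> w - q"
  have a: "a \<noteq> 0"
    using \<pi>_notin[OF w] q by (auto simp: a_def)
  \<comment> \<open>For \<open>u\<close> in the unit disc the distance from \<open>q\<close> grows
    by a factor below \<open>exp (2 * pi)\<close>, which explains \<open>small\<close>. Imaginary
    \<open>u\<close> of modulus at most 1/2 already sweep out the whole circle, since arguments are
    bounded by \<open>pi\<close>.\<close>
  define F where "F u = q + a * exp (2 * of_real pi * u)" for u :: complex
  have F_in: "F u \<in> ball q e - {q}" if "cmod u < 1" for u
  proof -
    have "Re u < 1"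
      using that complex_Re_le_cmod[of u] by simp
    then have "cmod a * exp (2 * pi * Re u) < cmod a * exp (2 * pi)"
      using a by simp
    then have "cmod (a * exp (2 * of_real pi * u)) < e"
      using small by (simp add: norm_mult a_def)
    then show ?thesis
      using a by (simp add: F_def dist_norm)
  qed
  have "F holomorphic_on ball 0 1"
    unfolding F_def by (intro holomorphic_intros)
  moreover have "F ` ball 0 1 \<subseteq> - Q"
  proof (rule image_subsetI)
    fix u :: complex assume "u \<in> ball 0 1"
    then have "F u \<in> ball q e - {q}"
      by (intro F_in) simp
    with e show "F u \<in> - Q"
      by blast
  qed
  moreover have "\<pi> w = F 0"
    by (simp add: F_def a_def)
  ultimately obtain F' where F': "F' holomorphic_on ball 0 1" "F' ` ball 0 1 \<subseteq> ball 0 1" "F' 0 = w"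
    "\<And>u. u \<in> ball 0 1 \<Longrightarrow> \<pi> (F' u) = F u"
    using lift[of "ball 0 1" F 0 w] w by auto
  define c where "c = (b - q) / a"
  define u where "u = \<i> * of_real (Arg c) / (2 * of_real pi)"
  have "cmod u = \<bar>Arg c\<bar> / (2 * pi)"
    by (simp add: u_def norm_mult norm_divide)
  also have "\<dots> \<le> pi / (2 * pi)"
    using Arg_bounded[of c] by (intro divide_right_mono) auto
  finally have u: "cmod u \<le> 1 / 2" by simp
  have c1: "cmod c = 1"
    using a b by (simp add: norm_divide a_def c_def)
  then have "c \<noteq> 0"
    by auto
  then have "exp (2 * of_real pi * u) = c"
    using Arg_eq[of c] c1 by (simp add: u_def)
  then have Fu: "F u = b"
    using a by (simp add: F_def c_def)
  have "pdist (F' u) (F' 0) \<le> pdist u 0"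
    using F' u by (intro Schwarz_Pick) auto
  then have "pdist (F' u) w \<le> 1 / 2"
    using u F'(3) by (simp add: pdist_commute)
  moreover have "cmod (F' u) < 1"
    using F'(2) u by (auto simp: image_subset_iff)
  ultimately show thesis
    using that[of "F' u"] F'(4)[of u] Fu u by simp
qed

lemma isolated_puncture:
  assumes "q \<in> Q"
  obtains e where "e > 0" "ball q e - {q} \<subseteq> - Q"
proof -
  obtain d where "d > 0" "\<And>x. x \<in> Q \<Longrightarrow> x \<noteq> q \<Longrightarrow> d \<le> dist q x"
    using finite_set_avoid[OF Q(1), of q] by blast
  then show thesis
    using that[of d] by force
qed

text \<open>Suppose points \<open>b\<close> outside \<open>U\<close> accumulate at \<open>q\<close>.
  The distance of the projected orbit from \<open>q\<close> tends to 0, so somewhere along a segment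
  joining consecutive orbit times it equals the distance of \<open>b\<close>. There
  \<open>preimage_on_circle\<close> supplies a preimage of \<open>b\<close> at bounded distance from
  the orbit. As this happens infinitely often, \<open>h\<close> would have a fixed point.\<close>

lemma limit_isolated_in_compl:
  assumes nofix: "\<nexists>p. cmod p < 1 \<and> h p = p" and z: "cmod z < 1" and q: "q \<in> Q"
    and lim: "(\<lambda>n. \<pi> ((h ^^ n) z)) \<longlonglongrightarrow> q"
  obtains e where "e > 0" "ball q e - {q} \<subseteq> U"
proof -
  obtain e where e: "e > 0" "ball q e - {q} \<subseteq> - Q"
    using isolated_puncture[OF q] by blast
  define e' where "e' = e / exp (2 * pi)"
  have e': "e' > 0"
    using e by (simp add: e'_def)
  define C where "C = closed_segment z (h z)"
  have hz: "cmod (h z) < 1"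
    using z by (rule h_norm)
  have C: "C \<subseteq> ball 0 1"
    unfolding C_def using z hz by (intro closed_segment_subset) auto
  obtain \<rho> where \<rho>: "\<rho> < 1" "\<And>c. c \<in> C \<Longrightarrow> cmod c < 1 \<and> pdist z c \<le> \<rho>"
    using pdist_bounded_on_compact[OF z _ C] by (auto simp: C_def)
  have "0 \<le> \<rho>"
    using \<rho>(2)[of z] by (simp add: C_def)
  have p: "Some q \<in> punctures"
    using q by simp
  have lim': "filterlim (\<lambda>n. \<pi> ((h ^^ n) z)) (sphere_nhds (Some q)) sequentially"
    using lim by (simp add: sphere_nhds_def)
  have "\<forall>\<^sub>F x in sphere_nhds (Some q). x \<in> ball q e'"
    using e' eventually_nhds_in_open[of "ball q e'" q] by (simp add: sphere_nhds_def)
  then have "\<forall>\<^sub>F n in sequentially. \<forall>c\<in>C. \<pi> ((h ^^ n) c) \<in> ball q e'"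
    by (intro uniform_convergence[OF z p lim' \<rho>])
  then obtain n0 where n0: "\<And>n c. n \<ge> n0 \<Longrightarrow> c \<in> C \<Longrightarrow> \<pi> ((h ^^ n) c) \<in> ball q e'"
    unfolding eventually_sequentially by blast
  \<comment> \<open>Combines the distance 1/2 from \<open>preimage_on_circle\<close> with
    \<open>\<rho>\<close>, which bounds the distance from \<open>z\<close> to any point of the
    segment \<open>C\<close>.\<close>
  define r where "r = (1 / 2 + \<rho>) / (1 + 1 / 2 * \<rho>)"
  have r: "r < 1"
    unfolding r_def using \<rho> \<open>0 \<le> \<rho>\<close> by (intro add_div_lt_1) auto
  define X where "X n = cmod (\<pi> ((h ^^ n) z) - q)" for n
  have X0: "X n > 0" for n
    using \<pi>_iterate_notin[OF z, of n] q by (auto simp: X_def)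
  have limX: "X \<longlonglongrightarrow> 0"
    using lim unfolding X_def by (simp add: LIM_zero tendsto_norm_zero)
  show thesis
  proof (rule ccontr)
    assume "\<not> thesis"
    then have omitted: "\<exists>b. b \<in> ball q d - {q} \<and> b \<notin> U" if "d > 0" for d
      using that \<open>\<not> thesis\<close> \<open>\<And>e. \<lbrakk>e > 0; ball q e - {q} \<subseteq> U\<rbrakk> \<Longrightarrow> thesis\<close> by blast
    have "\<exists>n\<ge>N. \<exists>b. cmod b < 1 \<and> \<pi> b \<notin> U \<and> pdist b ((h ^^ n) z) \<le> r" for N
    proof -
      \<comment> \<open>Choosing \<open>b\<close> closer to \<open>q\<close> than the orbit is at
        time \<open>M\<close> forces the crossing of its circle to happen after both
        \<open>N\<close> and \<open>n0\<close>.\<close>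
      define M where "M = max N n0"
      obtain b where b: "b \<in> ball q (X M) - {q}" "b \<notin> U"
        using omitted[OF X0] by blast
      define \<beta> where "\<beta> = cmod (b - q)"
      have \<beta>: "0 < \<beta>" "\<beta> < X M"
        using b by (auto simp: \<beta>_def dist_norm norm_minus_commute)
      have "\<exists>n\<ge>M. \<beta> \<le> X n \<and> X (Suc n) \<le> \<beta>"
      proof (rule ccontr)
        assume *: "\<not> ?thesis"
        have lower: "\<beta> \<le> X n" if "n \<ge> M" for n
          using that
        proof (induction n rule: dec_induct)
          case (step n)
          with * show ?case by force
        qed (use \<beta> in simp)
        obtain N' where "\<And>n. n \<ge> N' \<Longrightarrow> X n < \<beta>"
          using order_tendstoD(2)[OF limX \<beta>(1)] unfolding eventually_sequentially by blast
        then have "X (max M N') < \<beta>"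
          by simp
        moreover have "\<beta> \<le> X (max M N')"
          by (rule lower) simp
        ultimately show False
          by simp
      qed
      then obtain n where n: "n \<ge> M" "\<beta> \<le> X n" "X (Suc n) \<le> \<beta>"
        by blast
      \<comment> \<open>This distance varies continuously along \<open>C\<close>, from
        \<open>X n\<close> at \<open>z\<close> to \<open>X (Suc n)\<close> at \<open>h z\<close>, so
        it takes the value \<open>\<beta>\<close> in between.\<close>
      let ?f = "\<lambda>c. cmod (\<pi> ((h ^^ n) c) - q)"
      have "(\<pi> \<circ> (h ^^ n)) holomorphic_on C"
        by (intro holomorphic_on_compose_gen[OF holomorphic_on_subset[OF holomorphic_iterate C] hol\<pi>])
           (use C iterate_norm in auto)
      then have "continuous_on C (\<pi> \<circ> (h ^^ n))"
        by (rule holomorphic_on_imp_continuous_on)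
      then have "continuous_on C ?f"
        by (intro continuous_intros) (simp add: o_def)
      then have "connected (?f ` C)"
        by (rule connected_continuous_image) (simp add: C_def)
      moreover have "X n \<in> ?f ` C" "X (Suc n) \<in> ?f ` C"
        unfolding X_def by (auto simp: C_def funpow_swap1)
      ultimately have "\<beta> \<in> ?f ` C"
        using n connected_contains_Icc[of "?f ` C" "X (Suc n)" "X n"] by auto
      then obtain c where c: "c \<in> C" "cmod (\<pi> ((h ^^ n) c) - q) = \<beta>"
        by auto
      have c1: "cmod c < 1" "pdist z c \<le> \<rho>"
        using \<rho>(2)[OF c(1)] by auto
      have "\<pi> ((h ^^ n) c) \<in> ball q e'"
        using n0[OF _ c(1)] n(1) by (simp add: M_def)
      then have small: "cmod (\<pi> ((h ^^ n) c) - q) * exp (2 * pi) < e"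
        by (simp add: e'_def dist_norm norm_minus_commute pos_less_divide_eq)
      have "cmod (b - q) = cmod (\<pi> ((h ^^ n) c) - q)"
        using c(2) by (simp add: \<beta>_def)
      then obtain b' where b': "cmod b' < 1" "\<pi> b' = b" "pdist b' ((h ^^ n) c) \<le> 1 / 2"
        using preimage_on_circle[OF e(2) q iterate_norm[OF c1(1)] small] by blast
      have "pdist b' ((h ^^ n) z) \<le> r"
        unfolding r_def
      proof (rule pdist_strong_triangle[of _ _ "(h ^^ n) c"])
        show "pdist ((h ^^ n) c) ((h ^^ n) z) \<le> \<rho>"
          using pdist_iterate[OF c1(1) z, of n] c1(2) by (simp add: pdist_commute)
      qed (use b'(1,3) \<rho>(1) z c1(1) in \<open>simp_all add: iterate_norm\<close>)
      then show ?thesis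
        using n(1) b' b(2) by (intro exI[of _ n] exI[of _ b'] conjI) (simp_all add: M_def)
    qed
    then have "\<exists>\<^sub>F n in sequentially. \<exists>b. cmod b < 1 \<and> \<pi> b \<notin> U \<and> pdist b ((h ^^ n) z) \<le> r"
      unfolding frequently_sequentially by blast
    then show False
      using fixed_point_if_near_omitted[OF z r] nofix by blast
  qed
qed

section \<open>Extension of \<open>g\<close> to the limit puncture and its multiplier\<close>

text \<open>Near \<open>q\<close> the map \<open>g\<close> omits \<open>q\<close> and a second
  puncture, so it has a limit or a pole there. Since \<open>g\<close> moves the projected orbit one
  step back, its values along that orbit tend to \<open>q\<close>, which identifies the
  limit.\<close>

lemma extends_to_limit:
  assumes z: "cmod z < 1" and q: "q \<in> Q" and lim: "(\<lambda>n. \<pi> ((h ^^ n) z)) \<longlonglongrightarrow> q"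
    and e: "e > 0" "ball q e - {q} \<subseteq> U"
  obtains G where "G holomorphic_on insert q U" "\<And>u. u \<in> U \<Longrightarrow> G u = g u" "G q = q"
proof -
  have qU: "q \<notin> U"
    using q U(2) by auto
  obtain a where a: "a \<in> Q" "a \<noteq> q"
    using other_puncture by blast
  have holg': "g holomorphic_on ball q e - {q}"
    using holg e(2) by (rule holomorphic_on_subset)
  have gQ: "g w \<noteq> q \<and> g w \<noteq> a" if "w \<in> ball q e - {q}" for w
  proof -
    have "g w \<notin> Q"
      using g_im e(2) that by blast
    then show ?thesis
      using q a(1) by auto
  qed
  have lims: "(\<exists>l. (g \<longlongrightarrow> l) (at q)) \<or> filterlim g at_infinity (at q)"
    by (rule puncture_limit[OF open_ball _ _ holg' gQ]) (use e a in auto)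
  have Xq: "filterlim (\<lambda>n. \<pi> ((h ^^ Suc n) z)) (at q) sequentially"
    unfolding filterlim_at
  proof
    show "\<forall>\<^sub>F n in sequentially. \<pi> ((h ^^ Suc n) z) \<in> UNIV \<and> \<pi> ((h ^^ Suc n) z) \<noteq> q"
      using \<pi>_iterate_notin[OF z] q by (metis (mono_tags, lifting) UNIV_I eventuallyI)
    show "(\<lambda>n. \<pi> ((h ^^ Suc n) z)) \<longlonglongrightarrow> q"
      using lim by (rule LIMSEQ_Suc)
  qed
  have gX: "(\<lambda>n. g (\<pi> ((h ^^ Suc n) z))) \<longlonglongrightarrow> q"
    using lim by (simp only: g_iterate[OF z])
  have gq: "(g \<longlongrightarrow> q) (at q)"
    using lims
  proof
    assume "\<exists>l. (g \<longlongrightarrow> l) (at q)"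
    then obtain l where l: "(g \<longlongrightarrow> l) (at q)"
      by blast
    have "(\<lambda>n. g (\<pi> ((h ^^ Suc n) z))) \<longlonglongrightarrow> l"
      by (rule filterlim_compose[OF l Xq])
    then have "l = q"
      using gX by (rule LIMSEQ_unique)
    then show ?thesis using l by simp
  next
    assume "filterlim g at_infinity (at q)"
    then have "filterlim (\<lambda>n. g (\<pi> ((h ^^ Suc n) z))) at_infinity sequentially"
      using Xq by (rule filterlim_compose)
    then show ?thesis
      using not_tendsto_and_filterlim_at_infinity[OF sequentially_bot gX] by blast
  qed
  define G where "G u = (if u = q then q else g u)" for u
  have openU: "open (insert q U)"
  proof -
    have "insert q U = U \<union> ball q e"
      using e by auto
    then show ?thesis
      using U(1) by (metis open_Un open_ball)
  qed
  have "G holomorphic_on insert q U"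
  proof (rule no_isolated_singularity'[where K = "{q}"])
    fix y assume "y \<in> {q}"
    moreover have "(G \<longlongrightarrow> q) (at q)"
      using gq by (rule Lim_transform_eventually) (simp add: G_def eventually_at_filter)
    ultimately show "(G \<longlongrightarrow> G y) (at y within insert q U)"
      by (auto simp: G_def intro: tendsto_within_subset)
  next
    show "G holomorphic_on insert q U - {q}"
      using qU by (intro holomorphic_transform[OF holomorphic_on_subset[OF holg]]) (auto simp: G_def)
  qed (use openU in auto)
  then show thesis
    by (rule that) (use qU in \<open>auto simp: G_def\<close>)
qed

text \<open>If the derivative vanished, \<open>G\<close> would move points near \<open>q\<close>
  closer to \<open>q\<close>. As \<open>G\<close> runs the projected orbit backwards, the distances
  \<open>X n\<close> would eventually increase and could not tend to 0.\<close>

lemma multiplier_nonzero: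
  assumes z: "cmod z < 1" and q: "q \<in> Q" and lim: "(\<lambda>n. \<pi> ((h ^^ n) z)) \<longlonglongrightarrow> q"
    and G: "G field_differentiable at q" "\<And>u. u \<in> U \<Longrightarrow> G u = g u" "G q = q"
  shows "deriv G q \<noteq> 0"
proof
  assume "deriv G q = 0"
  then have "(G has_field_derivative 0) (at q)"
    using G(1) by (metis DERIV_deriv_iff_field_differentiable)
  then have "((\<lambda>x. (G x - q) / (x - q)) \<longlongrightarrow> 0) (at q)"
    using G(3) by (simp add: has_field_derivative_iff)
  then have "\<forall>\<^sub>F x in at q. cmod ((G x - q) / (x - q)) < 1"
    using order_tendstoD(2)[OF tendsto_norm_zero, of _ "at q" 1] by simp
  then have "\<forall>\<^sub>F x in at q. cmod (G x - q) < cmod (x - q)"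
    unfolding eventually_at_filter by eventually_elim (auto simp: norm_divide divide_less_eq)
  then obtain d where d: "d > 0" "\<And>x. x \<noteq> q \<Longrightarrow> dist x q < d \<Longrightarrow> cmod (G x - q) < cmod (x - q)"
    unfolding eventually_at by auto
  define X where "X n = cmod (\<pi> ((h ^^ n) z) - q)" for n
  have X0: "X n > 0" for n
    using \<pi>_iterate_notin[OF z, of n] q by (auto simp: X_def)
  have limX: "X \<longlonglongrightarrow> 0"
    using lim unfolding X_def by (simp add: LIM_zero tendsto_norm_zero)
  obtain N where N: "\<And>n. n \<ge> N \<Longrightarrow> X n < d"
    using order_tendstoD(2)[OF limX d(1)] unfolding eventually_sequentially by blast
  have grow: "X n < X (Suc n)" if "n \<ge> N" for n
  proof -
    have "\<pi> ((h ^^ Suc n) z) \<in> U"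
      using \<pi>h_U[OF iterate_norm[OF z]] by simp
    then have "G (\<pi> ((h ^^ Suc n) z)) = \<pi> ((h ^^ n) z)"
      using G(2) g_iterate[OF z] by simp
    then show ?thesis
      using d(2)[of "\<pi> ((h ^^ Suc n) z)"] N[of "Suc n"] X0[of "Suc n"] that
      by (auto simp: X_def dist_norm)
  qed
  have lower: "X N \<le> X n" if "n \<ge> N" for n
    using that
  proof (induction n rule: dec_induct)
    case (step n)
    then show ?case using grow[of n] by simp
  qed simp
  obtain N' where "\<And>n. n \<ge> N' \<Longrightarrow> X n < X N"
    using order_tendstoD(2)[OF limX X0] unfolding eventually_sequentially by blast
  then have "X (max N N') < X N"
    by simp
  moreover have "X N \<le> X (max N N')"
    by (rule lower) simp
  ultimately show False
    by simp
qed


text \<open>Continuing a preimage in the half-plane along the segments from \<open>(h ^^ n) z\<close> to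
  \<open>(h ^^ Suc n) z\<close> keeps all orbit points in the image of a single lift \<open>E'\<close> of \<open>E\<close>.\<close>

lemma half_plane_lift_of_orbit:
  assumes z: "cmod z < 1" and r: "r > 0"
    and orbit: "\<And>n c. n \<ge> n0 \<Longrightarrow> c \<in> closed_segment z (h z) \<Longrightarrow> \<pi> ((h ^^ n) c) \<in> ball q r - {q}"
    and E: "E = (\<lambda>\<zeta>. q + of_real r * exp \<zeta>)"
    and E': "E' holomorphic_on {\<zeta>. Re \<zeta> < 0}" "E' ` {\<zeta>. Re \<zeta> < 0} \<subseteq> ball 0 1"
      "\<And>\<zeta>. Re \<zeta> < 0 \<Longrightarrow> \<pi> (E' \<zeta>) = E \<zeta>"
    and base: "Re \<zeta>0 < 0" "E' \<zeta>0 = (h ^^ n0) z"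
    and n: "n \<ge> n0"
  shows "\<exists>\<zeta>. Re \<zeta> < 0 \<and> E' \<zeta> = (h ^^ n) z"
  using n
proof (induction n rule: dec_induct)
  case base
  then show ?case using \<open>Re \<zeta>0 < 0\<close> \<open>E' \<zeta>0 = (h ^^ n0) z\<close> by blast
next
  case (step n)
  then obtain \<zeta> where \<zeta>: "Re \<zeta> < 0" "E' \<zeta> = (h ^^ n) z"
    by blast
  define \<sigma> where "\<sigma> t = (h ^^ n) (linepath z (h z) t)" for t
  have seg: "linepath z (h z) t \<in> closed_segment z (h z)" if "t \<in> {0..1}" for t
    using that by (metis linepath_image_01 imageI)
  have segD: "closed_segment z (h z) \<subseteq> ball 0 1"
    using z h_norm by (intro closed_segment_subset) auto
  have \<sigma>_in: "cmod (\<sigma> t) < 1" "\<pi> (\<sigma> t) \<in> ball q r - {q}" if "t \<in> {0..1}" for t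
    using orbit[OF step(1) seg[OF that]] iterate_norm segD seg[OF that]
    by (auto simp: \<sigma>_def)
  have "continuous_on {0..1} ((h ^^ n) \<circ> linepath z (h z))"
  proof (rule continuous_on_compose)
    show "continuous_on (linepath z (h z) ` {0..1}) (h ^^ n)"
      unfolding linepath_image_01
      by (rule continuous_on_subset[OF holomorphic_on_imp_continuous_on[OF holomorphic_iterate] segD])
  qed (rule continuous_on_linepath)
  then have cont\<sigma>: "continuous_on {0..1} \<sigma>"
    by (simp add: \<sigma>_def[abs_def] o_def)
  have cont\<pi>\<sigma>: "continuous_on {0..1} (\<lambda>t. \<pi> (\<sigma> t))"
    using \<sigma>_in(1) by (intro continuous_on_compose2[OF holomorphic_on_imp_continuous_on[OF hol\<pi>] cont\<sigma>]) auto
  define f where "f t = (\<pi> (\<sigma> t) - q) / of_real r" for t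
  have contf: "continuous_on {0..1} f"
    unfolding f_def using r by (intro continuous_intros cont\<pi>\<sigma>) auto
  have fnz: "f t \<noteq> 0" if "t \<in> {0..1}" for t
    using \<sigma>_in(2)[OF that] r by (auto simp: f_def)
  obtain l where l: "continuous_on {0..1} l" "\<And>t. t \<in> {0..1} \<Longrightarrow> f t = exp (l t)"
    using continuous_logarithm_on_contractible[OF contf convex_imp_contractible fnz] by auto
  define l' where "l' t = l t + (\<zeta> - l 0)" for t
  have "\<pi> (E' \<zeta>) = E \<zeta>"
    using E'(3) \<zeta>(1) .
  then have "exp \<zeta> = f 0"
    using \<zeta>(2) r by (simp add: f_def \<sigma>_def E linepath_def)
  then have exp_l': "exp (l' t) = f t" if "t \<in> {0..1}" for t
    using l(2)[OF that] l(2)[of 0] by (simp add: l'_def exp_add exp_diff)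
  have l'_neg: "Re (l' t) < 0" if "t \<in> {0..1}" for t
  proof -
    have "exp (Re (l' t)) = cmod (f t)"
      using exp_l'[OF that] by (metis norm_exp_eq_Re)
    moreover have "cmod (f t) < 1"
      using \<sigma>_in(2)[OF that] r by (simp add: f_def norm_divide dist_norm norm_minus_commute)
    ultimately show ?thesis
      by (metis exp_less_one_iff)
  qed
  have contl': "continuous_on {0..1} l'"
    unfolding l'_def by (intro continuous_intros l(1))
  have "E' (l' 1) = \<sigma> 1"
  proof (rule covering_space_lift_unique[OF cov, of "\<lambda>t. E' (l' t)" 0 \<sigma> "{0..1}" "\<lambda>t. \<pi> (\<sigma> t)"])
    show "E' (l' 0) = \<sigma> 0"
      using \<zeta>(2) by (simp add: l'_def \<sigma>_def linepath_def)
    show "(\<lambda>t. \<pi> (\<sigma> t)) \<in> {0..1} \<rightarrow> - Q" "\<sigma> \<in> {0..1} \<rightarrow> ball 0 1"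
      using \<sigma>_in(1) \<pi>_notin by auto
    show "continuous_on {0..1} (\<lambda>t. E' (l' t))"
      using l'_neg by (intro continuous_on_compose2[OF holomorphic_on_imp_continuous_on[OF E'(1)] contl']) auto
    show "(\<lambda>t. E' (l' t)) \<in> {0..1} \<rightarrow> ball 0 1"
      using E'(2) l'_neg by (auto simp: image_subset_iff)
    show "\<pi> (\<sigma> t) = \<pi> (E' (l' t))" if "t \<in> {0..1}" for t
      using E'(3)[OF l'_neg[OF that]] exp_l'[OF that] r by (simp add: E f_def)
  qed (use cont\<sigma> cont\<pi>\<sigma> in auto)
  moreover have "\<sigma> 1 = (h ^^ Suc n) z"
    by (simp add: \<sigma>_def linepath_def funpow_swap1)
  ultimately show ?case
    using l'_neg[of 1] by auto
qed

text \<open>The functions \<open>\<phi> j\<close> read \<open>\<pi> \<circ> h ^^ j\<close> along a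
  lift \<open>E'\<close> of the exponential covering. Near the puncture \<open>\<phi> m\<close> is
  the iterate of the local inverse \<open>k\<close>, so it descends to \<open>\<Phi>\<close> with
  derivative \<open>inverse lam ^ m\<close> at \<open>q\<close>. For a suitable \<open>m\<close>,
  \<open>\<Phi>\<close> maps the circle of radius \<open>r\<close> into the disc of radius
  \<open>r / 2\<close>, and Cauchy's inequality applies.\<close>

lemma limit_repelling:
  assumes z: "cmod z < 1" and q: "q \<in> Q" and lim: "(\<lambda>n. \<pi> ((h ^^ n) z)) \<longlonglongrightarrow> q"
    and e: "e > 0" "ball q e - {q} \<subseteq> U"
    and G: "G holomorphic_on ball q e" "\<And>u. u \<in> U \<Longrightarrow> G u = g u" "G q = q" "deriv G q \<noteq> 0"
  shows "1 < cmod (deriv G q)"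
proof -
  define lam where "lam = deriv G q"
  have openb: "open (ball q e)" and qb: "q \<in> ball q e"
    using e(1) by auto
  obtain r0 where r0: "r0 > 0" "ball q r0 \<subseteq> ball q e" "inj_on G (ball q r0)"
    using has_complex_derivative_locally_injective[OF G(1) qb openb G(4)] by blast
  have holG: "G holomorphic_on ball q r0"
    using G(1) r0(2) by (rule holomorphic_on_subset)
  obtain k where k: "k holomorphic_on (G ` ball q r0)"
    "\<And>x. x \<in> ball q r0 \<Longrightarrow> deriv G x * deriv k (G x) = 1" "\<And>x. x \<in> ball q r0 \<Longrightarrow> k (G x) = x"
    using holomorphic_has_inverse[OF holG open_ball r0(3)] by blast
  have openG: "open (G ` ball q r0)"
    by (rule open_mapping_thm3[OF holG open_ball r0(3)])
  have "q \<in> G ` ball q r0"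
    using r0(1) G(3) by (intro image_eqI[of q G q]) auto
  then obtain d where d: "d > 0" "ball q d \<subseteq> G ` ball q r0"
    using openG unfolding open_contains_ball by blast
  define r1 where "r1 = min d r0"
  have r1: "r1 > 0" "ball q r1 \<subseteq> G ` ball q r0" "ball q r1 \<subseteq> ball q r0"
    using d r0(1) by (auto simp: r1_def)
  have kq: "k q = q"
    using k(3)[of q] G(3) r0(1) by simp
  have holk: "k holomorphic_on ball q r1"
    using k(1) r1(2) by (rule holomorphic_on_subset)
  have "(k has_field_derivative deriv k q) (at q)"
    using holk r1(1) by (intro holomorphic_derivI[of k "ball q r1"]) auto
  moreover have "deriv k q = inverse lam"
    using k(2)[of q] G(3) r0(1) by (simp add: lam_def inverse_unique)
  ultimately have derk: "(k has_field_derivative inverse lam) (at q)"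
    by simp
  have r1U: "ball q r1 - {q} \<subseteq> - Q"
    using r1(3) r0(2) e(2) U(2) by blast
  define C where "C = closed_segment z (h z)"
  have CD: "C \<subseteq> ball 0 1"
    unfolding C_def using z h_norm by (intro closed_segment_subset) auto
  have p: "Some q \<in> punctures"
    using q by simp
  have lim': "filterlim (\<lambda>n. \<pi> ((h ^^ n) z)) (sphere_nhds (Some q)) sequentially"
    using lim by (simp add: sphere_nhds_def)
  have unif: "\<forall>\<^sub>F n in sequentially. \<forall>c\<in>S. \<pi> ((h ^^ n) c) \<in> ball q d" if "compact S" "S \<subseteq> ball 0 1" "d > 0" for S d
  proof -
    obtain \<rho> where \<rho>: "\<rho> < 1" "\<And>c. c \<in> S \<Longrightarrow> cmod c < 1 \<and> pdist z c \<le> \<rho>"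
      using pdist_bounded_on_compact[OF z \<open>compact S\<close> \<open>S \<subseteq> ball 0 1\<close>] by blast
    have "\<forall>\<^sub>F x in sphere_nhds (Some q). x \<in> ball q d"
      using \<open>d > 0\<close> eventually_nhds_in_open[of "ball q d" q] by (simp add: sphere_nhds_def)
    then show ?thesis
      by (intro uniform_convergence[OF z p lim' \<rho>])
  qed
  obtain n0 where n0: "\<And>n c. n \<ge> n0 \<Longrightarrow> c \<in> C \<Longrightarrow> \<pi> ((h ^^ n) c) \<in> ball q r1"
    using unif[OF _ CD r1(1)] unfolding eventually_sequentially by (auto simp: C_def)
  define L where "L = {\<zeta>. Re \<zeta> < 0}"
  have L: "open L" "convex L"
    by (simp_all add: L_def open_halfspace_Re_lt convex_halfspace_Re_lt)
  define E where "E = (\<lambda>\<zeta>. q + of_real r1 * exp \<zeta>)"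
  have E_in: "E \<zeta> \<in> ball q r1 - {q}" if "\<zeta> \<in> L" for \<zeta>
    using that r1(1) by (simp add: E_def L_def dist_norm norm_mult)
  have holE: "E holomorphic_on L"
    unfolding E_def by (intro holomorphic_intros)
  define x0 where "x0 = (\<pi> ((h ^^ n0) z) - q) / of_real r1"
  have zC: "z \<in> C"
    by (simp add: C_def)
  have x0: "x0 \<noteq> 0" "cmod x0 < 1"
    using n0[OF order_refl zC] \<pi>_iterate_notin[OF z, of n0] q r1(1)
    by (auto simp: x0_def norm_divide dist_norm norm_minus_commute)
  define \<zeta>0 where "\<zeta>0 = Ln x0"
  have \<zeta>0: "\<zeta>0 \<in> L" "\<pi> ((h ^^ n0) z) = E \<zeta>0"
  proof -
    show "\<zeta>0 \<in> L"
      using x0 by (simp add: \<zeta>0_def L_def)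
    show "\<pi> ((h ^^ n0) z) = E \<zeta>0"
      using x0 r1(1) by (simp add: \<zeta>0_def E_def) (simp add: x0_def)
  qed
  have "E ` L \<subseteq> - Q"
    using E_in r1U by blast
  then obtain E' where E': "E' holomorphic_on L" "E' ` L \<subseteq> ball 0 1" "E' \<zeta>0 = (h ^^ n0) z"
    "\<And>\<zeta>. \<zeta> \<in> L \<Longrightarrow> \<pi> (E' \<zeta>) = E \<zeta>"
    using lift[OF L(2) holE _ \<zeta>0(1) iterate_norm[OF z] \<zeta>0(2)] by blast
  have E'_norm: "cmod (E' \<zeta>) < 1" if "\<zeta> \<in> L" for \<zeta>
    using E'(2) that by (auto simp: image_subset_iff)
  have orbit: "\<exists>\<zeta>\<in>L. E' \<zeta> = (h ^^ n) z" if "n \<ge> n0" for n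
  proof -
    have seg: "\<pi> ((h ^^ m) c) \<in> ball q r1 - {q}" if "m \<ge> n0" "c \<in> closed_segment z (h z)" for m c
    proof -
      have "cmod c < 1"
        using that(2) CD by (auto simp: C_def)
      then have "\<pi> ((h ^^ m) c) \<noteq> q"
        using \<pi>_iterate_notin q by blast
      then show ?thesis
        using n0[of m c] that by (simp add: C_def)
    qed
    have "\<exists>\<zeta>. Re \<zeta> < 0 \<and> E' \<zeta> = (h ^^ n) z"
    proof (rule half_plane_lift_of_orbit[OF z r1(1) seg E_def])
      show "E' \<zeta>0 = (h ^^ n0) z" "n0 \<le> n"
        using E'(3) that by auto
    qed (use E' \<zeta>0(1) in \<open>auto simp: L_def\<close>)
    then show ?thesis
      by (auto simp: L_def)
  qed
  \<comment> \<open>The radius of the circle that \<open>E\<close> traces on the line of real part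
    -1. The compact set \<open>S\<close> is the lift of one full turn of it.\<close>
  define r where "r = r1 * exp (- 1)"
  have r: "0 < r" "r < r1"
    using r1(1) by (auto simp: r_def)
  define S where "S = E' ` ((\<lambda>\<theta>. Complex (- 1) \<theta>) ` {0..2 * pi})"
  have arcL: "Complex (- 1) \<theta> \<in> L" for \<theta>
    by (simp add: L_def)
  have "continuous_on {0..2 * pi} (\<lambda>\<theta>. Complex (- 1) \<theta>)"
    unfolding Complex_eq by (intro continuous_intros)
  then have "compact ((\<lambda>\<theta>. Complex (- 1) \<theta>) ` {0..2 * pi})"
    by (rule compact_continuous_image) simp
  moreover have "continuous_on ((\<lambda>\<theta>. Complex (- 1) \<theta>) ` {0..2 * pi}) E'"
    using arcL by (intro continuous_on_subset[OF holomorphic_on_imp_continuous_on[OF E'(1)]]) auto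
  ultimately have "compact S"
    unfolding S_def by (rule compact_continuous_image[rotated])
  moreover have "S \<subseteq> ball 0 1"
    using E'(2) arcL by (auto simp: S_def)
  \<comment> \<open>\<open>m\<close> comes from locally uniform convergence to \<open>q\<close>; the
    radius \<open>r / 2\<close> is what yields the bound 1/2 on the derivative.\<close>
  ultimately obtain m where m: "\<And>c. c \<in> S \<Longrightarrow> \<pi> ((h ^^ m) c) \<in> ball q (r / 2)"
    using unif[of S "r / 2"] r(1) unfolding eventually_sequentially by auto
  define \<phi> where "\<phi> j \<zeta> = \<pi> ((h ^^ j) (E' \<zeta>))" for j \<zeta>
  have hol\<phi>: "\<phi> j holomorphic_on L" for j
  proof -
    have "(\<pi> \<circ> ((h ^^ j) \<circ> E')) holomorphic_on L"
      by (intro holomorphic_on_compose_gen[OF _ hol\<pi>] holomorphic_on_compose_gen[OF E'(1) holomorphic_iterate])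
        (use E'_norm iterate_norm in auto)
    then show ?thesis
      by (simp add: \<phi>_def[abs_def] o_def)
  qed
  obtain s where s: "0 < s" "s \<le> r1" "(k ^^ m) holomorphic_on ball q s"
    "(k ^^ m) ` ball q s \<subseteq> ball q r1" "((k ^^ m) has_field_derivative inverse lam ^ m) (at q)" "(k ^^ m) q = q"
    using iterate_near_fixed_point[OF holk r1(1) kq derk] by blast
  \<comment> \<open>The smaller half-plane on which \<open>E\<close> lands in
    \<open>ball q s\<close>, where the iterate of \<open>k\<close> is holomorphic.\<close>
  define Ls where "Ls = {\<zeta>. Re \<zeta> < ln (s / r1)}"
  have "ln (s / r1) \<le> 0"
    using s(1,2) r1(1) by simp
  then have Ls: "open Ls" "convex Ls" "Ls \<subseteq> L"
    by (auto simp: Ls_def L_def open_halfspace_Re_lt convex_halfspace_Re_lt)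
  have Ls_iff: "\<zeta> \<in> Ls \<longleftrightarrow> E \<zeta> \<in> ball q s" for \<zeta>
  proof -
    have "\<zeta> \<in> Ls \<longleftrightarrow> exp (Re \<zeta>) < s / r1"
      unfolding Ls_def using s(1) r1(1) by (metis divide_pos_pos exp_less_cancel_iff exp_ln mem_Collect_eq)
    then show ?thesis
      using r1(1) by (simp add: E_def dist_norm norm_mult field_simps)
  qed
  \<comment> \<open>The identity is first proved near a lifted orbit point \<open>\<zeta>n\<close>
    and then spreads over the connected set \<open>Ls\<close> by analytic continuation. At
    \<open>\<zeta>n\<close> the values \<open>\<phi> j\<close> are later points of the projected
    orbit, hence all close to \<open>q\<close>.\<close>
  have \<phi>_eq: "\<phi> m \<zeta> = (k ^^ m) (E \<zeta>)" if "\<zeta> \<in> Ls" for \<zeta>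
  proof -
    obtain n where n: "n \<ge> n0" "\<pi> ((h ^^ n) z) \<in> ball q s"
    proof -
      have "\<forall>\<^sub>F n in sequentially. \<pi> ((h ^^ n) z) \<in> ball q s"
        using unif[of "{z}" s] z s(1) by simp
      then obtain N where "\<And>n. n \<ge> N \<Longrightarrow> \<pi> ((h ^^ n) z) \<in> ball q s"
        unfolding eventually_sequentially by blast
      then show ?thesis
        using that[of "max N n0"] by simp
    qed
    obtain \<zeta>n where \<zeta>n: "\<zeta>n \<in> L" "E' \<zeta>n = (h ^^ n) z"
      using orbit[OF n(1)] by blast
    \<comment> \<open>On \<open>W\<close> every intermediate value stays in
      \<open>ball q r0\<close>, where \<open>k\<close> inverts \<open>G\<close>; so
      \<open>semiconj\<close> can be solved step by step for \<open>\<phi> (Suc j)\<close>.\<close>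
    define W where "W = (\<Inter>j\<in>{..m}. Ls \<inter> \<phi> j -` ball q r0)"
    have "open W"
      unfolding W_def
    proof (intro open_INT ballI)
      fix j
      have "continuous_on Ls (\<phi> j)"
        using hol\<phi> Ls(3) by (meson continuous_on_subset holomorphic_on_imp_continuous_on)
      then show "open (Ls \<inter> \<phi> j -` ball q r0)"
        using Ls(1) by (rule continuous_open_preimage) simp
    qed simp
    have "\<phi> j \<zeta>n \<in> ball q r0" for j
    proof -
      have "\<phi> j \<zeta>n = \<pi> ((h ^^ (j + n)) z)"
        by (simp add: \<phi>_def \<zeta>n(2) funpow_add)
      then show ?thesis
        using n0[of "j + n" z] zC n(1) r1(3) by auto
    qed
    moreover have "\<zeta>n \<in> Ls"
      using E'(4)[OF \<zeta>n(1)] \<zeta>n(2) n(2) by (simp add: Ls_iff)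
    ultimately have "\<zeta>n \<in> W"
      by (simp add: W_def)
    have eqW: "\<phi> m w = (k ^^ m) (E w)" if w: "w \<in> W" for w
    proof -
      have wL: "w \<in> L"
        using w Ls(3) by (auto simp: W_def)
      have "j \<le> m \<longrightarrow> \<phi> j w = (k ^^ j) (E w)" for j
      proof (induction j)
        case 0
        then show ?case using E'(4)[OF wL] by (simp add: \<phi>_def)
      next
        case (Suc j)
        show ?case
        proof
          assume j: "Suc j \<le> m"
          have "\<phi> (Suc j) w \<in> ball q r0"
            using w j by (auto simp: W_def)
          moreover have "G (\<phi> (Suc j) w) = \<phi> j w"
            using G(2)[OF \<pi>h_U[OF iterate_norm[OF E'_norm[OF wL]]]] semiconj[OF iterate_norm[OF E'_norm[OF wL]]]
            by (simp add: \<phi>_def)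
          ultimately have "\<phi> (Suc j) w = k (\<phi> j w)"
            using k(3) by metis
          then show "\<phi> (Suc j) w = (k ^^ Suc j) (E w)"
            using Suc j by simp
        qed
      qed
      then show ?thesis by simp
    qed
    show ?thesis
    proof (rule analytic_continuation_open[of W Ls "\<phi> m" "\<lambda>\<zeta>. (k ^^ m) (E \<zeta>)"])
      show "\<phi> m holomorphic_on Ls"
        using hol\<phi> Ls(3) by (rule holomorphic_on_subset)
      have "((k ^^ m) \<circ> E) holomorphic_on Ls"
        using holE Ls(3) Ls_iff by (intro holomorphic_on_compose_gen[OF _ s(3)]) (auto intro: holomorphic_on_subset)
      then show "(\<lambda>\<zeta>. (k ^^ m) (E \<zeta>)) holomorphic_on Ls"
        by (simp add: o_def)
    qed (use \<open>open W\<close> \<open>\<zeta>n \<in> W\<close> Ls eqW that in \<open>auto simp: W_def convex_connected\<close>)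
  qed
  \<comment> \<open>On \<open>Ls\<close> this is the periodicity of \<open>E\<close>; analytic
    continuation extends it to \<open>L\<close>, although \<open>E'\<close> itself need not be
    periodic.\<close>
  have "\<phi> m (\<zeta> + 2 * of_real pi * \<i>) = \<phi> m \<zeta>" if "\<zeta> \<in> L" for \<zeta>
  proof (rule analytic_continuation_open[of Ls L "\<lambda>\<zeta>. \<phi> m (\<zeta> + 2 * of_real pi * \<i>)" "\<phi> m"])
    have "(\<phi> m \<circ> (\<lambda>\<zeta>. \<zeta> + 2 * of_real pi * \<i>)) holomorphic_on L"
      by (intro holomorphic_on_compose_gen[OF _ hol\<phi>] holomorphic_intros) (auto simp: L_def)
    then show "(\<lambda>\<zeta>. \<phi> m (\<zeta> + 2 * of_real pi * \<i>)) holomorphic_on L"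
      by (simp add: o_def)
    have "Complex (ln (s / r1) - 1) 0 \<in> Ls"
      by (simp add: Ls_def)
    then show "Ls \<noteq> {}" by blast
    show "\<phi> m (\<zeta> + 2 * of_real pi * \<i>) = \<phi> m \<zeta>" if "\<zeta> \<in> Ls" for \<zeta>
    proof -
      have "\<zeta> + 2 * of_real pi * \<i> \<in> Ls"
        using that by (simp add: Ls_def)
      then show ?thesis
        using that by (simp add: \<phi>_eq E_def exp_add)
    qed
  qed (use Ls L hol\<phi> that in \<open>auto simp: convex_connected\<close>)
  then obtain \<Phi>0 where \<Phi>0: "\<Phi>0 holomorphic_on ball 0 1 - {0}" "\<And>\<zeta>. \<zeta> \<in> L \<Longrightarrow> \<Phi>0 (exp \<zeta>) = \<phi> m \<zeta>"
    using half_plane_periodic_descends[of "\<phi> m"] hol\<phi> unfolding L_def by auto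
  \<comment> \<open>The value at \<open>q\<close> is the one that makes \<open>\<Phi>\<close> agree
    with the iterate of \<open>k\<close> on \<open>ball q s\<close>, so the puncture is
    removable.\<close>
  define \<Phi> where "\<Phi> x = (if x = q then q else \<Phi>0 ((x - q) / of_real r1))" for x
  have \<Phi>E: "\<Phi> (E \<zeta>) = \<phi> m \<zeta>" if "\<zeta> \<in> L" for \<zeta>
    using \<Phi>0(2)[OF that] r1(1) by (simp add: \<Phi>_def E_def)
  have E_surj: "\<exists>\<zeta>. \<zeta> \<in> L \<and> E \<zeta> = x" if "x \<in> ball q r1 - {q}" for x
  proof -
    define y where "y = (x - q) / of_real r1"
    have "y \<noteq> 0" "cmod y < 1"
      using that r1(1) by (auto simp: y_def norm_divide dist_norm norm_minus_commute)
    then have "Ln y \<in> L" "E (Ln y) = x"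
      using r1(1) by (simp_all add: L_def E_def) (simp add: y_def)
    then show ?thesis by blast
  qed
  have \<Phi>k: "\<Phi> x = (k ^^ m) x" if x: "x \<in> ball q s" for x
  proof (cases "x = q")
    case False
    then obtain \<zeta> where "\<zeta> \<in> L" "E \<zeta> = x"
      using E_surj[of x] x s(2) by auto
    then show ?thesis
      using \<phi>_eq[of \<zeta>] \<Phi>E[of \<zeta>] x by (simp add: Ls_iff)
  qed (simp add: \<Phi>_def s(6))
  have hol\<Phi>: "\<Phi> holomorphic_on ball q r1"
  proof -
    have "\<Phi> holomorphic_on ball q s"
      using s(3) by (rule holomorphic_transform) (simp add: \<Phi>k)
    moreover have "\<Phi> holomorphic_on ball q r1 - {q}"
    proof -
      have "(\<Phi>0 \<circ> (\<lambda>x. (x - q) / of_real r1)) holomorphic_on ball q r1 - {q}"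
        using r1(1) by (intro holomorphic_on_compose_gen[OF _ \<Phi>0(1)] holomorphic_intros)
          (auto simp: norm_divide dist_norm norm_minus_commute)
      then show ?thesis
        by (rule holomorphic_transform) (simp add: \<Phi>_def)
    qed
    ultimately have "\<Phi> holomorphic_on (ball q s \<union> (ball q r1 - {q}))"
      by (rule holomorphic_on_Un) (auto intro: open_delete)
    moreover have "ball q s \<union> (ball q r1 - {q}) = ball q r1"
      using s(1,2) r1(1) by auto
    ultimately show ?thesis by simp
  qed
  have "cmod ((deriv ^^ 1) (\<lambda>x. \<Phi> x - q) q) \<le> fact 1 * (r / 2) / r ^ 1"
  proof (rule Cauchy_inequality)
    have hol: "(\<lambda>x. \<Phi> x - q) holomorphic_on ball q r1"
      by (intro holomorphic_intros hol\<Phi>)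
    then show "(\<lambda>x. \<Phi> x - q) holomorphic_on ball q r"
      using r by (auto intro: holomorphic_on_subset)
    show "continuous_on (cball q r) (\<lambda>x. \<Phi> x - q)"
      using r by (intro continuous_on_subset[OF holomorphic_on_imp_continuous_on[OF hol]]) auto
    fix x assume x: "cmod (q - x) = r"
    define y where "y = (x - q) / of_real r"
    have "cmod y = 1"
      using x r(1) by (simp add: y_def norm_divide norm_minus_commute)
    then obtain \<theta> where \<theta>: "0 \<le> \<theta>" "\<theta> < 2 * pi" "y = exp (\<i> * of_real \<theta>)"
      using Arg2pi_ge_0[of y] Arg2pi_lt_2pi[of y] Arg2pi_eq[of y] by (metis mult_1 of_real_1)
    define \<zeta> where "\<zeta> = Complex (- 1) \<theta>"
    have "\<zeta> = of_real (- 1) + \<i> * of_real \<theta>"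
      by (simp add: \<zeta>_def Complex_eq)
    then have "E \<zeta> = q + of_real r1 * (of_real (exp (- 1)) * exp (\<i> * of_real \<theta>))"
      by (simp only: E_def exp_add exp_of_real)
    also have "\<dots> = x"
      unfolding \<theta>(3)[symmetric] y_def using r1(1) by (simp add: r_def)
    finally have "\<Phi> x = \<phi> m \<zeta>"
      using \<Phi>E[of \<zeta>] arcL[of \<theta>] by (simp add: \<zeta>_def)
    moreover have "E' \<zeta> \<in> S"
      using \<theta>(1,2) by (auto simp: S_def \<zeta>_def)
    ultimately have "\<Phi> x \<in> ball q (r / 2)"
      using m[of "E' \<zeta>"] by (simp add: \<phi>_def)
    then show "cmod (\<Phi> x - q) \<le> r / 2"
      by (simp add: dist_norm norm_minus_commute)
  qed (rule r(1))
  moreover have "deriv (\<lambda>x. \<Phi> x - q) q = inverse lam ^ m"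
  proof -
    have "(\<Phi> has_field_derivative inverse lam ^ m) (at q)"
      by (rule has_field_derivative_transform_within_open[OF s(5) open_ball[of q s]])
        (use s(1) \<Phi>k in auto)
    then have "((\<lambda>x. \<Phi> x - q) has_field_derivative inverse lam ^ m - 0) (at q)"
      by (intro derivative_intros)
    then show ?thesis
      by (simp add: DERIV_imp_deriv)
  qed
  ultimately have half: "cmod (inverse lam ^ m) \<le> 1 / 2"
    using r(1) by simp
  show ?thesis
  proof (rule ccontr)
    assume "\<not> 1 < cmod (deriv G q)"
    then have "cmod lam \<le> 1" "lam \<noteq> 0"
      using G(4) by (auto simp: lam_def)
    then have "1 \<le> cmod (inverse lam)"
      by (simp add: norm_inverse one_le_inverse_iff)
    then have "1 \<le> cmod (inverse lam ^ m)"
      by (simp add: norm_power one_le_power)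
    then show False
      using half by simp
  qed
qed

section \<open>The dichotomy in the plane\<close>

text \<open>The middle alternative is convergence to the puncture at infinity, which this chart does
  not analyse further; it is excluded on the sphere by comparing two charts.\<close>

theorem plane_dichotomy:
  "(\<exists>p. cmod p < 1 \<and> h p = p \<and> (\<forall>z. cmod z < 1 \<longrightarrow> (\<lambda>n. (h ^^ n) z) \<longlonglongrightarrow> p)) \<or>
   (\<forall>z. cmod z < 1 \<longrightarrow> filterlim (\<lambda>n. \<pi> ((h ^^ n) z)) at_infinity sequentially) \<or>
   (\<exists>q\<in>Q. (\<forall>z. cmod z < 1 \<longrightarrow> (\<lambda>n. \<pi> ((h ^^ n) z)) \<longlonglongrightarrow> q) \<and>
      (\<exists>e>0. ball q e - {q} \<subseteq> U) \<and>
      (\<exists>G. G holomorphic_on insert q U \<and> (\<forall>u\<in>U. G u = g u) \<and> G q = q \<and> 1 < cmod (deriv G q)))"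
proof (cases "\<exists>p. cmod p < 1 \<and> h p = p")
  case True
  then show ?thesis
    using fixed_point_attracts by blast
next
  case nofix: False
  have 0: "cmod 0 < 1"
    by simp
  obtain p where p: "p \<in> punctures" "filterlim (\<lambda>n. \<pi> ((h ^^ n) 0)) (sphere_nhds p) sequentially"
    using converges_to_puncture[OF nofix 0] by blast
  have all: "filterlim (\<lambda>n. \<pi> ((h ^^ n) z)) (sphere_nhds p) sequentially" if "cmod z < 1" for z
    using limit_independent[OF 0 p that] .
  show ?thesis
  proof (cases p)
    case None
    then show ?thesis
      using all by (auto simp: sphere_nhds_def)
  next
    case (Some q)
    then have q: "q \<in> Q"
      using p by auto
    have lim: "(\<lambda>n. \<pi> ((h ^^ n) z)) \<longlonglongrightarrow> q" if "cmod z < 1" for z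
      using all[OF that] by (simp add: Some sphere_nhds_def)
    obtain e where e: "e > 0" "ball q e - {q} \<subseteq> U"
      using limit_isolated_in_compl[OF nofix 0 q lim[OF 0]] by blast
    obtain G where G: "G holomorphic_on insert q U" "\<And>u. u \<in> U \<Longrightarrow> G u = g u" "G q = q"
      using extends_to_limit[OF 0 q lim[OF 0] e] by blast
    have Gb: "G holomorphic_on ball q e"
      using e(2) by (intro holomorphic_on_subset[OF G(1)]) auto
    have "deriv G q \<noteq> 0"
      by (intro multiplier_nonzero[OF 0 q lim[OF 0] _ G(2,3)] holomorphic_on_imp_differentiable_at[OF Gb])
        (use e(1) in auto)
    then have "1 < cmod (deriv G q)"
      by (intro limit_repelling[OF 0 q lim[OF 0] e Gb G(2,3)])
    then show ?thesis
      using q lim e G by blast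
  qed
qed

end

section \<open>Transfer to the sphere\<close>

text \<open>An evenly covered neighbourhood is carried along by \<open>k\<close>, with the same
  sheets above it.\<close>

lemma covering_space_homeomorphism_compose:
  assumes cov: "covering_space c p S" and hom: "homeomorphism S T k k'"
  shows "covering_space c (k \<circ> p) T"
proof
  have k: "continuous_on S k" "k ` S = T" "\<And>x. x \<in> S \<Longrightarrow> k' (k x) = x"
    using hom by (auto simp: homeomorphism_def)
  have p: "continuous_on c p" "p ` c = S"
    using cov by (auto simp: covering_space_def)
  show "continuous_on c (k \<circ> p)"
    using k p by (intro continuous_on_compose) auto
  show "(k \<circ> p) ` c = T"
    using k p by (metis image_comp)
  fix y assume y: "y \<in> T"
  define x where "x = k' y"
  have x: "x \<in> S" "k x = y"
    using hom y by (auto simp: x_def homeomorphism_def)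
  have "\<exists>N. x \<in> N \<and> openin (top_of_set S) N \<and> (\<exists>v. \<Union>v = c \<inter> p -` N \<and>
      (\<forall>u \<in> v. openin (top_of_set c) u) \<and> pairwise disjnt v \<and> (\<forall>u \<in> v. \<exists>q. homeomorphism u N p q))"
    using cov x(1) by (simp only: covering_space_def)
  then obtain N v where N: "x \<in> N" "openin (top_of_set S) N" and v: "\<Union>v = c \<inter> p -` N"
    "\<forall>u \<in> v. openin (top_of_set c) u" "pairwise disjnt v" "\<forall>u \<in> v. \<exists>q. homeomorphism u N p q"
    by (elim exE conjE) (rule that)
  have NS: "N \<subseteq> S"
    using N(2) by (rule openin_imp_subset)
  have homN: "homeomorphism N (k ` N) k k'"
    using hom NS by (rule homeomorphism_of_subsets) auto
  show "\<exists>N'. y \<in> N' \<and> openin (top_of_set T) N' \<and>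
      (\<exists>v. \<Union>v = c \<inter> (k \<circ> p) -` N' \<and> (\<forall>u \<in> v. openin (top_of_set c) u) \<and>
        pairwise disjnt v \<and> (\<forall>u \<in> v. \<exists>q. homeomorphism u N' (k \<circ> p) q))"
  proof (intro exI[of _ "k ` N"] exI[of _ v] conjI)
    show "y \<in> k ` N"
      using N(1) x by blast
    show "openin (top_of_set T) (k ` N)"
      by (rule homeomorphism_imp_open_map[OF hom N(2)])
    have "(k \<circ> p) z \<in> k ` N \<longleftrightarrow> p z \<in> N" if "z \<in> c" for z
    proof -
      have "p z \<in> S"
        using that p(2) by blast
      then show ?thesis
        using k(3) NS by (metis comp_apply image_iff subsetD)
    qed
    then show "\<Union>v = c \<inter> (k \<circ> p) -` k ` N"
      unfolding v(1) by blast
    show "\<forall>u\<in>v. \<exists>q. homeomorphism u (k ` N) (k \<circ> p) q"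
      using v(4) homN homeomorphism_compose by blast
  qed (use v in auto)
qed

section \<open>The Moebius chart moving a finite point to infinity\<close>

lemma open_option_iff:
  fixes W :: "'a::topological_space option set"
  shows "open W \<longleftrightarrow> (\<exists>A. open A \<and> W = Some ` A) \<or>
    (\<exists>C. compact C \<and> closed C \<and> W = insert None (Some ` (- C)))"
  by (simp add: open_option_def openin_Alexandroff_compactification compactin_euclidean_iff Compl_eq_Diff_UNIV)

text \<open>The value at \<open>Some a\<close>, which should be infinity, is the junk value \<open>1 / 0 = 0\<close>.\<close>

definition to_plane :: "complex \<Rightarrow> riemann_sphere \<Rightarrow> complex" where
  "to_plane a p = (case p of None \<Rightarrow> 0 | Some z \<Rightarrow> 1 / (z - a))"

definition from_plane :: "complex \<Rightarrow> complex \<Rightarrow> riemann_sphere" where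
  "from_plane a y = (if y = 0 then None else Some (a + 1 / y))"

lemma to_from_plane [simp]: "to_plane a (from_plane a y) = y"
  by (simp add: to_plane_def from_plane_def)

lemma from_to_plane [simp]: "p \<noteq> Some a \<Longrightarrow> from_plane a (to_plane a p) = p"
  by (cases p) (auto simp: to_plane_def from_plane_def)

lemma from_plane_neq [simp]: "from_plane a y \<noteq> Some a" "Some a \<noteq> from_plane a y"
  by (simp_all add: from_plane_def)

lemma sphere_inverse_Some: "sphere_inverse (Some u) = from_plane 0 u"
  by (simp add: from_plane_def)

lemma continuous_from_plane: "continuous_on UNIV (from_plane a)"
  unfolding continuous_on_open_vimage[OF open_UNIV]
proof (intro allI impI)
  have cont: "continuous_on (- {0}) (\<lambda>y. a + 1 / y)"
    by (intro continuous_intros) auto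
  fix W :: "riemann_sphere set" assume "open W"
  then consider A where "open A" "W = Some ` A" | C where "compact C" "W = insert None (Some ` (- C))"
    by (auto simp: open_option_iff)
  then show "open (from_plane a -` W \<inter> UNIV)"
  proof cases
    case 1
    have "open (- {0} \<inter> (\<lambda>y. a + 1 / y) -` A)"
      by (rule continuous_open_preimage[OF cont _ 1(1)]) (simp add: open_Compl)
    moreover have "from_plane a -` W = - {0} \<inter> (\<lambda>y. a + 1 / y) -` A"
      by (auto simp: 1(2) from_plane_def split: if_splits)
    ultimately show ?thesis by simp
  next
    case 2
    obtain B where B: "B > 0" "\<And>x. x \<in> C \<Longrightarrow> cmod x \<le> B"
      using compact_imp_bounded[OF 2(1)] unfolding bounded_pos by blast
    \<comment> \<open>Chosen so that \<open>cmod y < d\<close> forces \<open>a + 1 / y\<close> to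
      have modulus above \<open>B\<close>, hence outside \<open>C\<close>.\<close>
    define d where "d = 1 / (B + cmod a + 1)"
    have Ba: "B + cmod a + 1 > 0"
      using B(1) by (simp add: add_pos_nonneg)
    have big: "a + 1 / y \<notin> C" if "cmod y < d" "y \<noteq> 0" for y
    proof
      assume "a + 1 / y \<in> C"
      then have "cmod (a + 1 / y) \<le> B"
        by (rule B(2))
      moreover have "cmod (1 / y) \<le> cmod (a + 1 / y) + cmod a"
        using norm_triangle_ineq4[of "a + 1 / y" a] by simp
      ultimately have "cmod (1 / y) \<le> B + cmod a"
        by simp
      moreover have "B + cmod a + 1 < 1 / cmod y"
        using that Ba by (simp add: d_def field_simps)
      ultimately show False
        by (simp add: norm_divide)
    qed
    have "open (- {0} \<inter> (\<lambda>y. a + 1 / y) -` (- C))"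
      by (rule continuous_open_preimage[OF cont]) (simp_all add: 2(1) compact_imp_closed open_Compl)
    then have "open (ball 0 d \<union> (- {0} \<inter> (\<lambda>y. a + 1 / y) -` (- C)))"
      by (intro open_Un open_ball)
    moreover have "from_plane a -` W = ball 0 d \<union> (- {0} \<inter> (\<lambda>y. a + 1 / y) -` (- C))"
    proof (rule set_eqI)
      fix y
      have "0 < d"
        using Ba by (simp add: d_def)
      then show "y \<in> from_plane a -` W \<longleftrightarrow> y \<in> ball 0 d \<union> (- {0} \<inter> (\<lambda>y. a + 1 / y) -` (- C))"
        using big[of y] by (cases "y = 0") (auto simp: 2(2) from_plane_def)
    qed
    ultimately show ?thesis by simp
  qed
qed

lemma continuous_to_plane: "continuous_on (- {Some a}) (to_plane a)"
proof -
  have openS: "open (- {Some a} :: riemann_sphere set)"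
    by (simp add: open_Compl)
  show ?thesis
    unfolding continuous_on_open_vimage[OF openS]
  proof (intro allI impI)
    fix B :: "complex set" assume B: "open B"
    define A where "A = - {a} \<inter> (\<lambda>z. 1 / (z - a)) -` B"
    have "continuous_on (- {a}) (\<lambda>z. 1 / (z - a))"
      by (intro continuous_intros) auto
    then have A: "open A"
      unfolding A_def using B by (intro continuous_open_preimage) (simp_all add: open_Compl)
    show "open (to_plane a -` B \<inter> - {Some a})"
    proof (cases "0 \<in> B")
      case False
      have "x \<in> to_plane a -` B \<inter> - {Some a} \<longleftrightarrow> x \<in> Some ` A" for x
        using False by (cases x) (auto simp: A_def to_plane_def)
      then have "to_plane a -` B \<inter> - {Some a} = Some ` A"
        by blast
      then show ?thesis
        using A open_option_iff by blast
    next
      case True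
      have eq: "x \<in> to_plane a -` B \<inter> - {Some a} \<longleftrightarrow> x \<in> insert None (Some ` A)" for x
        using True by (cases x) (auto simp: A_def to_plane_def)
      obtain e where e: "e > 0" "ball 0 e \<subseteq> B"
        using B True unfolding open_contains_ball by blast
      \<comment> \<open>The preimage now contains infinity, so openness requires the finite part of
        its complement to be compact; points far from \<open>a\<close> have image in the disc about
        0.\<close>
      have "- A \<subseteq> cball a (1 / e)"
      proof
        fix z assume z: "z \<in> - A"
        show "z \<in> cball a (1 / e)"
        proof (rule ccontr)
          assume "z \<notin> cball a (1 / e)"
          then have far: "1 / e < cmod (z - a)"
            by (simp add: dist_norm norm_minus_commute)
          then have "0 < cmod (z - a)"
            using e(1) by (meson less_trans zero_less_divide_1_iff)
          then have "z \<noteq> a" "cmod (1 / (z - a)) < e"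
            using far e(1) by (auto simp: norm_divide field_simps)
          then have "z \<in> A"
            using e(2) by (auto simp: A_def)
          then show False using z by simp
        qed
      qed
      then have "bounded (- A)"
        using bounded_cball bounded_subset by blast
      then have "compact (- A)"
        using A by (simp add: compact_eq_bounded_closed closed_Compl)
      moreover have "to_plane a -` B \<inter> - {Some a} = insert None (Some ` (- (- A)))"
        using eq by auto
      ultimately show ?thesis
        using open_option_iff[of "to_plane a -` B \<inter> - {Some a}"] compact_imp_closed by metis
    qed
  qed
qed

lemma homeomorphism_to_plane: "homeomorphism (- {Some a}) UNIV (to_plane a) (from_plane a)"
proof (rule homeomorphismI)
  show "continuous_on (- {Some a}) (to_plane a)" "continuous_on UNIV (from_plane a)"
    by (rule continuous_to_plane continuous_from_plane)+
qed auto

lemma open_from_plane_vimage: "open W \<Longrightarrow> open {y. from_plane a y \<in> W}"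
  using continuous_from_plane[of a] unfolding continuous_on_open_vimage[OF open_UNIV] by (simp add: vimage_def)

lemma open_Some_vimage:
  assumes "open (W :: riemann_sphere set)"
  shows "open {z. Some z \<in> W}"
proof -
  consider A where "open A" "W = Some ` A" | C where "closed C" "W = insert None (Some ` (- C))"
    using assms by (auto simp: open_option_iff)
  then show ?thesis
  proof cases
    case 1
    then have "{z. Some z \<in> W} = A" by auto
    then show ?thesis using 1 by simp
  next
    case 2
    then have "{z. Some z \<in> W} = - C" by auto
    then show ?thesis using 2 by (simp add: open_Compl)
  qed
qed

section \<open>Holomorphy in the Moebius chart\<close>

text \<open>At finite values the chart is \<open>1 / (w - a)\<close>; in the coordinate
  \<open>u = 1 / w\<close> it becomes \<open>u / (1 - a * u)\<close>. The two open sets where these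
  formulas apply cover \<open>A\<close>.\<close>

lemma to_plane_holomorphic:
  assumes f: "holomorphic_to_sphere_on f A" and A: "open A" and a: "\<And>z. z \<in> A \<Longrightarrow> f z \<noteq> Some a"
  shows "(\<lambda>z. to_plane a (f z)) holomorphic_on A"
proof -
  define A1 A2 where "A1 = {z \<in> A. f z \<noteq> None}" and "A2 = {z \<in> A. f z \<noteq> Some 0}"
  have cont: "continuous_on A f" and hol: "(the \<circ> f) holomorphic_on A1" "(the \<circ> sphere_inverse \<circ> f) holomorphic_on A2"
    using f by (auto simp: holomorphic_to_sphere_on_def A1_def A2_def)
  have "A1 = A \<inter> f -` (- {None})" "A2 = A \<inter> f -` (- {Some 0})"
    by (auto simp: A1_def A2_def)
  then have op: "open A1" "open A2"
    using cont A by (auto intro!: continuous_open_preimage open_Compl)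
  have "(\<lambda>z. 1 / ((the \<circ> f) z - a)) holomorphic_on A1"
    using a by (intro holomorphic_intros hol) (auto simp: A1_def)
  then have 1: "(\<lambda>z. to_plane a (f z)) holomorphic_on A1"
    by (rule holomorphic_transform) (auto simp: A1_def to_plane_def)
  define u where "u = the \<circ> sphere_inverse \<circ> f"
  have u: "1 - a * u z \<noteq> 0 \<and> u z / (1 - a * u z) = to_plane a (f z)" if "z \<in> A2" for z
  proof (cases "f z")
    case None
    then show ?thesis by (simp add: u_def to_plane_def)
  next
    case (Some w)
    then have "w \<noteq> 0" "w \<noteq> a"
      using that a[of z] by (auto simp: A2_def)
    then show ?thesis
      using Some by (simp add: u_def to_plane_def field_simps)
  qed
  have "(\<lambda>z. u z / (1 - a * u z)) holomorphic_on A2"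
    by (intro holomorphic_intros hol(2)[folded u_def]) (use u in auto)
  then have 2: "(\<lambda>z. to_plane a (f z)) holomorphic_on A2"
    by (rule holomorphic_transform) (use u in auto)
  have "A = A1 \<union> A2"
    by (auto simp: A1_def A2_def)
  then show ?thesis
    using holomorphic_on_Un[OF 1 2 op] by simp
qed

lemma from_plane_holomorphic:
  assumes f: "f holomorphic_on A"
  shows "holomorphic_to_sphere_on (\<lambda>z. from_plane a (f z)) A"
  unfolding holomorphic_to_sphere_on_def
proof (intro conjI)
  show "continuous_on A (\<lambda>z. from_plane a (f z))"
    by (rule continuous_on_compose2[OF continuous_from_plane holomorphic_on_imp_continuous_on[OF f]]) simp
  have "(\<lambda>z. a + 1 / f z) holomorphic_on {z \<in> A. f z \<noteq> 0}"
    by (intro holomorphic_intros holomorphic_on_subset[OF f]) auto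
  then have "(the \<circ> (\<lambda>z. from_plane a (f z))) holomorphic_on {z \<in> A. f z \<noteq> 0}"
    by (rule holomorphic_transform) (auto simp: from_plane_def)
  then show "(the \<circ> (\<lambda>z. from_plane a (f z))) holomorphic_on {z \<in> A. from_plane a (f z) \<noteq> None}"
    by (rule holomorphic_on_subset) (auto simp: from_plane_def)
  have *: "1 + a * y \<noteq> 0 \<and> y / (1 + a * y) = the (sphere_inverse (from_plane a y))"
    if "from_plane a y \<noteq> Some 0" for y
    using that by (auto simp: from_plane_def field_simps split: if_splits)
  have "(\<lambda>z. f z / (1 + a * f z)) holomorphic_on {z \<in> A. from_plane a (f z) \<noteq> Some 0}"
    using * by (intro holomorphic_intros holomorphic_on_subset[OF f]) auto
  then show "(the \<circ> sphere_inverse \<circ> (\<lambda>z. from_plane a (f z)))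
      holomorphic_on {z \<in> A. from_plane a (f z) \<noteq> Some 0}"
    by (rule holomorphic_transform) (use * in auto)
qed

lemma sphere_inverse_chart:
  assumes "1 + a * y \<noteq> 0"
  shows "sphere_inverse (Some (y / (1 + a * y))) = from_plane a y"
  using assms by (auto simp: from_plane_def field_simps)

text \<open>At \<open>a * u = 1\<close> both sides take the junk value 0, so the identity is
  unconditional.\<close>

lemma chart_sphere_inverse:
  shows "to_plane a (sphere_inverse (Some u)) = u / (1 - a * u)"
  by (auto simp: to_plane_def field_simps)

lemma chart_from_plane:
  assumes "1 + a * y \<noteq> 0"
  shows "the (sphere_inverse (from_plane a y)) = y / (1 + a * y)"
proof (cases "y = 0")
  case False
  then have "a + 1 / y = (1 + a * y) / y"
    by (simp add: field_simps)
  then show ?thesis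
    using assms False by (simp add: from_plane_def)
qed (simp add: from_plane_def)

text \<open>Away from \<open>y = 0\<close> the map is read through the finite chart of the sphere,
  and away from \<open>1 + a * y = 0\<close> through the chart at infinity. The two conditions
  cannot fail together.\<close>

lemma plane_map_holomorphic:
  assumes g: "sphere_holomorphic_on g U" and U: "open U" "Some a \<notin> U" "\<And>u. u \<in> U \<Longrightarrow> g u \<noteq> Some a"
  shows "(\<lambda>y. to_plane a (g (from_plane a y))) holomorphic_on {y. from_plane a y \<in> U}"
proof -
  define Y Y1 Y2 where "Y = {y. from_plane a y \<in> U}" and "Y1 = Y - {0}" and "Y2 = Y \<inter> {y. 1 + a * y \<noteq> 0}"
  have "open Y"
    unfolding Y_def by (rule open_from_plane_vimage[OF U(1)])
  moreover have "open {y. 1 + a * y \<noteq> 0}"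
    by (intro open_Collect_neq continuous_intros)
  ultimately have op: "open Y1" "open Y2"
    by (auto simp: Y1_def Y2_def)
  have hol: "holomorphic_to_sphere_on (g \<circ> Some) {z. Some z \<in> U}"
    "holomorphic_to_sphere_on (g \<circ> sphere_inverse \<circ> Some) {z. sphere_inverse (Some z) \<in> U}"
    using g unfolding sphere_holomorphic_on_def by blast+
  have g1: "(\<lambda>z. to_plane a ((g \<circ> Some) z)) holomorphic_on {z. Some z \<in> U}"
    by (rule to_plane_holomorphic[OF hol(1) open_Some_vimage[OF U(1)]]) (use U(3) in auto)
  have "open {u. sphere_inverse (Some u) \<in> U}"
    using open_from_plane_vimage[OF U(1), of 0] by (simp add: sphere_inverse_Some del: sphere_inverse.simps)
  then have g2: "(\<lambda>z. to_plane a ((g \<circ> sphere_inverse \<circ> Some) z)) holomorphic_on {u. sphere_inverse (Some u) \<in> U}"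
    by (rule to_plane_holomorphic[OF hol(2)]) (use U(3) in auto)
  have "((\<lambda>z. to_plane a ((g \<circ> Some) z)) \<circ> (\<lambda>y. a + 1 / y)) holomorphic_on Y1"
    by (intro holomorphic_on_compose_gen[OF _ g1] holomorphic_intros)
      (auto simp: Y1_def Y_def from_plane_def)
  then have 1: "(\<lambda>y. to_plane a (g (from_plane a y))) holomorphic_on Y1"
    by (rule holomorphic_transform) (auto simp: Y1_def from_plane_def)
  have "((\<lambda>z. to_plane a ((g \<circ> sphere_inverse \<circ> Some) z)) \<circ> (\<lambda>y. y / (1 + a * y))) holomorphic_on Y2"
    by (intro holomorphic_on_compose_gen[OF _ g2] holomorphic_intros)
      (auto simp: Y2_def Y_def sphere_inverse_chart simp del: sphere_inverse.simps)
  then have 2: "(\<lambda>y. to_plane a (g (from_plane a y))) holomorphic_on Y2"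
    by (rule holomorphic_transform) (auto simp: Y2_def sphere_inverse_chart simp del: sphere_inverse.simps)
  have "Y = Y1 \<union> Y2"
    by (auto simp: Y1_def Y2_def)
  then show ?thesis
    using holomorphic_on_Un[OF 1 2 op] by (simp add: Y_def)
qed

lemma sphere_map_holomorphic:
  assumes G: "G holomorphic_on to_plane a ` W" and W: "Some a \<notin> W"
  shows "sphere_holomorphic_on (\<lambda>p. from_plane a (G (to_plane a p))) W"
  unfolding sphere_holomorphic_on_def
proof
  have "(G \<circ> (\<lambda>z. to_plane a (Some z))) holomorphic_on {z. Some z \<in> W}"
  proof (rule holomorphic_on_compose_gen[OF _ G])
    show "(\<lambda>z. to_plane a (Some z)) holomorphic_on {z. Some z \<in> W}"
      unfolding to_plane_def option.case using W by (intro holomorphic_intros) auto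
  qed auto
  then show "holomorphic_to_sphere_on ((\<lambda>p. from_plane a (G (to_plane a p))) \<circ> Some) {z. Some z \<in> W}"
    using from_plane_holomorphic by (fastforce simp: o_def)
  have "1 - a * u \<noteq> 0" if "sphere_inverse (Some u) \<in> W" for u
  proof
    assume "1 - a * u = 0"
    then have "a * u = 1"
      by simp
    then have "u \<noteq> 0" "1 / u = a"
      by (auto simp: divide_eq_eq)
    then show False
      using that W by simp
  qed
  then have "(\<lambda>u. u / (1 - a * u)) holomorphic_on {u. sphere_inverse (Some u) \<in> W}"
    by (intro holomorphic_intros) auto
  then have "(\<lambda>u. to_plane a (sphere_inverse (Some u))) holomorphic_on {u. sphere_inverse (Some u) \<in> W}"
    by (simp only: chart_sphere_inverse)
  then have "(G \<circ> (\<lambda>u. to_plane a (sphere_inverse (Some u)))) holomorphic_on {u. sphere_inverse (Some u) \<in> W}"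
    by (rule holomorphic_on_compose_gen[OF _ G]) auto
  then show "holomorphic_to_sphere_on ((\<lambda>p. from_plane a (G (to_plane a p))) \<circ> sphere_inverse \<circ> Some)
      {z. sphere_inverse (Some z) \<in> W}"
    using from_plane_holomorphic by (fastforce simp: o_def simp del: sphere_inverse.simps)
qed

section \<open>Multipliers and repelling fixed points under the chart\<close>

text \<open>The derivatives of the coordinate change \<open>S\<close> and of its inverse
  \<open>T\<close> cancel at the fixed point: both are 1 at infinity, and they are -q^2 and -1/q^2
  at a finite point.\<close>

lemma multiplier_conjugate:
  assumes x: "x \<noteq> Some a" and Gq: "G (to_plane a x) = to_plane a x"
    and der: "(G has_field_derivative c) (at (to_plane a x))"
  shows "multiplier (\<lambda>p. from_plane a (G (to_plane a p))) x = c"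
proof (cases x)
  case None
  have q: "to_plane a x = 0"
    by (simp add: None to_plane_def)
  define T S where "T = (\<lambda>y. y / (1 + a * y))" and "S = (\<lambda>u. u / (1 - a * u))"
  have S: "(S has_field_derivative 1) (at 0)"
    unfolding S_def by (auto intro!: derivative_eq_intros)
  have T: "(T has_field_derivative 1) (at 0)"
    unfolding T_def by (auto intro!: derivative_eq_intros)
  have G0: "(G has_field_derivative c) (at 0)" "G 0 = 0"
    using der Gq by (simp_all add: q)
  have S0: "S 0 = 0"
    by (simp add: S_def)
  have GS: "((G \<circ> S) has_field_derivative c * 1) (at 0)"
    by (rule DERIV_chain) (use S G0 in \<open>simp_all add: S0\<close>)

  have TGS: "((T \<circ> (G \<circ> S)) has_field_derivative 1 * (c * 1)) (at 0)"
    by (rule DERIV_chain) (use GS T in \<open>simp_all add: S0 G0\<close>)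
  have "((\<lambda>u. 1 + a * (G \<circ> S) u) \<longlongrightarrow> 1 + a * (G \<circ> S) 0) (at 0)"
    using DERIV_isCont[OF GS] by (intro tendsto_intros) (simp add: isCont_def o_def)
  then have "\<forall>\<^sub>F u in at 0. 1 + a * (G \<circ> S) u \<noteq> 0"
    by (rule tendsto_imp_eventually_ne) (simp add: S0 G0)
  then have ev: "\<forall>\<^sub>F u in nhds 0. 1 + a * (G \<circ> S) u \<noteq> 0"
    unfolding eventually_at_filter by (rule eventually_mono) (use S0 G0 in auto)
  have eq: "(the \<circ> sphere_inverse \<circ> (\<lambda>p. from_plane a (G (to_plane a p))) \<circ> sphere_inverse \<circ> Some) u
      = (T \<circ> (G \<circ> S)) u" if "1 + a * (G \<circ> S) u \<noteq> 0" for u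
  proof -
    show ?thesis
      using that by (simp add: chart_sphere_inverse chart_from_plane S_def T_def del: sphere_inverse.simps)
  qed
  have "\<forall>\<^sub>F u in nhds 0. (the \<circ> sphere_inverse \<circ> (\<lambda>p. from_plane a (G (to_plane a p))) \<circ> sphere_inverse \<circ> Some) u
      = (T \<circ> (G \<circ> S)) u"
    using ev by (rule eventually_mono) (rule eq)
  then have "deriv (the \<circ> sphere_inverse \<circ> (\<lambda>p. from_plane a (G (to_plane a p))) \<circ> sphere_inverse \<circ> Some) 0
      = deriv (T \<circ> (G \<circ> S)) 0"
    by (rule deriv_cong_ev) simp
  also have "\<dots> = c"
    using DERIV_imp_deriv[OF TGS] by simp
  finally show ?thesis
    by (simp add: multiplier_def None)
next
  case (Some z)
  then have za: "z \<noteq> a"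
    using x by simp
  define q where "q = 1 / (z - a)"
  have q: "to_plane a x = q" "q \<noteq> 0"
    using za by (simp_all add: Some to_plane_def q_def)
  define S where "S = (\<lambda>w. 1 / (w - a))"
  have S: "(S has_field_derivative - (q\<^sup>2)) (at z)"
    unfolding S_def using za by (auto intro!: derivative_eq_intros simp: q_def power2_eq_square)
  have Sz: "S z = q"
    by (simp add: S_def q_def)
  have Gq': "(G has_field_derivative c) (at q)" "G q = q"
    using der Gq q by simp_all
  have GS: "((G \<circ> S) has_field_derivative c * - (q\<^sup>2)) (at z)"
    by (rule DERIV_chain) (use S Gq' in \<open>simp_all add: Sz\<close>)
  define T where "T = (\<lambda>y. a + 1 / y)"
  have T: "(T has_field_derivative - (1 / q\<^sup>2)) (at q)"
    unfolding T_def using q(2) by (auto intro!: derivative_eq_intros simp: power2_eq_square)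
  have TGS: "((T \<circ> (G \<circ> S)) has_field_derivative - (1 / q\<^sup>2) * (c * - (q\<^sup>2))) (at z)"
    by (rule DERIV_chain) (use GS T in \<open>simp_all add: Sz Gq'\<close>)
  have "((G \<circ> S) \<longlongrightarrow> (G \<circ> S) z) (at z)"
    using DERIV_isCont[OF GS] by (simp add: isCont_def)
  then have "\<forall>\<^sub>F w in at z. (G \<circ> S) w \<noteq> 0"
    by (rule tendsto_imp_eventually_ne) (use q(2) Gq'(2) Sz in auto)
  then have ev: "\<forall>\<^sub>F w in nhds z. (G \<circ> S) w \<noteq> 0"
    unfolding eventually_at_filter by (rule eventually_mono) (use q(2) Gq'(2) Sz in auto)
  have "\<forall>\<^sub>F w in nhds z. (the \<circ> (\<lambda>p. from_plane a (G (to_plane a p))) \<circ> Some) w = (T \<circ> (G \<circ> S)) w"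
    using ev by (rule eventually_mono) (auto simp: from_plane_def to_plane_def T_def S_def)
  then have "deriv (the \<circ> (\<lambda>p. from_plane a (G (to_plane a p))) \<circ> Some) z = deriv (T \<circ> (G \<circ> S)) z"
    by (rule deriv_cong_ev) simp
  also have "\<dots> = c"
    using DERIV_imp_deriv[OF TGS] q(2) by simp
  finally show ?thesis
    by (simp add: multiplier_def Some)
qed

lemma repelling_from_plane:
  assumes U: "open U" "Some a \<notin> U" and x: "x \<notin> U" "x \<noteq> Some a"
    and e: "e > 0" "ball (to_plane a x) e - {to_plane a x} \<subseteq> to_plane a ` U"
    and g: "\<And>u. u \<in> U \<Longrightarrow> g u \<noteq> Some a"
    and G: "G holomorphic_on to_plane a ` insert x U"
      "\<And>u. u \<in> U \<Longrightarrow> G (to_plane a u) = to_plane a (g u)"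
      "G (to_plane a x) = to_plane a x" "1 < cmod (deriv G (to_plane a x))"
  shows "repelling_fixed_point U g x"
proof -
  define q where "q = to_plane a x"
  \<comment> \<open>\<open>Some a\<close> must be removed explicitly, because its junk image 0 may
    lie in the ball.\<close>
  define N where "N = to_plane a -` ball q e \<inter> - {Some a}"
  have openS: "open (- {Some a} :: riemann_sphere set)"
    by (simp add: open_Compl)
  have N: "open N"
    using continuous_to_plane[of a] unfolding continuous_on_open_vimage[OF openS] N_def by simp
  have xN: "x \<in> N"
    using x(2) e(1) by (simp add: N_def q_def)
  have NU: "N - {x} \<subseteq> U"
  proof
    fix p assume p: "p \<in> N - {x}"
    then have pa: "p \<noteq> Some a"
      by (simp add: N_def)
    have "to_plane a p \<noteq> q"
      using p pa x(2) from_to_plane unfolding q_def by (metis DiffD2 singletonI)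
    then obtain u where u: "u \<in> U" "to_plane a p = to_plane a u"
      using p e(2) by (auto simp: N_def q_def)
    then have "p = u"
      using pa U(2) from_to_plane by metis
    then show "p \<in> U"
      using u by simp
  qed
  let ?G = "\<lambda>p. from_plane a (G (to_plane a p))"
  have "removable_extension U g x ?G"
    unfolding removable_extension_def
  proof (intro conjI)
    show "\<exists>N. open N \<and> x \<in> N \<and> N - {x} \<subseteq> U"
      using N xN NU by blast
    show "sphere_holomorphic_on ?G (insert x U)"
      using U x by (intro sphere_map_holomorphic G(1)) auto
    show "\<forall>u\<in>U. ?G u = g u"
      using G(2) g by simp
  qed (rule x(1))
  moreover have "?G x = x"
    using G(3) x(2) by simp
  moreover have "multiplier ?G x = deriv G q"
    unfolding q_def
  proof (rule multiplier_conjugate[where G = G and x = x and a = a])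
    have "ball q e \<subseteq> to_plane a ` insert x U"
      using e(2) by (auto simp: q_def)
    then have "G holomorphic_on ball q e"
      by (rule holomorphic_on_subset[OF G(1)])
    then show "(G has_field_derivative deriv G (to_plane a x)) (at (to_plane a x))"
      using e(1) by (intro holomorphic_derivI[of G "ball q e"]) (auto simp: q_def)
  qed (use x(2) G(3) in auto)
  ultimately show ?thesis
    using G(4) unfolding repelling_fixed_point_def q_def by auto
qed

section \<open>The dichotomy on the sphere\<close>

text \<open>Conjugation by the chart at the puncture \<open>Some a\<close> gives an instance of
  \<open>lifted_inverse\<close>, whose conclusions are then translated back.\<close>

lemma chart_dichotomy:
  fixes h :: "complex \<Rightarrow> complex"
    and \<pi> :: "complex \<Rightarrow> riemann_sphere"
    and g :: "riemann_sphere \<Rightarrow> riemann_sphere"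
    and P U :: "riemann_sphere set"
  assumes h: "h holomorphic_on ball 0 1" "h ` ball 0 1 \<subseteq> ball 0 1"
    and P: "finite P" "3 \<le> card P"
    and U: "open U" "U \<subseteq> - P"
    and \<pi>: "holomorphic_to_sphere_on \<pi> (ball 0 1)" "covering_space (ball 0 1) \<pi> (- P)"
    and g: "sphere_holomorphic_on g U" "g ` U = - P"
    and range: "\<pi> ` h ` ball 0 1 \<subseteq> U"
    and semiconj: "\<forall>z\<in>ball 0 1. \<pi> z = g (\<pi> (h z))"
    and noninj: "\<not> inj_on g U"
    and a: "Some a \<in> P"
  shows "(\<exists>p. cmod p < 1 \<and> h p = p \<and> (\<forall>z. cmod z < 1 \<longrightarrow> (\<lambda>n. (h ^^ n) z) \<longlonglongrightarrow> p)) \<or>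
    (\<forall>z. cmod z < 1 \<longrightarrow> filterlim (\<lambda>n. to_plane a (\<pi> ((h ^^ n) z))) at_infinity sequentially) \<or>
    (\<exists>x\<in>P. repelling_fixed_point U g x \<and> (\<forall>z. cmod z < 1 \<longrightarrow> (\<lambda>n. \<pi> ((h ^^ n) z)) \<longlonglongrightarrow> x))"
proof -
  let ?\<mu> = "to_plane a" and ?\<nu> = "from_plane a"
  define Q where "Q = ?\<mu> ` (P - {Some a})"
  define U' where "U' = ?\<mu> ` U"
  define \<pi>' where "\<pi>' z = ?\<mu> (\<pi> z)" for z
  define g' where "g' y = ?\<mu> (g (?\<nu> y))" for y
  have inj: "inj_on ?\<mu> (- {Some a})"
    by (rule inj_on_inverseI[of _ ?\<nu>]) simp
  have aU: "Some a \<notin> U"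
    using U(2) a by blast
  have U'_eq: "U' = {y. ?\<nu> y \<in> U}"
  proof (rule set_eqI)
    fix y
    have "?\<nu> (?\<mu> u) \<in> U" if "u \<in> U" for u
    proof -
      have "u \<noteq> Some a"
        using that aU by blast
      then show ?thesis using that by simp
    qed
    then show "y \<in> U' \<longleftrightarrow> y \<in> {y. ?\<nu> y \<in> U}"
      unfolding U'_def by (auto intro: image_eqI[of _ _ "?\<nu> y"])
  qed
  have "UNIV = ?\<mu> ` (- {Some a})"
    using homeomorphism_to_plane[of a] by (simp add: homeomorphism_def)
  also have "\<dots> - Q = ?\<mu> ` (- {Some a} - (P - {Some a}))"
    unfolding Q_def using inj_on_image_set_diff[OF inj, of "- {Some a}" "P - {Some a}"] by auto
  also have "- {Some a} - (P - {Some a}) = - P"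
    using a by auto
  finally have \<mu>V: "?\<mu> ` (- P) = - Q"
    by (simp add: Compl_eq_Diff_UNIV)
  have \<pi>V: "\<pi> z \<in> - P" if "cmod z < 1" for z
    using covering_space_imp_surjective[OF \<pi>(2)] that by (metis imageI mem_ball_0)
  have \<pi>a: "\<pi> z \<noteq> Some a" if "cmod z < 1" for z
  proof
    assume "\<pi> z = Some a"
    with \<pi>V[OF that] a show False by simp
  qed
  have ga: "g u \<noteq> Some a" if "u \<in> U" for u
  proof
    assume "g u = Some a"
    moreover have "g u \<in> - P"
      using imageI[OF that, of g] unfolding g(2) .
    ultimately show False
      using a by simp
  qed
  have Q: "finite Q" "2 \<le> card Q"
  proof -
    show "finite Q"
      unfolding Q_def using P(1) by (intro finite_imageI finite_Diff)
    have "card Q = card (P - {Some a})"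
      unfolding Q_def by (intro card_image inj_on_subset[OF inj]) auto
    then show "2 \<le> card Q"
      using P a by simp
  qed
  have U': "open U'" "U' \<subseteq> - Q"
  proof -
    show "open U'"
      unfolding U'_eq by (rule open_from_plane_vimage[OF U(1)])
    show "U' \<subseteq> - Q"
      unfolding U'_def \<mu>V[symmetric] using U(2) by (rule image_mono)
  qed
  have hol\<pi>': "\<pi>' holomorphic_on ball 0 1"
    unfolding \<pi>'_def[abs_def] using \<pi>(1) \<pi>a by (intro to_plane_holomorphic) auto
  have "homeomorphism (- P) (- Q) ?\<mu> ?\<nu>"
    by (rule homeomorphism_of_subsets[OF homeomorphism_to_plane[of a], where T'' = UNIV]) (use a \<mu>V in auto)
  from covering_space_homeomorphism_compose[OF \<pi>(2) this]
  have cov': "covering_space (ball 0 1) \<pi>' (- Q)"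
    by (simp add: \<pi>'_def[abs_def] o_def)
  have holg': "g' holomorphic_on U'"
    unfolding g'_def[abs_def] U'_eq using g(1) U(1) aU ga by (intro plane_map_holomorphic)
  have g'_\<mu>: "g' (?\<mu> u) = ?\<mu> (g u)" if "u \<in> U" for u
    using that aU by (metis from_to_plane g'_def)
  have "(\<lambda>u. g' (?\<mu> u)) ` U = (\<lambda>u. ?\<mu> (g u)) ` U"
    by (rule image_cong) (simp_all add: g'_\<mu>)
  then have "g' ` U' = ?\<mu> ` g ` U"
    by (simp add: U'_def image_image)
  then have g'_im: "g' ` U' = - Q"
    unfolding g(2) \<mu>V .
  \<comment> \<open>Otherwise \<open>g'\<close> would be a surjective self-map of the punctured
    plane, hence injective, and so would \<open>g\<close>.\<close>
  have proper: "U' \<noteq> - Q"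
  proof
    assume eq: "U' = - Q"
    have "inj_on g' U'"
      using surjective_self_map_injective[OF Q] holg' g'_im eq by simp
    have "inj_on g U"
    proof (rule inj_onI)
      fix u v assume uv: "u \<in> U" "v \<in> U" "g u = g v"
      then have "g' (?\<mu> u) = g' (?\<mu> v)"
        by (simp add: g'_\<mu>)
      then have "?\<mu> u = ?\<mu> v"
        using uv \<open>inj_on g' U'\<close> by (auto simp: inj_on_def U'_def)
      then show "u = v"
        using uv aU by (metis from_to_plane)
    qed
    with noninj show False ..
  qed
  have range': "\<pi> (h z) \<in> U" if "cmod z < 1" for z
    using range that by (auto simp: image_subset_iff)
  interpret L: lifted_inverse h \<pi>' g' U' Q
  proof
    show "\<pi>' (h z) \<in> U'" "g' (\<pi>' (h z)) = \<pi>' z" if "cmod z < 1" for z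
      using range'[OF that] semiconj that by (auto simp: \<pi>'_def U'_def g'_\<mu>)
    show "g' ` U' \<subseteq> - Q"
      by (simp only: g'_im order_refl)
  qed (fact h Q U' proper hol\<pi>' cov' holg')+
  show ?thesis
    using L.plane_dichotomy
  proof (elim disjE)
    assume "\<exists>p. cmod p < 1 \<and> h p = p \<and> (\<forall>z. cmod z < 1 \<longrightarrow> (\<lambda>n. (h ^^ n) z) \<longlonglongrightarrow> p)"
    then show ?thesis ..
  next
    assume "\<forall>z. cmod z < 1 \<longrightarrow> filterlim (\<lambda>n. \<pi>' ((h ^^ n) z)) at_infinity sequentially"
    then show ?thesis
      unfolding \<pi>'_def by (intro disjI2 disjI1)
  next
    assume "\<exists>q\<in>Q. (\<forall>z. cmod z < 1 \<longrightarrow> (\<lambda>n. \<pi>' ((h ^^ n) z)) \<longlonglongrightarrow> q) \<and>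
      (\<exists>e>0. ball q e - {q} \<subseteq> U') \<and>
      (\<exists>G. G holomorphic_on insert q U' \<and> (\<forall>u\<in>U'. G u = g' u) \<and> G q = q \<and> 1 < cmod (deriv G q))"
    then obtain q e G where q: "q \<in> Q" and lim: "\<And>z. cmod z < 1 \<Longrightarrow> (\<lambda>n. \<pi>' ((h ^^ n) z)) \<longlonglongrightarrow> q"
      and e: "e > 0" "ball q e - {q} \<subseteq> U'"
      and G: "G holomorphic_on insert q U'" "\<And>u. u \<in> U' \<Longrightarrow> G u = g' u" "G q = q" "1 < cmod (deriv G q)"
      by blast
    obtain x where x: "x \<in> P" "x \<noteq> Some a" "?\<mu> x = q"
      using q by (auto simp: Q_def)
    have "repelling_fixed_point U g x"
    proof (rule repelling_from_plane[OF U(1) aU _ x(2) e(1) _ ga])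
      show "x \<notin> U"
        using x(1) U(2) by blast
      show "ball (?\<mu> x) e - {?\<mu> x} \<subseteq> ?\<mu> ` U"
        using e(2) by (simp add: x(3) U'_def)
      show "G holomorphic_on ?\<mu> ` insert x U"
        using G(1) by (simp add: x(3) U'_def)
      show "G (?\<mu> u) = ?\<mu> (g u)" if "u \<in> U" for u
        using G(2)[of "?\<mu> u"] that by (simp add: U'_def g'_\<mu>)
    qed (simp_all only: x(3) G)
    moreover have "(\<lambda>n. \<pi> ((h ^^ n) z)) \<longlonglongrightarrow> x" if z: "cmod z < 1" for z
    proof -
      have "isCont ?\<nu> q"
        using continuous_from_plane[of a] by (simp add: continuous_on_eq_continuous_at)
      then have "(\<lambda>n. ?\<nu> (\<pi>' ((h ^^ n) z))) \<longlonglongrightarrow> ?\<nu> q"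
        using lim[OF z] by (rule isCont_tendsto_compose)
      moreover have "?\<nu> (\<pi>' ((h ^^ n) z)) = \<pi> ((h ^^ n) z)" for n
        using \<pi>a[OF L.iterate_norm[OF z]] by (simp add: \<pi>'_def)
      moreover have "?\<nu> q = x"
        using x by auto
      ultimately show ?thesis by simp
    qed
    ultimately show ?thesis
      using x(1) by blast
  qed
qed

theorem theorem3p10:
  fixes h :: "complex \<Rightarrow> complex"
    and \<pi> :: "complex \<Rightarrow> riemann_sphere"
    and g :: "riemann_sphere \<Rightarrow> riemann_sphere"
    and P U V :: "riemann_sphere set"
  assumes h: "h holomorphic_on ball 0 1" "h ` ball 0 1 \<subseteq> ball 0 1"
    and P: "finite P" "3 \<le> card P"
    and V: "V = UNIV - P"
    and U: "open U" "connected U" "U \<noteq> {}" "U \<subseteq> V"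
    and \<pi>: "holomorphic_to_sphere_on \<pi> (ball 0 1)" "covering_space (ball 0 1) \<pi> V"
    and g: "sphere_holomorphic_on g U" "covering_space U g V"
    and range: "\<pi> ` h ` ball 0 1 \<subseteq> U"
    and semiconj: "\<forall>z\<in>ball 0 1. \<pi> z = g (\<pi> (h z))"
    and noninj: "\<not> inj_on g U"
  shows "(\<exists>p\<in>ball 0 1. h p = p \<and> (\<forall>q\<in>ball 0 1. h q = q \<longrightarrow> q = p) \<and>
            (\<forall>z\<in>ball 0 1. (\<lambda>n. (h ^^ n) z) \<longlonglongrightarrow> p))
         \<noteq>
         (\<exists>x\<in>P. repelling_fixed_point U g x \<and>
            (\<forall>z\<in>ball 0 1. (\<lambda>n. \<pi> ((h ^^ n) z)) \<longlonglongrightarrow> x))"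
proof -
  have V': "V = - P"
    using V by (simp add: Compl_eq_Diff_UNIV)
  have "(\<exists>p\<in>ball 0 1. h p = p \<and> (\<forall>z\<in>ball 0 1. (\<lambda>n. (h ^^ n) z) \<longlonglongrightarrow> p)) \<or>
      (\<exists>x\<in>P. repelling_fixed_point U g x \<and> (\<forall>z\<in>ball 0 1. (\<lambda>n. \<pi> ((h ^^ n) z)) \<longlonglongrightarrow> x))"
  proof -
    \<comment> \<open>Even if infinity is a puncture, two finite ones remain, which provides two
      charts.\<close>
    have "\<not> card (P - {None}) \<le> Suc 0"
      using P by (cases "None \<in> P") auto
    then obtain x x' where "x \<in> P - {None}" "x' \<in> P - {None}" "x \<noteq> x'"
      using card_le_Suc0_iff_eq[of "P - {None}"] P(1) by auto
    then obtain a a' where a: "Some a \<in> P" "Some a' \<in> P" "a \<noteq> a'"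
      by (cases x; cases x') auto
    let ?thesis' = "(\<exists>p\<in>ball 0 1. h p = p \<and> (\<forall>z\<in>ball 0 1. (\<lambda>n. (h ^^ n) z) \<longlonglongrightarrow> p)) \<or>
      (\<exists>x\<in>P. repelling_fixed_point U g x \<and> (\<forall>z\<in>ball 0 1. (\<lambda>n. \<pi> ((h ^^ n) z)) \<longlonglongrightarrow> x))"
    have chart: "?thesis' \<or> filterlim (\<lambda>n. to_plane b (\<pi> ((h ^^ n) 0))) at_infinity sequentially"
      if "Some b \<in> P" for b
      using chart_dichotomy[OF h P U(1) _ \<pi>(1) _ g(1) _ range semiconj noninj that]
        U(4) \<pi>(2) covering_space_imp_surjective[OF g(2)] by (auto simp: V')
    \<comment> \<open>Escape to infinity in the chart at \<open>b\<close> means convergence to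
      \<open>Some b\<close>, which cannot hold for two different points.\<close>
    have False if "filterlim (\<lambda>n. to_plane a (\<pi> ((h ^^ n) 0))) at_infinity sequentially"
      "filterlim (\<lambda>n. to_plane a' (\<pi> ((h ^^ n) 0))) at_infinity sequentially"
    proof -
      define X where "X n = \<pi> ((h ^^ n) 0)" for n
      define d where "d = dist a a' / 2"
      have d: "d > 0"
        using a(3) by (simp add: d_def)
      have "\<forall>\<^sub>F n in sequentially. 1 / d < cmod (to_plane b (X n))" if "b = a \<or> b = a'" for b
        using that \<open>filterlim (\<lambda>n. to_plane a (\<pi> ((h ^^ n) 0))) at_infinity sequentially\<close>
          \<open>filterlim (\<lambda>n. to_plane a' (\<pi> ((h ^^ n) 0))) at_infinity sequentially\<close>
        unfolding X_def by (auto simp: filterlim_at_infinity_conv_norm_at_top filterlim_at_top_dense)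
      from this[of a] this[of a']
      have "\<forall>\<^sub>F n in sequentially. 1 / d < cmod (to_plane a (X n)) \<and> 1 / d < cmod (to_plane a' (X n))"
        by (simp add: eventually_conj)
      then obtain n where n: "1 / d < cmod (to_plane a (X n))" "1 / d < cmod (to_plane a' (X n))"
        using eventually_happens'[OF sequentially_bot] by blast
      \<comment> \<open>The junk value 0 at \<open>Some b\<close> and the value 0 at infinity are
        excluded by the lower bound, leaving a finite point close to \<open>b\<close>.\<close>
      have near: "\<exists>w. X n = Some w \<and> dist w b < d" if "1 / d < cmod (to_plane b (X n))" for b
      proof (cases "X n")
        case None
        then show ?thesis
          using that d by (simp add: to_plane_def divide_less_0_iff)
      next
        case (Some w)
        have "w \<noteq> b"
          using that d by (auto simp: Some to_plane_def divide_less_0_iff)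
        then have "cmod (w - b) < d"
          using that d by (simp add: Some to_plane_def norm_divide field_simps)
        then show ?thesis
          by (simp add: Some dist_norm)
      qed
      from near[OF n(1)] near[OF n(2)] obtain w where w: "dist w a < d" "dist w a' < d"
        by auto
      have "dist a a' \<le> dist w a + dist w a'"
        by (rule dist_triangle3)
      then show False
        using w by (simp add: d_def)
    qed
    then show ?thesis'
      using chart[OF a(1)] chart[OF a(2)] by blast
  qed
  moreover have "\<forall>q\<in>ball 0 1. h q = q \<longrightarrow> q = p"
    if lim: "\<forall>z\<in>ball 0 1. (\<lambda>n. (h ^^ n) z) \<longlonglongrightarrow> p" for p
  proof (intro ballI impI)
    fix q :: complex assume q: "q \<in> ball 0 1" "h q = q"
    have "(h ^^ n) q = q" for n
      by (induction n) (use q in auto)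
    then have "(\<lambda>n. q) \<longlonglongrightarrow> p"
      using bspec[OF lim q(1)] by simp
    then show "q = p"
      by (simp add: LIMSEQ_const_iff)
  qed
  \<comment> \<open>The alternatives exclude each other: convergence to \<open>p\<close> in the disc
    makes the projected orbit converge to \<open>\<pi> p\<close>, which lies in \<open>V\<close> and
    not in \<open>P\<close>.\<close>
  moreover have False
    if p: "p \<in> ball 0 1" "\<forall>z\<in>ball 0 1. (\<lambda>n. (h ^^ n) z) \<longlonglongrightarrow> p"
      and x: "x \<in> P" "\<forall>z\<in>ball 0 1. (\<lambda>n. \<pi> ((h ^^ n) z)) \<longlonglongrightarrow> x" for p x
  proof -
    have "isCont \<pi> p"
      using \<pi>(1) p(1) by (simp add: holomorphic_to_sphere_on_def continuous_on_eq_continuous_at)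
    moreover have "(\<lambda>n. (h ^^ n) 0) \<longlonglongrightarrow> p"
      using p(2) by simp
    ultimately have "(\<lambda>n. \<pi> ((h ^^ n) 0)) \<longlonglongrightarrow> \<pi> p"
      by (rule isCont_tendsto_compose)
    moreover have "(\<lambda>n. \<pi> ((h ^^ n) 0)) \<longlonglongrightarrow> x"
      using x(2) by simp
    ultimately have "\<pi> p = x"
      using LIMSEQ_unique by blast
    moreover have "\<pi> p \<in> V"
      using covering_space_imp_surjective[OF \<pi>(2)] p(1) by blast
    ultimately show False
      using x(1) V by simp
  qed
  ultimately show ?thesis
    by meson
qed

end
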